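(* For all integers $k\geq 1$ and $n\geq 0$, $$c\left(5^{2k-1}n+\frac{7\cdot 5^{2k-1}+1}{12}\right)\equiv 0 \pmod{5^{2k-1}},$$ $$c\left(5^{2k}n+\frac{11\cdot 5^{2k}+1}{12}\right)\equiv 0 \pmod{5^{2k}}.$$
   Context: Let $q=e^{2\pi i\tau}$ with $\mathrm{Im}\,\tau>0$, and $(a;q)_\infty=\prod_{n=0}^\infty(1-aq^n)$. The weight 2 Eisenstein series is $E_2(\tau)=1-24\sum_{n=1}^\infty \frac{nq^n}{1-q^n}$. The integers $c(n)$ are defined by $$\sum_{n=0}^\infty c(n)q^n=\frac{2E_2(2\tau)-E_2(\tau)}{(q^2;q^2)_\infty}.$$ *)

theory Defs
  imports "HOL-Analysis.Analysis" "HOL-Number_Theory.Cong"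
begin

definition nome :: "complex \<Rightarrow> complex" where
  "nome \<tau> = exp (2 * of_real pi * \<i> * \<tau>)"

definition qpoch_inf :: "complex \<Rightarrow> complex \<Rightarrow> complex" where
  "qpoch_inf a q = (\<Prod>n. 1 - a * q ^ n)"

text \<open>The sum over \<open>n \<ge> 1\<close> is indexed from \<open>0\<close> by the shift \<open>n \<mapsto> Suc n\<close>.\<close>

definition eisenstein_E2 :: "complex \<Rightarrow> complex" where
  "eisenstein_E2 \<tau> =
     1 - 24 * (\<Sum>n. of_nat (Suc n) * nome \<tau> ^ Suc n / (1 - nome \<tau> ^ Suc n))"

text \<open>
  \<open>generates_c c\<close> says that \<open>c\<close> is the integer sequence defined by the generating function
  \<open>(2 E\<^sub>2(2\<tau>) - E\<^sub>2(\<tau>)) / (q\<^sup>2; q\<^sup>2)\<^sub>\<infinity>\<close> with \<open>q = exp (2\<pi>i\<tau>)\<close>.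
  The identity is required on the whole upper half-plane, i.e. for all \<open>q\<close> with \<open>0 < |q| < 1\<close>,
  so it determines \<open>c\<close> uniquely.
\<close>

definition generates_c :: "(nat \<Rightarrow> int) \<Rightarrow> bool" where
  "generates_c c \<longleftrightarrow>
     (\<forall>\<tau>. Im \<tau> > 0 \<longrightarrow>
        (\<lambda>n. of_int (c n) * nome \<tau> ^ n) sums
          ((2 * eisenstein_E2 (2 * \<tau>) - eisenstein_E2 \<tau>)
             / qpoch_inf (nome \<tau> ^ 2) (nome \<tau> ^ 2)))"

text \<open>The divisions by 12 below are exact, so \<open>div\<close> on natural numbers is genuine division.\<close>

lemma index_odd_dvd:
  assumes "k \<ge> 1"
  shows "(12 :: nat) dvd 7 * 5 ^ (2 * k - 1) + 1"
proof -
  obtain j where "k = Suc j" using assms by (cases k) auto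
  moreover have "(12 :: nat) dvd 7 * 5 ^ (2 * j + 1) + 1"
  proof (induction j)
    case (Suc j)
    have "(7 * 5 ^ (2 * Suc j + 1) + 1 :: nat)
            = 25 * (7 * 5 ^ (2 * j + 1) + 1) - 12 * 2" by simp
    then show ?case using Suc by (metis dvd_diff_nat dvd_mult dvd_triv_left)
  qed simp
  ultimately show ?thesis by simp
qed

lemma index_even_dvd: "(12 :: nat) dvd 11 * 5 ^ (2 * k) + 1"
proof (induction k)
  case (Suc k)
  have "(11 * 5 ^ (2 * Suc k) + 1 :: nat) = 25 * (11 * 5 ^ (2 * k) + 1) - 12 * 2" by simp
  then show ?case using Suc by (metis dvd_diff_nat dvd_mult dvd_triv_left)
qed simp

end

theory Submission
  imports Defs "HOL-Complex_Analysis.Complex_Analysis"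
begin

text \<open>
  Write \<open>E(\<tau>) = 2 E\<^sub>2(2\<tau>) - E\<^sub>2(\<tau>)\<close>, \<open>E5(\<tau>) = E(5\<tau>)\<close>, \<open>Z = \<eta>(50\<tau>)/\<eta>(2\<tau>)\<close>, \<open>t = (\<eta>(10\<tau>)/\<eta>(2\<tau>))\<^sup>6\<close>, and let
  \<open>U5\<close> keep the coefficients of the powers \<open>q\<close> to the \<open>5n\<close>. Starting from \<open>E\<close>, apply \<open>f \<mapsto> U5 (Z f)\<close> and \<open>f \<mapsto> U5 f\<close>
  alternately: up to an invertible integral series, the \<open>m\<close>-th result is the generating function
  of the values of \<open>c\<close> in the \<open>m\<close>-th progression.

  All these series have the form \<open>E \<alpha>(t) + E5 \<beta>(t)\<close>. The reason is that \<open>E\<close> and \<open>E5\<close> are logarithmic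
  derivatives of eta quotients, hence rational multiples of the logarithmic derivative of Ramanujan's
  parameter \<open>k = R(q) R(q\<^sup>2)\<^sup>2\<close>, with \<open>R\<close> the Rogers--Ramanujan continued fraction, while the 5-dissection
  of Euler's product expresses \<open>Z\<close> through \<open>R\<close>. So \<open>U5 (E / Z\<^sup>j)\<close> for \<open>0 \<le> j \<le> 4\<close> comes down to identities
  between rational functions of \<open>k\<close>, and the quintic equation of \<open>Z\<close> yields \<open>U5 (E Z\<^sup>m)\<close> by recursion.
  The orders at 5 of the coefficients obey bounds like those in Watson's proof of Ramanujan's
  congruences, and every application of \<open>U5\<close> gains a factor 5.
\<close>

section \<open>The Jacobi triple product\<close>

text \<open>The obstacle is that \<open>U5 E = 6 * E - 5 * E5\<close> is congruent to
  \<open>E\<close> modulo 5, so a bare multiple of \<open>E\<close> need not gain a factor 5. The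
  difference \<open>D = E - E5\<close> does: \<open>U5 D = 5 * D\<close>. The bounds therefore have
  to show two things at once: terms free of \<open>t\<close> occur only as multiples of
  \<open>D\<close>, and terms containing \<open>t\<close> carry enough powers of 5. The difference
  appears because, among the \<open>U5 (E * y ^ j)\<close> with \<open>y = 1 / Z\<close> and
  \<open>j\<close> at most 4, only \<open>j = 3\<close> has a pole at the cusp, namely
  \<open>(E - E5) / t\<close>; the recursion multiplies by \<open>t\<close> and leaves exactly
  \<open>D\<close>. No transformation law of modular forms enters. Analysis delivers the four
  identities assumed in \<open>eta_quintic\<close>, valid on the punctured unit disc, together with
  integrality of Euler's product and the expansion of the generating function. Comparing Laurent
  expansions at 0 makes them formal, and the rest is algebra in the field of Laurent series.\<close>

lemma qpoch_inf_convergent: "norm q < 1 \<Longrightarrow> convergent_prod (\<lambda>n. 1 - a * q ^ n :: complex)"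
  by (intro abs_convergent_prod_imp_convergent_prod summable_imp_abs_convergent_prod)
     (auto simp: norm_mult norm_power intro!: summable_mult summable_geometric)

lemma qpoch_inf_LIMSEQ: "norm q < 1 \<Longrightarrow> (\<lambda>N. \<Prod>n<N. 1 - a * q ^ n) \<longlonglongrightarrow> qpoch_inf a q"
  unfolding qpoch_inf_def
  by (rule has_prod_imp_tendsto'[OF convergent_prod_has_prod[OF qpoch_inf_convergent]])

lemma qpoch_inf_nonzero: "norm q < 1 \<Longrightarrow> (\<And>n. a * q ^ n \<noteq> 1) \<Longrightarrow> qpoch_inf a q \<noteq> 0"
  unfolding qpoch_inf_def by (rule prodinf_nonzero[OF qpoch_inf_convergent]) auto

lemma qpoch_inf_nonzero': "norm q < 1 \<Longrightarrow> norm a < 1 \<Longrightarrow> qpoch_inf a q \<noteq> 0"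
proof (rule qpoch_inf_nonzero)
  fix n assume *: "norm q < 1" "norm a < 1"
  have "norm (a * q ^ n) \<le> norm a * 1"
    unfolding norm_mult norm_power by (rule mult_left_mono) (use * in \<open>auto intro: power_le_one\<close>)
  then show "a * q ^ n \<noteq> 1" using * by auto
qed

lemma qpoch_inf_prod:
  assumes "norm q < 1" "norm q' < 1" "finite I" "\<And>n. (\<Prod>i\<in>I. 1 - a i * q ^ n) = 1 - b * q' ^ n"
  shows "(\<Prod>i\<in>I. qpoch_inf (a i) q) = qpoch_inf b q'"
proof (rule LIMSEQ_unique)
  show "(\<lambda>N. \<Prod>i\<in>I. \<Prod>n<N. 1 - a i * q ^ n) \<longlonglongrightarrow> (\<Prod>i\<in>I. qpoch_inf (a i) q)"
    by (intro tendsto_prod qpoch_inf_LIMSEQ assms)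
  have "(\<lambda>N. \<Prod>i\<in>I. \<Prod>n<N. 1 - a i * q ^ n) = (\<lambda>N. \<Prod>n<N. 1 - b * q' ^ n)"
    by (subst prod.swap) (simp add: assms(4))
  then show "(\<lambda>N. \<Prod>i\<in>I. \<Prod>n<N. 1 - a i * q ^ n) \<longlonglongrightarrow> qpoch_inf b q'"
    using qpoch_inf_LIMSEQ[OF assms(2)] by simp
qed

lemma qpoch_inf_split:
  assumes "norm q < 1" "m > 0"
  shows "qpoch_inf a q = (\<Prod>r<m. qpoch_inf (a * q ^ r) (q ^ m))"
proof (rule LIMSEQ_unique)
  have q: "norm (q ^ m) < 1" using assms by (simp add: norm_power power_less_one_iff)
  have "(\<lambda>N. \<Prod>n<N * m. 1 - a * q ^ n) \<longlonglongrightarrow> qpoch_inf a q"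
    using LIMSEQ_subseq_LIMSEQ[OF qpoch_inf_LIMSEQ[OF assms(1)], of "\<lambda>N. N * m"] assms(2)
    by (simp add: o_def strict_mono_def)
  then show "(\<lambda>N. \<Prod>n<N * m. 1 - a * q ^ n) \<longlonglongrightarrow> qpoch_inf a q" .
  have "(\<Prod>n<N * m. 1 - a * q ^ n) = (\<Prod>r<m. \<Prod>n<N. 1 - a * q ^ r * (q ^ m) ^ n)" for N
  proof -
    have "(\<Prod>n<N * m. 1 - a * q ^ n) = (\<Prod>n<N. \<Prod>i=n*m..<n*m+m. 1 - a * q ^ i)"
      by (rule prod.nat_group[symmetric])
    also have "\<dots> = (\<Prod>n<N. \<Prod>r<m. 1 - a * q ^ r * (q ^ m) ^ n)"
    proof (rule prod.cong[OF refl])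
      fix n
      show "(\<Prod>i=n*m..<n*m+m. 1 - a * q ^ i) = (\<Prod>r<m. 1 - a * q ^ r * (q ^ m) ^ n)"
        by (rule prod.reindex_bij_witness[of _ "\<lambda>r. r + n * m" "\<lambda>i. i - n * m"])
           (auto simp: mult.commute[of m] simp flip: power_mult power_add mult.assoc)
    qed
    also have "\<dots> = (\<Prod>r<m. \<Prod>n<N. 1 - a * q ^ r * (q ^ m) ^ n)" by (rule prod.swap)
    finally show ?thesis .
  qed
  moreover have "(\<lambda>N. \<Prod>r<m. \<Prod>n<N. 1 - a * q ^ r * (q ^ m) ^ n) \<longlonglongrightarrow> (\<Prod>r<m. qpoch_inf (a * q ^ r) (q ^ m))"
    by (intro tendsto_prod qpoch_inf_LIMSEQ q)
  ultimately show "(\<lambda>N. \<Prod>n<N * m. 1 - a * q ^ n) \<longlonglongrightarrow> (\<Prod>r<m. qpoch_inf (a * q ^ r) (q ^ m))"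
    by simp
qed

text \<open>The Pascal recursion avoids division, so the q-binomial coefficients exist in every
  commutative ring. Where \<open>M < k\<close> the truncated exponent \<open>M - k\<close> does no
  harm, because the coefficient it multiplies vanishes.\<close>

fun gauss_binomial :: "'a :: comm_ring_1 \<Rightarrow> nat \<Rightarrow> nat \<Rightarrow> 'a" where
  "gauss_binomial p M 0 = 1"
| "gauss_binomial p 0 (Suc k) = 0"
| "gauss_binomial p (Suc M) (Suc k) = gauss_binomial p M (Suc k) + p ^ (M - k) * gauss_binomial p M k"

lemma gauss_binomial_eq_0: "M < k \<Longrightarrow> gauss_binomial p M k = 0"
  by (induction p M k rule: gauss_binomial.induct) auto

lemma triangle_Suc: "Suc k * (Suc k - 1) div 2 = k * (k - 1) div 2 + k"
proof (cases k)
  case (Suc l)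
  have "Suc k * (Suc k - 1) = k * (k - 1) + 2 * k" by (simp add: Suc)
  then show ?thesis by simp
qed simp

lemma gauss_binomial_theorem:
  "(\<Prod>j<M. 1 + x * p ^ j) = (\<Sum>k\<le>M. gauss_binomial p M k * p ^ (k * (k - 1) div 2) * x ^ k)"
proof (induction M)
  case (Suc M)
  let ?f = "\<lambda>k. gauss_binomial p M k * p ^ (k * (k - 1) div 2) * x ^ k"
  have *: "p ^ (M - k) * p ^ (Suc k * (Suc k - 1) div 2) = p ^ M * p ^ (k * (k - 1) div 2)" if "k \<le> M" for k
    unfolding triangle_Suc using that by (simp flip: power_add)
  have "(\<Sum>k\<le>Suc M. gauss_binomial p (Suc M) k * p ^ (k * (k - 1) div 2) * x ^ k)
      = 1 + (\<Sum>k\<le>M. gauss_binomial p (Suc M) (Suc k) * p ^ (Suc k * (Suc k - 1) div 2) * x ^ Suc k)"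
    by (subst sum.atMost_Suc_shift) simp
  also have "(\<Sum>k\<le>M. gauss_binomial p (Suc M) (Suc k) * p ^ (Suc k * (Suc k - 1) div 2) * x ^ Suc k)
     = (\<Sum>k\<le>M. ?f (Suc k)) + (\<Sum>k\<le>M. x * p ^ M * ?f k)"
    unfolding sum.distrib[symmetric]
  proof (rule sum.cong)
    fix k assume "k \<in> {..M}"
    then have k: "k \<le> M" by simp
    have "gauss_binomial p (Suc M) (Suc k) * p ^ (Suc k * (Suc k - 1) div 2) * x ^ Suc k
      = ?f (Suc k) + gauss_binomial p M k * x ^ Suc k * (p ^ (M - k) * p ^ (Suc k * (Suc k - 1) div 2))"
      by (simp only: gauss_binomial.simps algebra_simps)
    then show "gauss_binomial p (Suc M) (Suc k) * p ^ (Suc k * (Suc k - 1) div 2) * x ^ Suc k = ?f (Suc k) + x * p ^ M * ?f k"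
      unfolding *[OF k] by (simp add: mult_ac)
  qed simp
  also have "1 + ((\<Sum>k\<le>M. ?f (Suc k)) + (\<Sum>k\<le>M. x * p ^ M * ?f k)) = (\<Sum>k\<le>Suc M. ?f k) + (\<Sum>k\<le>M. x * p ^ M * ?f k)"
    by (subst sum.atMost_Suc_shift) simp
  also have "\<dots> = (\<Sum>k\<le>M. ?f k) * (1 + x * p ^ M)"
    by (simp add: gauss_binomial_eq_0 sum_distrib_left[symmetric] algebra_simps del: gauss_binomial.simps)
  finally show ?case using Suc by (simp del: gauss_binomial.simps)
qed simp

text \<open>The usual quotient formula in product form, so that no factor \<open>1 - p ^ i\<close>
  has to be invertible; it follows from the Pascal recursion by induction on
  \<open>M\<close>.\<close>

lemma gauss_binomial_closed:
  fixes p :: "'a :: comm_ring_1"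
  defines "pf \<equiv> \<lambda>M. \<Prod>i<M. 1 - p ^ Suc i"
  shows "k \<le> M \<Longrightarrow> gauss_binomial p M k * pf k * pf (M - k) = pf M"
proof (induction M arbitrary: k)
  case 0
  then show ?case by (simp add: pf_def)
next
  case (Suc M)
  show ?case
  proof (cases k)
    case 0
    then show ?thesis by (simp add: pf_def)
  next
    case (Suc l)
    with Suc.prems have l: "l \<le> M" by simp
    have pf_Suc: "pf (Suc n) = pf n * (1 - p ^ Suc n)" for n by (simp add: pf_def)
    note IH = Suc.IH[OF l]
    show ?thesis
    proof (cases "l = M")
      case True
      then show ?thesis using IH
        by (simp add: Suc gauss_binomial_eq_0 pf_Suc mult_ac) (metis mult.assoc)
    next
      case False
      with l obtain d where d: "M = Suc (l + d)" by (metis le_neq_implies_less less_imp_Suc_add)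
      have IH': "gauss_binomial p M (Suc l) * pf (Suc l) * pf d = pf M"
        using Suc.IH[of "Suc l"] d by simp
      have pd: "pf (Suc d) = pf d * (1 - p ^ Suc d)" by (rule pf_Suc)
      have "gauss_binomial p (Suc M) k * pf k * pf (Suc M - k)
          = gauss_binomial p M (Suc l) * pf (Suc l) * pf d * (1 - p ^ Suc d)
          + p ^ Suc d * (1 - p ^ Suc l) * (gauss_binomial p M l * pf l * pf (M - l))"
        by (simp add: Suc d pd pf_Suc[of l] algebra_simps del: gauss_binomial.simps(1,2))
      also have "\<dots> = pf M * (1 - p ^ Suc d * p ^ Suc l)"
        unfolding IH IH' by (simp add: algebra_simps)
      also have "p ^ Suc d * p ^ Suc l = p ^ Suc M" unfolding d by (simp add: power_add mult_ac)
      finally show ?thesis by (simp add: pf_Suc)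
    qed
  qed
qed

definition theta_term :: "complex \<Rightarrow> complex \<Rightarrow> int \<Rightarrow> complex" where
  "theta_term z p n = (- z) powi n * p powi (n * (n - 1) div 2)"

definition theta :: "complex \<Rightarrow> complex \<Rightarrow> complex" where
  "theta z p = qpoch_inf p p * qpoch_inf z p * qpoch_inf (p / z) p"

lemma triangle_shift: "(n + 1) * n div 2 = n * (n - 1) div 2 + (n :: int)"
proof -
  have "(n + 1) * n = n * (n - 1) + n * 2" by (simp add: algebra_simps)
  then show ?thesis by simp
qed

lemma theta_term_Suc: "z \<noteq> 0 \<Longrightarrow> p \<noteq> 0 \<Longrightarrow> theta_term z p (n + 1) = theta_term z p n * (- z * p powi n)"
  unfolding theta_term_def by (simp add: triangle_shift power_int_add)

lemma theta_term_summable_nat: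
  assumes "z \<noteq> 0" "p \<noteq> 0" "norm p < 1"
  shows "summable (\<lambda>n::nat. norm (theta_term z p (int n)))"
proof -
  have "(\<lambda>n. norm z * norm p ^ n) \<longlonglongrightarrow> norm z * 0"
    by (intro tendsto_mult tendsto_const LIMSEQ_power_zero) (use assms in auto)
  then have "eventually (\<lambda>n. norm z * norm p ^ n < 1 / 2) sequentially"
    by (rule order_tendstoD) auto
  then obtain N where N: "\<And>n. n \<ge> N \<Longrightarrow> norm z * norm p ^ n < 1 / 2"
    by (auto simp: eventually_at_top_linorder)
  show ?thesis
  proof (rule summable_ratio_test[of "1 / 2" N])
    fix n assume "n \<ge> N"
    have "norm (theta_term z p (int (Suc n))) = norm (theta_term z p (int n)) * (norm z * norm p ^ n)"
      using theta_term_Suc[OF assms(1,2), of "int n"] by (simp add: norm_mult norm_power add.commute)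
    also have "\<dots> \<le> norm (theta_term z p (int n)) * (1 / 2)"
      by (rule mult_left_mono) (use N[OF \<open>n \<ge> N\<close>] in auto)
    finally show "norm (norm (theta_term z p (int (Suc n)))) \<le> 1 / 2 * norm (norm (theta_term z p (int n)))"
      by simp
  qed simp
qed

lemma theta_term_reflect: "z \<noteq> 0 \<Longrightarrow> p \<noteq> 0 \<Longrightarrow> theta_term z p (1 - n) = - z * theta_term (1 / z) p n"
proof -
  assume "z \<noteq> 0" "p \<noteq> 0"
  have "(1 - n) * ((1 - n) - 1) = n * (n - 1)" by (simp add: algebra_simps)
  moreover have "(- z) powi (1 - n) = - z * (- (1 / z)) powi n"
    using \<open>z \<noteq> 0\<close> by (simp add: power_int_diff power_int_minus_left power_int_divide_distrib)
  ultimately show ?thesis unfolding theta_term_def by simp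
qed

lemma theta_term_abs_summable:
  assumes "z \<noteq> 0" "p \<noteq> 0" "norm p < 1"
  shows "(\<lambda>n. norm (theta_term z p n)) summable_on UNIV"
proof -
  have A: "(\<lambda>n::nat. norm (theta_term z p (int n))) summable_on UNIV" if "z \<noteq> 0" for z
    using theta_term_summable_nat[OF that assms(2,3)]
    by (intro norm_summable_imp_summable_on) simp
  have 1: "(\<lambda>n. norm (theta_term z p n)) summable_on range int"
    using A[OF assms(1)] by (subst summable_on_reindex) (auto simp: o_def)
  have "(\<lambda>n. norm (theta_term z p n)) summable_on (\<lambda>n::nat. 1 - int n) ` UNIV"
  proof (subst summable_on_reindex)
    have "(\<lambda>n::nat. norm z * norm (theta_term (1 / z) p (int n))) summable_on UNIV"
      by (intro summable_on_cmult_right A) (use assms in auto)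
    then show "((\<lambda>n. norm (theta_term z p n)) \<circ> (\<lambda>n::nat. 1 - int n)) summable_on UNIV"
      by (simp add: o_def theta_term_reflect assms norm_mult)
  qed (auto simp: inj_on_def)
  then have 2: "(\<lambda>n. norm (theta_term z p n)) summable_on {n. n < 0}"
  proof (rule summable_on_subset_banach)
    show "{n. n < 0} \<subseteq> range (\<lambda>n. 1 - int n)"
    proof
      fix n :: int assume "n \<in> {n. n < 0}"
      then have "n = 1 - int (nat (1 - n))" by simp
      then show "n \<in> range (\<lambda>n. 1 - int n)" by blast
    qed
  qed
  have "range int \<inter> {n. n < 0} = {}" by auto
  moreover have "range int \<union> {n. n < 0} = UNIV" by (auto simp: image_iff) (metis nat_0_le not_le)
  ultimately show ?thesis using summable_on_Un_disjoint[OF 1 2] by simp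
qed

text \<open>This is the q-binomial theorem with \<open>2 * N\<close> factors at
  \<open>x = - z * p powi (- N)\<close>: the upper half of the factors is the product in
  \<open>z\<close>, and the lower half becomes the product in \<open>p / z\<close> once a monomial
  is taken out of each factor.\<close>

lemma finite_triple_product:
  assumes "z \<noteq> 0" "p \<noteq> 0"
  shows "(\<Prod>j<N. 1 - z * p ^ j) * (\<Prod>j<N. 1 - p / z * p ^ j) =
    (\<Sum>n=-int N..int N. gauss_binomial p (2 * N) (nat (int N + n)) * theta_term z p n)"
proof -
  define x where "x = - z * p powi (- int N)"
  \<comment> \<open>\<open>K\<close> is the product of the monomials taken out of the
    \<open>N\<close> lower factors.\<close>
  define K where "K = (- z) powi (int N) * p powi (- (int N * (int N + 1) div 2))"
  have K_nz: "K \<noteq> 0" using assms by (simp add: K_def)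
  have low: "(\<Prod>j<N. 1 + x * p ^ j) = K * (\<Prod>j<N. 1 - p / z * p ^ j)"
  proof -
    have "(\<Prod>j<N. 1 + x * p ^ j) = (\<Prod>i<N. 1 + x * p ^ (N - Suc i))"
      by (rule prod.nat_diff_reindex[symmetric])
    also have "\<dots> = (\<Prod>i<N. (- z * p powi (- int (Suc i))) * (1 - p / z * p ^ i))"
    proof (rule prod.cong[OF refl])
      fix i assume i: "i \<in> {..<N}"
      have "int N - int (Suc i) = int (N - Suc i)" using i by auto
      then have "p ^ (N - Suc i) = p powi (int N - int (Suc i))" by (simp only: power_int_of_nat)
      then have "x * p ^ (N - Suc i) = - z * p powi (- int (Suc i))"
        unfolding x_def using assms by (simp flip: power_int_add)
      moreover have "- z * p powi (- int (Suc i)) * (p / z * p ^ i) = - 1"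
      proof -
        have "p powi (- int (Suc i)) * (p * p ^ i) = p powi (- int (Suc i)) * p powi (int (Suc i))"
          by (simp only: power_int_of_nat power_Suc)
        also have "\<dots> = 1" using assms by (subst power_int_add[symmetric]) auto
        finally show ?thesis using assms by (simp add: field_simps)
      qed
      ultimately show "1 + x * p ^ (N - Suc i) = - z * p powi (- int (Suc i)) * (1 - p / z * p ^ i)"
        by (simp add: right_diff_distrib)
    qed
    also have "\<dots> = (\<Prod>i<N. - z * p powi (- int (Suc i))) * (\<Prod>j<N. 1 - p / z * p ^ j)"
      by (rule prod.distrib)
    also have "(\<Prod>i<N. - z * p powi (- int (Suc i))) = K"
      unfolding K_def
    proof (induction N)
      case (Suc N)
      have "int (Suc N) * (int (Suc N) + 1) div 2 = int N * (int N + 1) div 2 + int (Suc N)"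
        using triangle_shift[of "int N + 1"] by (simp add: algebra_simps)
      then show ?case using Suc assms
        by (simp add: power_int_add power_int_diff power_int_minus field_simps)
    qed simp
    finally show ?thesis .
  qed
  have high: "(\<Prod>j=N..<N+N. 1 + x * p ^ j) = (\<Prod>j<N. 1 - z * p ^ j)"
  proof (rule prod.reindex_bij_witness[of _ "\<lambda>r. r + N" "\<lambda>i. i - N"])
    fix j assume "j \<in> {N..<N + N}"
    then have "p powi (- int N) * p ^ j = p ^ (j - N)"
      using assms by (simp add: power_int_def power_diff field_simps)
    then show "1 - z * p ^ (j - N) = 1 + x * p ^ j" unfolding x_def by simp
  qed auto
  have "K * ((\<Prod>j<N. 1 - z * p ^ j) * (\<Prod>j<N. 1 - p / z * p ^ j)) = (\<Prod>j<2*N. 1 + x * p ^ j)"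
    using prod.atLeastLessThan_concat[of 0 N "N + N" "\<lambda>j. 1 + x * p ^ j"] low high
    unfolding mult_2 by (simp add: lessThan_atLeast0 mult_ac)
  also have "\<dots> = (\<Sum>k\<le>2*N. gauss_binomial p (2 * N) k * p ^ (k * (k - 1) div 2) * x ^ k)"
    by (rule gauss_binomial_theorem)
  also have "\<dots> = (\<Sum>n=-int N..int N. K * (gauss_binomial p (2 * N) (nat (int N + n)) * theta_term z p n))"
  proof (rule sum.reindex_bij_witness[of _ "\<lambda>n. nat (int N + n)" "\<lambda>k. int k - int N"])
    fix k assume k: "k \<in> {..2 * N}"
    define n where "n = int k - int N"
    have kn: "int k = n + int N" by (simp add: n_def)
    have "p ^ (k * (k - 1) div 2) = p powi (int k * (int k - 1) div 2)"
    proof (cases k)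
      case (Suc l)
      have "int (k * (k - 1) div 2) = int k * (int k - 1) div 2" by (simp add: Suc zdiv_int algebra_simps)
      then show ?thesis by (metis power_int_of_nat)
    qed simp
    moreover have "x ^ k = (- z) powi int k * p powi (- int N * int k)"
      unfolding x_def by (simp only: power_mult_distrib power_int_mult power_int_of_nat)
    moreover have "int k * (int k - 1) div 2 + - int N * int k = - (int N * (int N + 1) div 2) + n * (n - 1) div 2"
    proof -
      have "2 * (int k * (int k - 1) div 2) = int k * (int k - 1)"
        "2 * (int N * (int N + 1) div 2) = int N * (int N + 1)"
        "2 * (n * (n - 1) div 2) = n * (n - 1)"
        by (auto intro!: dvd_mult_div_cancel)
      moreover have "int k * (int k - 1) + 2 * (- int N * int k) = - (int N * (int N + 1)) + n * (n - 1)"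
        unfolding kn by (simp add: algebra_simps)
      ultimately show ?thesis by linarith
    qed
    ultimately have "p ^ (k * (k - 1) div 2) * x ^ k = (- z) powi int k * p powi (- (int N * (int N + 1) div 2) + n * (n - 1) div 2)"
      using assms by (simp flip: power_int_add)
    also have "\<dots> = K * theta_term z p n"
    proof -
      have "p powi (- i + j) = p powi (- i) * p powi j" for i j :: int
        by (rule power_int_add) (use assms in simp)
      moreover have "(- z) powi (n + int N) = (- z) powi n * (- z) powi int N"
        by (rule power_int_add) (use assms in simp)
      ultimately show ?thesis unfolding kn K_def theta_term_def by (simp only: mult_ac)
    qed
    finally have "p ^ (k * (k - 1) div 2) * x ^ k = K * theta_term z p n" .
    then show "K * (gauss_binomial p (2 * N) (nat (int N + (int k - int N))) * theta_term z p (int k - int N))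
       = gauss_binomial p (2 * N) k * p ^ (k * (k - 1) div 2) * x ^ k"
      by (simp add: n_def mult_ac)
  qed auto
  also have "\<dots> = K * (\<Sum>n=-int N..int N. gauss_binomial p (2 * N) (nat (int N + n)) * theta_term z p n)"
    by (simp add: sum_distrib_left)
  finally show ?thesis using K_nz by simp
qed

text \<open>These are the two inputs of Tannery's theorem: a bound uniform in both arguments, and
  the limit of each coefficient at fixed distance from the centre of row
  \<open>2 * N\<close>.\<close>

lemma gauss_binomial_bound:
  fixes p :: complex
  assumes "norm p < 1"
  obtains B where "\<And>M k. norm (gauss_binomial p M k) \<le> B"
    and "\<And>n. (\<lambda>N. gauss_binomial p (2 * N) (nat (int N + n))) \<longlonglongrightarrow> 1 / qpoch_inf p p"
proof -
  define pf where "pf = (\<lambda>M. \<Prod>i<M. 1 - p ^ Suc i)"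
  have lim: "pf \<longlonglongrightarrow> qpoch_inf p p"
    using qpoch_inf_LIMSEQ[OF assms, of p] by (simp add: pf_def)
  have L: "qpoch_inf p p \<noteq> 0" by (rule qpoch_inf_nonzero') (use assms in auto)
  have nz: "pf M \<noteq> 0" for M
  proof -
    have "norm (p ^ Suc i) < 1" for i using assms by (simp add: norm_power power_less_one_iff del: power_Suc)
    then have "1 - p ^ Suc i \<noteq> 0" for i by (metis norm_one order_less_irrefl right_minus_eq)
    then show ?thesis by (simp add: pf_def del: power_Suc)
  qed
  have closed: "gauss_binomial p M k = pf M / (pf k * pf (M - k))" if "k \<le> M" for M k
  proof -
    have "gauss_binomial p M k * pf k * pf (M - k) = pf M"
      using gauss_binomial_closed[OF that, of p] unfolding pf_def .
    then show ?thesis using nz[of k] nz[of "M - k"] by (simp add: field_simps)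
  qed
  obtain B1 where B1: "\<And>M. norm (pf M) \<le> B1" using convergent_imp_Bseq[OF convergentI[OF lim]] by (auto simp: Bseq_def)
  have "(\<lambda>M. inverse (pf M)) \<longlonglongrightarrow> inverse (qpoch_inf p p)" by (intro tendsto_inverse lim L)
  then obtain B2 where B2: "\<And>M. norm (inverse (pf M)) \<le> B2" 
    using convergent_imp_Bseq[OF convergentI] by (metis Bseq_def)
  have pos: "0 \<le> B1" "0 \<le> B2" using B1[of 0] B2[of 0] norm_ge_zero by (meson order_trans)+
  show ?thesis
  proof
    fix M k
    show "norm (gauss_binomial p M k) \<le> B1 * (B2 * B2)"
    proof (cases "k \<le> M")
      case True
      have "gauss_binomial p M k = pf M * (inverse (pf k) * inverse (pf (M - k)))"
        unfolding closed[OF True] by (simp add: field_simps)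
      then show ?thesis
        by (simp only: norm_mult) (intro mult_mono B1 B2 mult_nonneg_nonneg norm_ge_zero pos)
    qed (use pos in \<open>simp add: gauss_binomial_eq_0\<close>)
  next
    fix n :: int
    have f: "filterlim (\<lambda>N. nat (int N + m)) sequentially sequentially" for m
    proof (rule filterlim_at_top_mono[OF filterlim_minus_const_nat_at_top[of "nat (- m)"]])
      show "eventually (\<lambda>N. N - nat (- m) \<le> nat (int N + m)) sequentially"
        by (intro always_eventually allI) linarith
    qed
    have "(\<lambda>N. pf (2 * N) / (pf (nat (int N + n)) * pf (nat (int N + (- n))))) \<longlonglongrightarrow> qpoch_inf p p / (qpoch_inf p p * qpoch_inf p p)"
    proof (intro tendsto_divide tendsto_mult)
      show "(\<lambda>N. pf (2 * N)) \<longlonglongrightarrow> qpoch_inf p p"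
        using LIMSEQ_subseq_LIMSEQ[OF lim, of "\<lambda>N. 2 * N"] by (simp add: o_def strict_mono_def)
      show "(\<lambda>N. pf (nat (int N + n))) \<longlonglongrightarrow> qpoch_inf p p"
        "(\<lambda>N. pf (nat (int N + - n))) \<longlonglongrightarrow> qpoch_inf p p"
        by (rule filterlim_compose[OF lim f])+
    qed (use L in simp)
    moreover have "eventually (\<lambda>N. pf (2 * N) / (pf (nat (int N + n)) * pf (nat (int N + (- n))))
        = gauss_binomial p (2 * N) (nat (int N + n))) sequentially"
      using eventually_ge_at_top[of "nat \<bar>n\<bar>"]
    proof eventually_elim
      case (elim N)
      then have "nat (int N + n) \<le> 2 * N" "2 * N - nat (int N + n) = nat (int N + (- n))" by linarith+
      then show ?case by (simp add: closed)
    qed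
    ultimately show "(\<lambda>N. gauss_binomial p (2 * N) (nat (int N + n))) \<longlonglongrightarrow> 1 / qpoch_inf p p"
      using L by (simp add: filterlim_cong[OF refl refl])
  qed
qed

text \<open>\<open>N\<close> tends to infinity in \<open>finite_triple_product\<close>, with the
  theta series itself, up to a constant, as dominating series.\<close>

theorem jacobi_triple_product:
  assumes "z \<noteq> 0" "p \<noteq> 0" "norm p < 1"
  shows "(theta_term z p has_sum theta z p) UNIV"
proof -
  obtain B where B: "\<And>M k. norm (gauss_binomial p M k) \<le> B"
    and lim: "\<And>n. (\<lambda>N. gauss_binomial p (2 * N) (nat (int N + n))) \<longlonglongrightarrow> 1 / qpoch_inf p p"
    using gauss_binomial_bound[OF assms(3)] by blast
  define L where "L = qpoch_inf p p"
  have L: "L \<noteq> 0" unfolding L_def by (rule qpoch_inf_nonzero') (use assms in auto)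
  \<comment> \<open>The integers are enumerated because Tannery's theorem is applied to series over
    the naturals.\<close>
  define d where "d = int_decode"
  have bij: "bij d" unfolding d_def by (rule bij_int_decode)
  \<comment> \<open>The cutoff must be explicit: \<open>nat\<close> sends negative positions to 0,
    where the Gaussian binomial is 1 and not 0.\<close>
  define a where "a = (\<lambda>k N. (if \<bar>d k\<bar> \<le> int N then gauss_binomial p (2 * N) (nat (int N + d k)) else 0) * theta_term z p (d k))"
  have sm: "summable (\<lambda>k. norm (theta_term z p (d k)))"
  proof -
    have "(\<lambda>k. norm (theta_term z p (d k))) summable_on UNIV"
      using theta_term_abs_summable[OF assms]
      by (subst summable_on_reindex_bij_betw[OF bij, of "\<lambda>n. norm (theta_term z p n)"])
    then show ?thesis by (rule summable_on_imp_summable)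
  qed
  have T: "(\<lambda>N. \<Sum>k. a k N) \<longlonglongrightarrow> (\<Sum>k. 1 / L * theta_term z p (d k))"
  proof (rule tannerys_theorem[THEN conjunct2, THEN conjunct2])
    show "summable (\<lambda>k. B * norm (theta_term z p (d k)))" by (intro summable_mult sm)
    show "eventually (\<lambda>(k, N). norm (a k N) \<le> B * norm (theta_term z p (d k))) (at_top \<times>\<^sub>F sequentially)"
    proof (intro always_eventually allI, clarify)
      fix k N
      have "0 \<le> B" using B[of 0 0] norm_ge_zero order_trans by blast
      then show "norm (a k N) \<le> B * norm (theta_term z p (d k))"
        unfolding a_def norm_mult by (intro mult_right_mono) (use B in auto)
    qed
    fix k
    have "eventually (\<lambda>N. gauss_binomial p (2 * N) (nat (int N + d k)) * theta_term z p (d k) = a k N) sequentially"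
      using eventually_ge_at_top[of "nat \<bar>d k\<bar>"] by eventually_elim (auto simp: a_def)
    moreover have "(\<lambda>N. gauss_binomial p (2 * N) (nat (int N + d k)) * theta_term z p (d k)) \<longlonglongrightarrow> 1 / L * theta_term z p (d k)"
      unfolding L_def by (intro tendsto_mult lim tendsto_const)
    ultimately show "a k \<longlonglongrightarrow> 1 / L * theta_term z p (d k)"
      by (rule Lim_transform_eventually[rotated])
  qed simp
  have "(\<Sum>k. a k N) = (\<Prod>j<N. 1 - z * p ^ j) * (\<Prod>j<N. 1 - p / z * p ^ j)" for N
  proof -
    have "(\<Sum>k. a k N) = (\<Sum>k\<in>int_encode ` {-int N..int N}. a k N)"
    proof (rule suminf_finite)
      fix k assume "k \<notin> int_encode ` {-int N..int N}"
      then have "d k \<notin> {-int N..int N}" unfolding d_def by (metis image_eqI int_decode_inverse)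
      then show "a k N = 0" by (auto simp: a_def)
    qed simp
    also have "\<dots> = (\<Sum>n=-int N..int N. gauss_binomial p (2 * N) (nat (int N + n)) * theta_term z p n)"
      by (subst sum.reindex) (auto simp: inj_on_def inj_int_encode[THEN inj_eq] a_def d_def intro!: sum.cong)
    finally show ?thesis using finite_triple_product[OF assms(1,2)] by simp
  qed
  moreover have "(\<lambda>N. (\<Prod>j<N. 1 - z * p ^ j) * (\<Prod>j<N. 1 - p / z * p ^ j)) \<longlonglongrightarrow> qpoch_inf z p * qpoch_inf (p / z) p"
    by (intro tendsto_mult qpoch_inf_LIMSEQ assms)
  ultimately have "(\<Sum>k. 1 / L * theta_term z p (d k)) = qpoch_inf z p * qpoch_inf (p / z) p"
    using T LIMSEQ_unique by (simp only:)
  then have "(\<Sum>k. theta_term z p (d k)) = theta z p"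
    using L suminf_mult[OF summable_norm_cancel[OF sm], of "1 / L"]
    by (simp add: theta_def L_def[symmetric] field_simps)
  then have "((\<lambda>k. theta_term z p (d k)) has_sum theta z p) UNIV"
    using norm_summable_imp_has_sum[OF sm] summable_sums[OF summable_norm_cancel[OF sm]] by simp
  then show ?thesis using has_sum_reindex_bij_betw[OF bij] by blast
qed

section \<open>Theta identities of level 5 and 10\<close>

lemma theta_symmetric: "p \<noteq> 0 \<Longrightarrow> z \<noteq> 0 \<Longrightarrow> theta (p / z) p = theta z p"
  by (simp add: theta_def mult_ac)

lemma theta_symmetric': "p \<noteq> 0 \<Longrightarrow> z \<noteq> 0 \<Longrightarrow> z * z' = p \<Longrightarrow> theta z' p = theta z p"
  using theta_symmetric[of p z] by (metis nonzero_mult_div_cancel_left)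

lemma qpoch_inf_head: "norm q < 1 \<Longrightarrow> qpoch_inf a q = (1 - a) * qpoch_inf (a * q) q"
proof (rule LIMSEQ_unique)
  assume q: "norm q < 1"
  show "(\<lambda>N. \<Prod>n<Suc N. 1 - a * q ^ n) \<longlonglongrightarrow> qpoch_inf a q"
    by (rule LIMSEQ_Suc[OF qpoch_inf_LIMSEQ[OF q]])
  have "(\<Prod>n<Suc N. 1 - a * q ^ n) = (1 - a) * (\<Prod>n<N. 1 - a * q * q ^ n)" for N
    by (subst prod.lessThan_Suc_shift) (simp add: mult_ac)
  then show "(\<lambda>N. \<Prod>n<Suc N. 1 - a * q ^ n) \<longlonglongrightarrow> (1 - a) * qpoch_inf (a * q) q"
    using tendsto_mult[OF tendsto_const qpoch_inf_LIMSEQ[OF q]] by simp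
qed

lemma qpoch_inf_one [simp]: "norm q < 1 \<Longrightarrow> qpoch_inf 1 q = 0"
  by (subst qpoch_inf_head) auto

lemma theta_one: "norm p < 1 \<Longrightarrow> theta 1 p = 0"
  by (simp add: theta_def)

lemma theta_quasiperiodic:
  assumes "norm p < 1" "p \<noteq> 0" "z \<noteq> 0"
  shows "theta (p * z) p = - theta z p / z"
proof -
  have "qpoch_inf z p = (1 - z) * qpoch_inf (p * z) p" "z * qpoch_inf (1 / z) p = (z - 1) * qpoch_inf (p / z) p"
    using assms qpoch_inf_head[OF assms(1), of z] qpoch_inf_head[OF assms(1), of "1 / z"]
    by (simp_all add: field_simps)
  then have "z * ((1 - z) * (qpoch_inf p p * qpoch_inf (p * z) p * qpoch_inf (1 / z) p))
      = - ((1 - z) * (qpoch_inf p p * qpoch_inf z p * qpoch_inf (p / z) p))"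
    by algebra
  moreover have "p / (p * z) = 1 / z" using assms by simp
  ultimately have "z * ((1 - z) * theta (p * z) p) = - ((1 - z) * theta z p)"
    unfolding theta_def by simp
  \<comment> \<open>At \<open>z = 1\<close> the factor \<open>1 - z\<close> cannot be cancelled, but
    there both sides are 0.\<close>
  moreover have "theta (p * z) p = - theta z p / z" if "z = 1"
    using that assms theta_one[of p] theta_symmetric'[of p 1 p] by simp
  moreover have "theta (p * z) p = - theta z p / z"
    if "z * ((1 - z) * theta (p * z) p) = - ((1 - z) * theta z p)" "z \<noteq> 1"
  proof -
    have "(1 - z) * (z * theta (p * z) p + theta z p) = 0" using that(1) by algebra
    then have "z * theta (p * z) p + theta z p = 0" using that(2) by simp
    then have "z * theta (p * z) p = - theta z p" by (simp add: eq_neg_iff_add_eq_0)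
    then show ?thesis using assms by (simp add: field_simps)
  qed
  ultimately show ?thesis by blast
qed

text \<open>The factors combine by \<open>(1 - a) * (1 + a) = 1 - a ^ 2\<close>, once for the
  product in \<open>z\<close> and once for the product in \<open>p / z\<close>.\<close>

lemma theta_square:
  assumes "norm p < 1" "p \<noteq> 0" "z \<noteq> 0"
  shows "theta z p * theta (- z) p * qpoch_inf (p\<^sup>2) (p\<^sup>2) = theta (z\<^sup>2) (p\<^sup>2) * (qpoch_inf p p)\<^sup>2"
proof -
  have p2: "norm (p\<^sup>2) < 1" using assms by (simp add: norm_power power_less_one_iff)
  have *: "qpoch_inf a p * qpoch_inf (- a) p = qpoch_inf (a\<^sup>2) (p\<^sup>2)" for a
  proof -
    have "(\<Prod>i\<in>{True, False}. qpoch_inf (if i then a else - a) p) = qpoch_inf (a\<^sup>2) (p\<^sup>2)"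
      by (rule qpoch_inf_prod[OF assms(1) p2])
         (auto simp: power2_eq_square algebra_simps power_mult_distrib)
    then show ?thesis by simp
  qed
  show ?thesis
    using *[of z] *[of "p / z"] by (simp add: theta_def power_divide power2_eq_square mult_ac)
qed

lemma theta_split2:
  assumes "norm p < 1" "p \<noteq> 0" "z \<noteq> 0"
  shows "theta z p * (qpoch_inf (p\<^sup>2) (p\<^sup>2))\<^sup>2 = qpoch_inf p p * theta z (p\<^sup>2) * theta (z * p) (p\<^sup>2)"
proof -
  have *: "qpoch_inf a p = qpoch_inf a (p\<^sup>2) * qpoch_inf (a * p) (p\<^sup>2)" for a
    using qpoch_inf_split[OF assms(1), of 2 a] by (simp add: numeral_2_eq_2)
  show ?thesis
    unfolding theta_def *[of z] *[of "p / z"] using assms by (simp add: power2_eq_square field_simps)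
qed

lemma has_sum_product:
  fixes f :: "'a \<Rightarrow> complex" and g :: "'b \<Rightarrow> complex"
  assumes "(f has_sum a) UNIV" "(g has_sum b) UNIV"
    "(\<lambda>x. norm (f x)) summable_on UNIV" "(\<lambda>x. norm (g x)) summable_on UNIV"
  shows "((\<lambda>(x, y). f x * g y) has_sum a * b) (UNIV \<times> UNIV)"
proof (rule has_sum_SigmaI)
  show "((\<lambda>y. case (x, y) of (x, y) \<Rightarrow> f x * g y) has_sum f x * b) UNIV" for x
    using has_sum_cmult_right[OF assms(2)] by simp
  show "((\<lambda>x. f x * b) has_sum a * b) UNIV" by (rule has_sum_cmult_left[OF assms(1)])
  have "(\<lambda>z. norm (case z of (x, y) \<Rightarrow> f x * g y)) summable_on UNIV \<times> UNIV"
  proof (rule summable_on_SigmaI)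
    show "((\<lambda>y. norm (case (x, y) of (x, y) \<Rightarrow> f x * g y)) has_sum norm (f x) * infsum (\<lambda>y. norm (g y)) UNIV) UNIV" for x
      using has_sum_cmult_right[OF has_sum_infsum[OF assms(4)]] by (simp add: norm_mult)
    show "(\<lambda>x. norm (f x) * infsum (\<lambda>y. norm (g y)) UNIV) summable_on UNIV"
      by (rule summable_on_cmult_left[OF assms(3)])
  qed simp
  then show "(\<lambda>(x, y). f x * g y) summable_on UNIV \<times> UNIV"
    by (rule abs_summable_summable)
qed

lemma double_triangle: "2 * (n * (n - 1) div 2) = n * (n - 1 :: int)"
  by (intro dvd_mult_div_cancel) auto

text \<open>The summation index is written \<open>5 * m + r\<close> with \<open>r\<close> from -2 to
  2; each residue class is again a theta series, of nome \<open>p ^ 25\<close>.\<close>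

lemma theta_dissection5:
  assumes "z \<noteq> 0" "p \<noteq> 0" "norm p < 1"
  shows "theta z p = (\<Sum>r=-2..2. theta_term z p r * theta (z ^ 5 * p powi (10 + 5 * r)) (p ^ 25))"
proof -
  have p25: "norm (p ^ 25) < 1" using assms by (simp add: norm_power power_less_one_iff)
  have eq: "theta_term z p (5 * m + r) = theta_term z p r * theta_term (z ^ 5 * p powi (10 + 5 * r)) (p ^ 25) m" for m r
  proof -
    have 1: "p powi (i + j) = p powi i * p powi j" "(- z) powi (i + j) = (- z) powi i * (- z) powi j" for i j
      by (rule power_int_add, use assms in simp)+
    have "(5 * m + r) * (5 * m + r - 1) div 2 = r * (r - 1) div 2 + ((10 + 5 * r) * m + 25 * (m * (m - 1) div 2))"
    proof -
      define Tr Tm where "Tr = r * (r - 1) div 2" and "Tm = m * (m - 1) div 2"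
      have "2 * Tr = r * (r - 1)" "2 * Tm = m * (m - 1)"
        unfolding Tr_def Tm_def by (rule double_triangle)+
      then have "(5 * m + r) * (5 * m + r - 1) = 2 * (Tr + ((10 + 5 * r) * m + 25 * Tm))"
        by algebra
      then show ?thesis by (simp add: Tr_def Tm_def)
    qed
    then have e: "theta_term z p (5 * m + r) = (- z) powi (5 * m) * (- z) powi r
        * (p powi (r * (r - 1) div 2) * (p powi ((10 + 5 * r) * m) * p powi (25 * (m * (m - 1) div 2))))"
      unfolding theta_term_def by (simp only: 1)
    have e1: "(- z) powi (5 * m) * p powi ((10 + 5 * r) * m) = (- (z ^ 5 * p powi (10 + 5 * r))) powi m"
    proof -
      have "(- z) powi (5 * m) = ((- z) ^ 5) powi m"
        using power_int_mult[of "- z" 5 m] by simp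
      moreover have "p powi ((10 + 5 * r) * m) = (p powi (10 + 5 * r)) powi m" by (rule power_int_mult)
      moreover have "- (z ^ 5 * p powi (10 + 5 * r)) = (- z) ^ 5 * p powi (10 + 5 * r)" by simp
      ultimately show ?thesis by (simp only: power_int_mult_distrib)
    qed
    have e2: "p powi (25 * (m * (m - 1) div 2)) = (p ^ 25) powi (m * (m - 1) div 2)"
      using power_int_mult[of p 25 "m * (m - 1) div 2"] by simp
    have "theta_term z p (5 * m + r) = (- z) powi r * p powi (r * (r - 1) div 2)
        * ((- z) powi (5 * m) * p powi ((10 + 5 * r) * m) * p powi (25 * (m * (m - 1) div 2)))"
      unfolding e by (simp only: mult_ac)
    then show ?thesis unfolding e1 e2 theta_term_def .
  qed
  have "((\<lambda>(r, m). theta_term z p r * theta_term (z ^ 5 * p powi (10 + 5 * r)) (p ^ 25) m) has_sum theta z p) ({-2..2} \<times> UNIV)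
     \<longleftrightarrow> (theta_term z p has_sum theta z p) UNIV"
    by (rule has_sum_reindex_bij_witness[of _ "\<lambda>n. ((n + 2) mod 5 - 2, (n + 2) div 5)" "\<lambda>(r, m). 5 * m + r"])
       (auto simp: eq, presburger+)
  then have "((\<lambda>(r, m). theta_term z p r * theta_term (z ^ 5 * p powi (10 + 5 * r)) (p ^ 25) m) has_sum theta z p) ({-2..2} \<times> UNIV)"
    using jacobi_triple_product[OF assms] by simp
  then have "((\<lambda>r. theta_term z p r * theta (z ^ 5 * p powi (10 + 5 * r)) (p ^ 25)) has_sum theta z p) {-2..2}"
  proof (rule has_sum_Sigma')
    show "((\<lambda>y. case (r, y) of (r, m) \<Rightarrow> theta_term z p r * theta_term (z ^ 5 * p powi (10 + 5 * r)) (p ^ 25) m) has_sum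
         theta_term z p r * theta (z ^ 5 * p powi (10 + 5 * r)) (p ^ 25)) UNIV" for r
      using has_sum_cmult_right[OF jacobi_triple_product[of "z ^ 5 * p powi (10 + 5 * r)" "p ^ 25"]] p25 assms by simp
  qed
  then show ?thesis by (simp only: has_sum_finite_iff finite_atLeastAtMost_int)
qed

text \<open>The double series is split according to the parity of the sum of the two summation indices.\<close>

lemma theta_product:
  assumes "z1 \<noteq> 0" "z2 \<noteq> 0" "p \<noteq> 0" "norm p < 1"
  shows "theta z1 p * theta z2 p = theta (- z1 * z2) (p\<^sup>2) * theta (- p * z1 / z2) (p\<^sup>2)
     - z1 * theta (- p * z1 * z2) (p\<^sup>2) * theta (- p\<^sup>2 * z1 / z2) (p\<^sup>2)"
proof -
  have p2: "norm (p\<^sup>2) < 1" "p\<^sup>2 \<noteq> 0" using assms by (simp_all add: norm_power power_less_one_iff)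
  have J: "(theta_term z (p\<^sup>2) has_sum theta z (p\<^sup>2)) UNIV" "(\<lambda>n. norm (theta_term z (p\<^sup>2) n)) summable_on UNIV"
    if "z \<noteq> 0" for z
    using jacobi_triple_product[OF that p2(2,1)] theta_term_abs_summable[OF that p2(2,1)] by auto
  have add: "w powi (i + j) = w powi i * w powi j" if "w \<noteq> 0" for w :: complex and i j
    by (rule power_int_add) (use that in simp)
  have sq: "(p\<^sup>2) powi i = p powi (2 * i)" for i
    using power_int_mult[of p 2 i] by simp
  have z: "(- z1) powi (a + b) * (- z2) powi (a - b) = (z1 * z2) powi a * (z1 / z2) powi b" for a b
  proof -
    have "(- z1) powi (a + b) * (- z2) powi (a - b) = ((- z1) powi a * (- z2) powi a) * ((- z1) powi b / (- z2) powi b)"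
      using assms by (simp add: power_int_add power_int_diff)
    also have "(- z1) powi a * (- z2) powi a = (z1 * z2) powi a" by (simp flip: power_int_mult_distrib)
    also have "(- z1) powi b / (- z2) powi b = (z1 / z2) powi b" by (simp flip: power_int_divide_distrib)
    finally show ?thesis .
  qed
  have e0: "theta_term z1 p (a + b) * theta_term z2 p (a - b)
      = theta_term (- z1 * z2) (p\<^sup>2) a * theta_term (- p * z1 / z2) (p\<^sup>2) b" for a b
  proof -
    have "(a + b) * (a + b - 1) div 2 + (a - b) * (a - b - 1) div 2 = 2 * (a * (a - 1) div 2) + (b + 2 * (b * (b - 1) div 2))"
    proof -
      have "2 * ((a + b) * (a + b - 1) div 2 + (a - b) * (a - b - 1) div 2) = 2 * (2 * (a * (a - 1) div 2) + (b + 2 * (b * (b - 1) div 2)))"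
        unfolding distrib_left double_triangle by (simp add: algebra_simps)
      then show ?thesis by simp
    qed
    then have e: "p powi ((a + b) * (a + b - 1) div 2) * p powi ((a - b) * (a - b - 1) div 2)
        = (p\<^sup>2) powi (a * (a - 1) div 2) * (p powi b * (p\<^sup>2) powi (b * (b - 1) div 2))"
      by (simp only: sq add[OF assms(3), symmetric])
    have e': "(z1 / z2) powi b * p powi b = (p * z1 / z2) powi b"
      by (simp add: mult_ac flip: power_int_mult_distrib)
    have "(- z1) powi (a + b) * p powi ((a + b) * (a + b - 1) div 2) * ((- z2) powi (a - b) * p powi ((a - b) * (a - b - 1) div 2))
       = (- z1) powi (a + b) * (- z2) powi (a - b) * (p powi ((a + b) * (a + b - 1) div 2) * p powi ((a - b) * (a - b - 1) div 2))"
      by (simp only: mult_ac)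
    also have "\<dots> = (z1 * z2) powi a * (p\<^sup>2) powi (a * (a - 1) div 2) * ((p * z1 / z2) powi b * (p\<^sup>2) powi (b * (b - 1) div 2))"
      unfolding z e e'[symmetric] by (simp only: mult_ac)
    finally show ?thesis unfolding theta_term_def by simp
  qed
  have e1: "theta_term z1 p (a + b + 1) * theta_term z2 p (a - b)
      = - z1 * (theta_term (- p * z1 * z2) (p\<^sup>2) a * theta_term (- p\<^sup>2 * z1 / z2) (p\<^sup>2) b)" for a b
  proof -
    have "theta_term z1 p (a + b + 1) * theta_term z2 p (a - b) = theta_term z1 p (a + b) * theta_term z2 p (a - b) * (- z1 * p powi (a + b))"
      using theta_term_Suc[OF assms(1,3), of "a + b"] by simp
    also have "\<dots> = - z1 * ((p powi a * theta_term (- z1 * z2) (p\<^sup>2) a) * (p powi b * theta_term (- p * z1 / z2) (p\<^sup>2) b))"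
      unfolding e0 add[OF assms(3)] by (simp only: mult_ac minus_mult_left minus_mult_right)
    also have "p powi a * theta_term (- z1 * z2) (p\<^sup>2) a = theta_term (- p * z1 * z2) (p\<^sup>2) a"
      unfolding theta_term_def by (simp add: power_int_mult_distrib mult_ac)
    also have "p powi b * theta_term (- p * z1 / z2) (p\<^sup>2) b = theta_term (- p\<^sup>2 * z1 / z2) (p\<^sup>2) b"
      unfolding theta_term_def by (simp add: power_int_mult_distrib power_int_divide_distrib power2_eq_square mult_ac)
    finally show ?thesis .
  qed
  define f where "f = (\<lambda>e::int. \<lambda>(a, b). theta_term z1 p (a + b + e) * theta_term z2 p (a - b))"
  have "((\<lambda>(e, ab). f e ab) has_sum theta z1 p * theta z2 p) ({0, 1} \<times> (UNIV \<times> UNIV))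
     \<longleftrightarrow> ((\<lambda>(m, n). theta_term z1 p m * theta_term z2 p n) has_sum theta z1 p * theta z2 p) (UNIV \<times> UNIV)"
    by (rule has_sum_reindex_bij_witness[of _ "\<lambda>(m, n). ((m + n) mod 2, ((m + n) div 2, m - (m + n) div 2 - (m + n) mod 2))"
          "\<lambda>(e, (a, b)). (a + b + e, a - b)"])
       (auto simp: f_def, presburger)
  then have "((\<lambda>(e, ab). f e ab) has_sum theta z1 p * theta z2 p) ({0, 1} \<times> (UNIV \<times> UNIV))"
    using has_sum_product[OF jacobi_triple_product jacobi_triple_product theta_term_abs_summable theta_term_abs_summable] assms
    by simp
  then have "((\<lambda>e::int. if e = 0 then theta (- z1 * z2) (p\<^sup>2) * theta (- p * z1 / z2) (p\<^sup>2)
      else - z1 * (theta (- p * z1 * z2) (p\<^sup>2) * theta (- p\<^sup>2 * z1 / z2) (p\<^sup>2))) has_sum theta z1 p * theta z2 p) {0, 1}"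
  proof (rule has_sum_Sigma')
    fix e :: int assume e: "e \<in> {0, 1}"
    have "((\<lambda>(a, b). theta_term (- z1 * z2) (p\<^sup>2) a * theta_term (- p * z1 / z2) (p\<^sup>2) b) has_sum
       theta (- z1 * z2) (p\<^sup>2) * theta (- p * z1 / z2) (p\<^sup>2)) (UNIV \<times> UNIV)"
      by (rule has_sum_product; rule J) (use assms in auto)
    moreover have "((\<lambda>x. - z1 * (case x of (a, b) \<Rightarrow> theta_term (- p * z1 * z2) (p\<^sup>2) a * theta_term (- p\<^sup>2 * z1 / z2) (p\<^sup>2) b)) has_sum
       - z1 * (theta (- p * z1 * z2) (p\<^sup>2) * theta (- p\<^sup>2 * z1 / z2) (p\<^sup>2))) (UNIV \<times> UNIV)"
      by (rule has_sum_cmult_right, rule has_sum_product; rule J) (use assms in auto)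
    ultimately show "((\<lambda>y. case (e, y) of (e, ab) \<Rightarrow> f e ab) has_sum (if e = 0 then theta (- z1 * z2) (p\<^sup>2) * theta (- p * z1 / z2) (p\<^sup>2)
      else - z1 * (theta (- p * z1 * z2) (p\<^sup>2) * theta (- p\<^sup>2 * z1 / z2) (p\<^sup>2)))) (UNIV \<times> UNIV)"
      using e by (auto simp: f_def e0 e1 case_prod_beta')
  qed
  then show ?thesis by (simp add: has_sum_finite_iff)
qed

section \<open>The Rogers-Ramanujan theta functions and the 5-dissection of Euler's product\<close>

definition eulerP :: "complex \<Rightarrow> complex" where "eulerP q = qpoch_inf q q"
text \<open>\<open>rrA q / rrB q\<close> is \<open>q\<close> to the power 1/5 divided by the
  Rogers-Ramanujan continued fraction R(q), in its product form.\<close>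

definition rrA :: "complex \<Rightarrow> complex" where "rrA q = theta (q\<^sup>2) (q ^ 5)"
definition rrB :: "complex \<Rightarrow> complex" where "rrB q = theta q (q ^ 5)"

lemma norm_power_lt_1: "norm (q :: complex) < 1 \<Longrightarrow> n > 0 \<Longrightarrow> norm (q ^ n) < 1"
  by (simp add: norm_power power_less_one_iff)

lemma eulerP_nz: "norm q < 1 \<Longrightarrow> eulerP q \<noteq> 0"
  unfolding eulerP_def by (rule qpoch_inf_nonzero')

lemma prod_lessThan_5: "(\<Prod>i<5. f i) = f 0 * f 1 * f 2 * f 3 * f (4::nat)"
  by (simp add: eval_nat_numeral)

lemma rrA_eq: "q \<noteq> 0 \<Longrightarrow> rrA q = eulerP (q ^ 5) * qpoch_inf (q\<^sup>2) (q ^ 5) * qpoch_inf (q ^ 3) (q ^ 5)"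
  by (simp add: rrA_def theta_def eulerP_def eval_nat_numeral)

lemma rrB_eq: "q \<noteq> 0 \<Longrightarrow> rrB q = eulerP (q ^ 5) * qpoch_inf q (q ^ 5) * qpoch_inf (q ^ 4) (q ^ 5)"
  by (simp add: rrB_def theta_def eulerP_def eval_nat_numeral)

lemma eulerP_split5:
  assumes "norm q < 1"
  shows "eulerP q = qpoch_inf q (q ^ 5) * qpoch_inf (q\<^sup>2) (q ^ 5) * qpoch_inf (q ^ 3) (q ^ 5) * qpoch_inf (q ^ 4) (q ^ 5) * eulerP (q ^ 5)"
  unfolding eulerP_def qpoch_inf_split[OF assms, of 5 q, simplified] prod_lessThan_5
  by (simp add: eval_nat_numeral mult_ac)

lemma rrA_rrB:
  assumes "norm q < 1" "q \<noteq> 0"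
  shows "rrA q * rrB q = eulerP q * eulerP (q ^ 5)"
  unfolding rrA_eq[OF assms(2)] rrB_eq[OF assms(2)] eulerP_split5[OF assms(1)] by (simp add: mult_ac)

lemma rrA_nz: "norm q < 1 \<Longrightarrow> q \<noteq> 0 \<Longrightarrow> rrA q \<noteq> 0"
  and rrB_nz: "norm q < 1 \<Longrightarrow> q \<noteq> 0 \<Longrightarrow> rrB q \<noteq> 0"
  using rrA_rrB eulerP_nz norm_power_lt_1 by (metis mult_eq_0_iff zero_less_numeral)+

context
  fixes \<zeta> :: complex
  assumes root: "1 + \<zeta> + \<zeta>\<^sup>2 + \<zeta> ^ 3 + \<zeta> ^ 4 = 0"
begin

lemma root_power5: "\<zeta> ^ 5 = 1"
proof -
  have "\<zeta> ^ 5 - 1 = (\<zeta> - 1) * (1 + \<zeta> + \<zeta>\<^sup>2 + \<zeta> ^ 3 + \<zeta> ^ 4)" by algebra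
  then show ?thesis by (simp add: root)
qed

lemma root_nz: "\<zeta> \<noteq> 0" using root_power5 by auto

lemma root_norm: "norm \<zeta> = 1"
  using root_power5 by (metis norm_one norm_power norm_ge_zero power_eq_1_iff zero_neq_numeral zero_less_numeral)

lemma root_prod: "(\<Prod>j<5. 1 - \<zeta> ^ j * x) = 1 - x ^ 5"
proof -
  have "(1 - x) * (1 - \<zeta> * x) * (1 - \<zeta>\<^sup>2 * x) * (1 - \<zeta> ^ 3 * x) * (1 - \<zeta> ^ 4 * x) = 1 - x ^ 5"
    using root by algebra
  then show ?thesis by (simp add: prod_lessThan_5)
qed

lemma qpoch_inf_root_prod:
  assumes "norm q < 1"
  shows "(\<Prod>j<5. qpoch_inf (\<zeta> ^ j * a) q) = qpoch_inf (a ^ 5) (q ^ 5)"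
proof (rule qpoch_inf_prod[OF assms norm_power_lt_1[OF assms]])
  fix n
  show "(\<Prod>i<5. 1 - \<zeta> ^ i * a * q ^ n) = 1 - a ^ 5 * (q ^ 5) ^ n"
    using root_prod[of "a * q ^ n"] by (simp add: power_mult_distrib mult_ac flip: power_mult)
qed auto

text \<open>In the 5-dissection at \<open>\<zeta>\<close> the class \<open>r = -2\<close> carries
  the theta function at 1, which vanishes; the other four classes pair up under the symmetry of
  \<open>theta\<close>.\<close>

lemma theta_root:
  assumes "norm q < 1" "q \<noteq> 0"
  shows "theta \<zeta> q = (1 - \<zeta>) * rrA (q ^ 5) + q * (\<zeta>\<^sup>2 - \<zeta> ^ 4) * rrB (q ^ 5)"
proof -
  have p: "norm (q ^ 25) < 1" "q ^ 25 \<noteq> 0" using norm_power_lt_1[OF assms(1)] assms(2) by auto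
  have inv: "inverse \<zeta> = \<zeta> ^ 4"
    using root_power5 by (intro inverse_unique) (simp add: eval_nat_numeral)
  have "{-2..2::int} = {-2, -1, 0, 1, 2}" by auto
  then have "theta \<zeta> q = theta_term \<zeta> q (-2) * theta (q powi 0) (q ^ 25) + theta_term \<zeta> q (-1) * theta (q powi 5) (q ^ 25)
     + theta_term \<zeta> q 0 * theta (q powi 10) (q ^ 25) + theta_term \<zeta> q 1 * theta (q powi 15) (q ^ 25)
     + theta_term \<zeta> q 2 * theta (q powi 20) (q ^ 25)"
    using theta_dissection5[OF root_nz assms(2,1)] root_power5 by (simp add: add_ac)
  moreover have "theta (q powi 0) (q ^ 25) = 0" by (simp add: theta_one[OF p(1)])
  moreover have "theta (q powi 15) (q ^ 25) = theta (q ^ 10) (q ^ 25)"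
    using theta_symmetric'[of "q ^ 25" "q ^ 10" "q ^ 15"] assms(2) by (simp flip: power_add)
  moreover have "theta (q powi 20) (q ^ 25) = theta (q ^ 5) (q ^ 25)"
    using theta_symmetric'[of "q ^ 25" "q ^ 5" "q ^ 20"] assms(2) by (simp flip: power_add)
  moreover have "rrA (q ^ 5) = theta (q ^ 10) (q ^ 25)" "rrB (q ^ 5) = theta (q ^ 5) (q ^ 25)"
    by (simp_all add: rrA_def rrB_def flip: power_mult)
  moreover have "theta_term \<zeta> q (-1) = - (\<zeta> ^ 4 * q)" "theta_term \<zeta> q 0 = 1" "theta_term \<zeta> q 1 = - \<zeta>" "theta_term \<zeta> q 2 = \<zeta>\<^sup>2 * q"
    using inv by (simp_all add: theta_term_def power_int_minus_left power_int_minus)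
  ultimately show ?thesis by (simp add: algebra_simps)
qed

text \<open>After the heads \<open>1 - \<zeta>\<close> and \<open>1 - \<zeta> ^ 2\<close> are split
  off, the four remaining products and one of the two copies of \<open>eulerP q\<close> run over all
  five roots of unity and combine to \<open>eulerP (q ^ 5)\<close>.\<close>

lemma theta_root_prod:
  assumes "norm q < 1" "q \<noteq> 0"
  shows "theta \<zeta> q * theta (\<zeta>\<^sup>2) q = (1 - \<zeta>) * (1 - \<zeta>\<^sup>2) * (eulerP q * eulerP (q ^ 5))"
proof -
  have d: "q / \<zeta> = \<zeta> ^ 4 * q" "q / \<zeta>\<^sup>2 = \<zeta> ^ 3 * q"
    using root_power5 root_nz by (simp_all add: field_simps eval_nat_numeral)
  have "theta \<zeta> q * theta (\<zeta>\<^sup>2) q = (1 - \<zeta>) * (1 - \<zeta>\<^sup>2) * (eulerP q * (\<Prod>j<5. qpoch_inf (\<zeta> ^ j * q) q))"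
    unfolding theta_def d qpoch_inf_head[OF assms(1), of \<zeta>] qpoch_inf_head[OF assms(1), of "\<zeta>\<^sup>2"] prod_lessThan_5
    by (simp add: eulerP_def mult_ac)
  then show ?thesis unfolding qpoch_inf_root_prod[OF assms(1)] eulerP_def .
qed

end

lemma ex_root: "\<exists>\<zeta>::complex. 1 + \<zeta> + \<zeta>\<^sup>2 + \<zeta> ^ 3 + \<zeta> ^ 4 = 0"
proof
  define \<zeta> where "\<zeta> = cis (2 * pi / 5)"
  have 5: "\<zeta> ^ 5 = 1" unfolding \<zeta>_def Complex.DeMoivre by simp
  have "\<zeta> \<noteq> 1"
  proof
    assume "\<zeta> = 1"
    then have "sin (2 * pi / 5) = 0" by (simp add: \<zeta>_def complex_eq_iff)
    moreover have "sin (2 * pi / 5) > 0" by (rule sin_gt_zero) auto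
    ultimately show False by simp
  qed
  moreover have "(\<zeta> - 1) * (1 + \<zeta> + \<zeta>\<^sup>2 + \<zeta> ^ 3 + \<zeta> ^ 4) = \<zeta> ^ 5 - 1" by algebra
  ultimately show "1 + \<zeta> + \<zeta>\<^sup>2 + \<zeta> ^ 3 + \<zeta> ^ 4 = 0" using 5 by simp
qed

lemma root_power: 
  assumes "1 + \<zeta> + \<zeta>\<^sup>2 + \<zeta> ^ 3 + \<zeta> ^ 4 = (0 :: complex)"
  shows "1 + \<zeta>\<^sup>2 + (\<zeta>\<^sup>2)\<^sup>2 + (\<zeta>\<^sup>2) ^ 3 + (\<zeta>\<^sup>2) ^ 4 = 0" "1 + \<zeta>^3 + (\<zeta>^3)\<^sup>2 + (\<zeta>^3) ^ 3 + (\<zeta>^3) ^ 4 = 0"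
    "1 + \<zeta>^4 + (\<zeta>^4)\<^sup>2 + (\<zeta>^4) ^ 3 + (\<zeta>^4) ^ 4 = 0"
  using assms by algebra+

text \<open>
  For a primitive fifth root of unity \<open>\<zeta>\<close>, the theta series at \<open>\<zeta>\<close> and \<open>\<zeta>\<^sup>2\<close> are linear in \<open>rrA\<close> and \<open>rrB\<close>,
  and their product is a product of Euler functions.
\<close>

theorem eulerP_dissection:
  assumes "norm q < 1" "q \<noteq> 0"
  shows "eulerP q * eulerP (q ^ 5) = (rrA (q ^ 5))\<^sup>2 - q * rrA (q ^ 5) * rrB (q ^ 5) - q\<^sup>2 * (rrB (q ^ 5))\<^sup>2"
proof -
  obtain \<zeta> :: complex where r: "1 + \<zeta> + \<zeta>\<^sup>2 + \<zeta> ^ 3 + \<zeta> ^ 4 = 0" using ex_root by blast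
  define A B where "A = rrA (q ^ 5)" and "B = rrB (q ^ 5)"
  have "(1 - \<zeta>) * (1 - \<zeta>\<^sup>2) * (eulerP q * eulerP (q ^ 5))
     = ((1 - \<zeta>) * A + q * (\<zeta>\<^sup>2 - \<zeta> ^ 4) * B) * ((1 - \<zeta>\<^sup>2) * A + q * ((\<zeta>\<^sup>2)\<^sup>2 - (\<zeta>\<^sup>2) ^ 4) * B)"
    unfolding theta_root_prod[OF r assms, symmetric] theta_root[OF r assms] theta_root[OF root_power(1)[OF r] assms] A_def B_def ..
  also have "\<dots> = (1 - \<zeta>) * (1 - \<zeta>\<^sup>2) * (A\<^sup>2 - q * A * B - q\<^sup>2 * B\<^sup>2)"
    using r by algebra
  finally have *: "(1 - \<zeta>) * (1 - \<zeta>\<^sup>2) * (eulerP q * eulerP (q ^ 5)) = (1 - \<zeta>) * (1 - \<zeta>\<^sup>2) * (A\<^sup>2 - q * A * B - q\<^sup>2 * B\<^sup>2)" .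
  have ne_1: "1 - x \<noteq> 0" if "1 + x + x\<^sup>2 + x ^ 3 + x ^ 4 = 0" for x :: complex
  proof
    assume "1 - x = 0"
    then have "x = 1" by simp
    with that show False by simp
  qed
  have "1 - \<zeta> \<noteq> 0" "1 - \<zeta>\<^sup>2 \<noteq> 0" using ne_1 r root_power(1)[OF r] by blast+
  with * show ?thesis by (simp add: A_def B_def)
qed

text \<open>The norm of the 5-dissection at a fifth root of \<open>q\<close>.\<close>

theorem eulerP_norm:
  assumes "norm q < 1" "q \<noteq> 0"
  shows "eulerP q ^ 11 = eulerP (q ^ 5) * (rrA q ^ 10 - 11 * q * rrA q ^ 5 * rrB q ^ 5 - q\<^sup>2 * rrB q ^ 10)"
proof -
  obtain \<zeta> :: complex where r: "1 + \<zeta> + \<zeta>\<^sup>2 + \<zeta> ^ 3 + \<zeta> ^ 4 = 0" using ex_root by blast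
  note r5 = root_power5[OF r]
  obtain s where s: "s ^ 5 = q" using exists_complex_root[of 5 q] by auto
  have s_nz: "s \<noteq> 0" using s assms by auto
  have ns: "norm s < 1" using assms(1) unfolding s[symmetric] norm_power
    by (metis not_less one_le_power norm_ge_zero)
  have nz: "\<zeta> ^ j * s \<noteq> 0" "norm (\<zeta> ^ j * s) < 1" "(\<zeta> ^ j * s) ^ 5 = q" for j
    using root_nz[OF r] s_nz ns root_norm[OF r] r5 s
    by (simp_all add: norm_mult norm_power power_mult_distrib power_mult[symmetric] mult.commute[of j])
       (simp add: power_mult)
  define A B where "A = rrA q" and "B = rrB q"
  have "eulerP (\<zeta> ^ j * s) * eulerP q = A\<^sup>2 - (\<zeta> ^ j * s) * A * B - (\<zeta> ^ j * s)\<^sup>2 * B\<^sup>2" for j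
    using eulerP_dissection[OF nz(2,1)] unfolding nz(3) A_def B_def .
  moreover have "(\<Prod>j<5. eulerP (\<zeta> ^ j * s)) * eulerP q ^ 5 = (\<Prod>j<5. eulerP (\<zeta> ^ j * s) * eulerP q)"
    by (simp add: prod.distrib)
  ultimately have "(\<Prod>j<5. eulerP (\<zeta> ^ j * s)) * eulerP q ^ 5 = (\<Prod>j<5. A\<^sup>2 - (\<zeta> ^ j * s) * A * B - (\<zeta> ^ j * s)\<^sup>2 * B\<^sup>2)"
    by simp
  also have "\<dots> = A ^ 10 - 11 * s ^ 5 * A ^ 5 * B ^ 5 - s ^ 10 * B ^ 10"
  proof -
    \<comment> \<open>The golden ratio and its conjugate split the quadratic form into linear
      factors, so each linear factor contributes a difference of fifth powers. The constant 11 is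
      the Lucas number \<open>\<alpha> ^ 5 + \<beta> ^ 5\<close>.\<close>
    define \<alpha> \<beta> :: complex where "\<alpha> = (1 + complex_of_real (sqrt 5)) / 2" and "\<beta> = (1 - complex_of_real (sqrt 5)) / 2"
    have "(complex_of_real (sqrt 5))\<^sup>2 = 5" by (simp flip: of_real_power)
    then have ab: "\<alpha> + \<beta> = 1" "\<alpha> * \<beta> = - 1"
      by (simp_all add: \<alpha>_def \<beta>_def field_simps power2_eq_square)
    have hom: "(\<Prod>j<5. A - \<zeta> ^ j * y) = A ^ 5 - y ^ 5" for y
    proof -
      have "(A - y) * (A - \<zeta> * y) * (A - \<zeta>\<^sup>2 * y) * (A - \<zeta> ^ 3 * y) * (A - \<zeta> ^ 4 * y) = A ^ 5 - y ^ 5"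
        using r by algebra
      then show ?thesis by (simp add: prod_lessThan_5)
    qed
    have "A\<^sup>2 - y * A * B - y\<^sup>2 * B\<^sup>2 = (A - \<alpha> * y * B) * (A - \<beta> * y * B)" for y
      using ab by algebra
    from this[of "\<zeta> ^ j * s" for j]
    have "A\<^sup>2 - (\<zeta> ^ j * s) * A * B - (\<zeta> ^ j * s)\<^sup>2 * B\<^sup>2 = (A - \<zeta> ^ j * (\<alpha> * s * B)) * (A - \<zeta> ^ j * (\<beta> * s * B))" for j
      by (simp only: mult_ac)
    then have "(\<Prod>j<5. A\<^sup>2 - (\<zeta> ^ j * s) * A * B - (\<zeta> ^ j * s)\<^sup>2 * B\<^sup>2) = (A ^ 5 - (\<alpha> * s * B) ^ 5) * (A ^ 5 - (\<beta> * s * B) ^ 5)"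
      by (simp only: prod.distrib hom)
    also have "\<dots> = A ^ 10 - (\<alpha> ^ 5 + \<beta> ^ 5) * s ^ 5 * A ^ 5 * B ^ 5 + (\<alpha> * \<beta>) ^ 5 * s ^ 10 * B ^ 10"
      by algebra
    also have "\<alpha> ^ 5 + \<beta> ^ 5 = 11" using ab by algebra
    finally show ?thesis by (simp add: ab)
  qed
  finally have *: "(\<Prod>j<5. eulerP (\<zeta> ^ j * s)) * eulerP q ^ 5 = A ^ 10 - 11 * s ^ 5 * A ^ 5 * B ^ 5 - s ^ 10 * B ^ 10" .
  have 1: "(\<Prod>j<5. eulerP (\<zeta> ^ j * s)) * eulerP q ^ 5 = A ^ 10 - 11 * q * A ^ 5 * B ^ 5 - q\<^sup>2 * B ^ 10"
  proof -
    have "s ^ 10 = q\<^sup>2" by (simp add: s[symmetric] flip: power_mult)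
    with * s show ?thesis by simp
  qed
  have nq: "norm q < 1" by fact
  \<comment> \<open>Second evaluation of the product of conjugates: the exponents in each factor are
    sorted modulo 5. Class 0 gives \<open>eulerP q\<close> for every \<open>j\<close>; in the other
    four classes the product over \<open>j\<close> runs over all fifth roots of unity.\<close>
  have e: "eulerP (\<zeta> ^ j * s) = qpoch_inf (\<zeta> ^ j * s) q * qpoch_inf ((\<zeta>\<^sup>2) ^ j * s\<^sup>2) q * qpoch_inf ((\<zeta> ^ 3) ^ j * s ^ 3) q
     * qpoch_inf ((\<zeta> ^ 4) ^ j * s ^ 4) q * eulerP q" for j
    unfolding eulerP_split5[OF nz(2)] nz(3) by (simp add: power_mult_distrib mult.commute flip: power_mult)
  have "(\<Prod>j<5. eulerP (\<zeta> ^ j * s)) = (\<Prod>j<5. qpoch_inf (\<zeta> ^ j * s) q) * (\<Prod>j<5. qpoch_inf ((\<zeta>\<^sup>2) ^ j * s\<^sup>2) q)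
      * (\<Prod>j<5. qpoch_inf ((\<zeta> ^ 3) ^ j * s ^ 3) q) * (\<Prod>j<5. qpoch_inf ((\<zeta> ^ 4) ^ j * s ^ 4) q) * eulerP q ^ 5"
    unfolding e prod.distrib by simp
  also have "\<dots> = qpoch_inf q (q ^ 5) * qpoch_inf (q\<^sup>2) (q ^ 5) * qpoch_inf (q ^ 3) (q ^ 5) * qpoch_inf (q ^ 4) (q ^ 5) * eulerP q ^ 5"
    unfolding qpoch_inf_root_prod[OF r nq] qpoch_inf_root_prod[OF root_power(1)[OF r] nq]
      qpoch_inf_root_prod[OF root_power(2)[OF r] nq] qpoch_inf_root_prod[OF root_power(3)[OF r] nq]
    by (simp add: s[symmetric] mult.commute flip: power_mult)
  finally have "eulerP (q ^ 5) * (\<Prod>j<5. eulerP (\<zeta> ^ j * s)) = eulerP q * eulerP q ^ 5"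
    using eulerP_split5[OF nq] by (simp add: mult_ac)
  then have "eulerP q ^ 11 = eulerP (q ^ 5) * ((\<Prod>j<5. eulerP (\<zeta> ^ j * s)) * eulerP q ^ 5)"
    by (simp add: eval_nat_numeral mult_ac)
  then show ?thesis unfolding 1 A_def B_def .
qed

text \<open>Here \<open>k\<close> is R(q) R(q^2)^2, and the first identity is the classical relation
  R(q)^2 / R(q^2) = (1 - k) / (1 + k). Up to the common factor \<open>T3 * A2\<close>, both
  \<open>1 + k\<close> and \<open>1 - k\<close> are products of two theta functions; comparing them
  gives the first identity, multiplying them the second.\<close>

theorem level10_identities:
  assumes "norm q < 1" "q \<noteq> 0"
  defines "w \<equiv> rrA q / rrB q" and "u \<equiv> rrA (q\<^sup>2) / rrB (q\<^sup>2)"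
  defines "k \<equiv> q / (w * u\<^sup>2)"
  shows "u * (1 + k) = w\<^sup>2 * (1 - k)"
    and "k * (eulerP (q\<^sup>2) * eulerP (q ^ 5) ^ 5) = (1 - k\<^sup>2) * q * eulerP q * eulerP (q ^ 10) ^ 5"
proof -
  define A B A2 B2 where "A = rrA q" and "B = rrB q" and "A2 = rrA (q\<^sup>2)" and "B2 = rrB (q\<^sup>2)"
  define P1 P2 P5 P10 where "P1 = eulerP q" and "P2 = eulerP (q\<^sup>2)" and "P5 = eulerP (q ^ 5)" and "P10 = eulerP (q ^ 10)"
  define T1 T3 where "T1 = theta q (q ^ 10)" and "T3 = theta (q ^ 3) (q ^ 10)"
  define Am Bm where "Am = theta (- q\<^sup>2) (q ^ 5)" and "Bm = theta (- q) (q ^ 5)"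
  have n: "norm (q\<^sup>2) < 1" "norm (q ^ 5) < 1" "norm (q ^ 10) < 1" using norm_power_lt_1[OF assms(1)] by auto
  have q: "q\<^sup>2 \<noteq> 0" "q ^ 5 \<noteq> 0" "q ^ 10 \<noteq> 0" "q ^ 3 \<noteq> 0" using assms(2) by auto
  have nz: "A \<noteq> 0" "B \<noteq> 0" "A2 \<noteq> 0" "B2 \<noteq> 0" "P1 \<noteq> 0" "P2 \<noteq> 0" "P5 \<noteq> 0" "P10 \<noteq> 0"
    unfolding A_def B_def A2_def B2_def P1_def P2_def P5_def P10_def
    using rrA_nz rrB_nz eulerP_nz n q assms(1,2) by blast+
  have AB: "A * B = P1 * P5" "A2 * B2 = P2 * P10"
    using rrA_rrB[OF assms(1,2)] rrA_rrB[OF n(1) q(1)]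
    by (simp_all add: A_def B_def A2_def B2_def P1_def P2_def P5_def P10_def flip: power_mult)
  have A: "A = theta (q\<^sup>2) (q ^ 5)" "B = theta q (q ^ 5)" "A2 = theta (q ^ 4) (q ^ 10)" "B2 = theta (q\<^sup>2) (q ^ 10)"
    by (simp_all add: A_def B_def A2_def B2_def rrA_def rrB_def flip: power_mult)
  have sym: "theta (q ^ 6) (q ^ 10) = A2" "theta (q ^ 8) (q ^ 10) = B2" "theta (q ^ 9) (q ^ 10) = T1" "theta (q ^ 7) (q ^ 10) = T3"
    unfolding A T1_def T3_def by (rule theta_symmetric'; use assms(2) in \<open>simp flip: power_add power_Suc\<close>)+
  have q11: "theta (q ^ 11) (q ^ 10) = - T1 / q"
    using theta_quasiperiodic[OF n(3) q(3) assms(2)] by (simp add: T1_def flip: power_Suc2)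
  \<comment> \<open>This and \<open>h\<close> below are the sum and the difference of the same two
    products of level 10, whose ratio turns out to be \<open>k\<close>. The theta functions
    \<open>Am\<close> and \<open>Bm\<close> at negated arguments are eliminated by
    \<open>sqr\<close>.\<close>
  have g: "A * Bm = T3 * A2 + q * B2 * T1"
  proof -
    have "A * Bm = theta (- q\<^sup>2 * - q) ((q ^ 5)\<^sup>2) * theta (- (q ^ 5) * q\<^sup>2 / (- q)) ((q ^ 5)\<^sup>2)
       - q\<^sup>2 * theta (- (q ^ 5) * q\<^sup>2 * (- q)) ((q ^ 5)\<^sup>2) * theta (- ((q ^ 5)\<^sup>2) * q\<^sup>2 / (- q)) ((q ^ 5)\<^sup>2)"
      unfolding A Bm_def by (rule theta_product) (use assms(2) q n in auto)
    also have "- q\<^sup>2 * - q = q ^ 3" by (simp add: eval_nat_numeral)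
    also have "- (q ^ 5) * q\<^sup>2 / (- q) = q ^ 6" using assms(2) by (simp add: eval_nat_numeral)
    also have "- (q ^ 5) * q\<^sup>2 * (- q) = q ^ 8" by (simp add: eval_nat_numeral)
    also have "- ((q ^ 5)\<^sup>2) * q\<^sup>2 / (- q) = q ^ 11" using assms(2) by (simp add: eval_nat_numeral)
    also have "(q ^ 5)\<^sup>2 = q ^ 10" by (simp flip: power_mult)
    finally show ?thesis unfolding sym q11 T3_def[symmetric] using assms(2) by (simp add: power2_eq_square)
  qed
  have h: "B * Am = T3 * A2 - q * B2 * T1"
  proof -
    have "B * Am = theta (- q * - q\<^sup>2) ((q ^ 5)\<^sup>2) * theta (- (q ^ 5) * q / (- q\<^sup>2)) ((q ^ 5)\<^sup>2)
       - q * theta (- (q ^ 5) * q * (- q\<^sup>2)) ((q ^ 5)\<^sup>2) * theta (- ((q ^ 5)\<^sup>2) * q / (- q\<^sup>2)) ((q ^ 5)\<^sup>2)"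
      unfolding A Am_def by (rule theta_product) (use assms(2) q n in auto)
    also have "- q * - q\<^sup>2 = q ^ 3" by (simp add: eval_nat_numeral)
    also have "- (q ^ 5) * q / (- q\<^sup>2) = q ^ 4" using assms(2) by (simp add: eval_nat_numeral)
    also have "- (q ^ 5) * q * (- q\<^sup>2) = q ^ 8" by (simp add: eval_nat_numeral)
    also have "- ((q ^ 5)\<^sup>2) * q / (- q\<^sup>2) = q ^ 9" using assms(2) by (simp add: eval_nat_numeral)
    also have "(q ^ 5)\<^sup>2 = q ^ 10" by (simp flip: power_mult)
    finally show ?thesis unfolding sym T3_def[symmetric] A(3)[symmetric] by simp
  qed
  have sqr: "B * Bm * P10 = B2 * P5\<^sup>2" "A * Am * P10 = A2 * P5\<^sup>2"
    using theta_square[OF n(2) q(2) assms(2)] theta_square[OF n(2) q(2) q(1)]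
    by (simp_all add: A Am_def Bm_def P5_def P10_def eulerP_def flip: power_mult)
  have split: "B * P10\<^sup>2 = P5 * T1 * A2" "A * P10\<^sup>2 = P5 * B2 * T3"
    using theta_split2[OF n(2) q(2) assms(2)] theta_split2[OF n(2) q(2) q(1)] sym
    by (simp_all add: A T1_def P5_def P10_def eulerP_def flip: power_mult power_add power_Suc)
  have T_nz: "T1 \<noteq> 0" "T3 \<noteq> 0" using split nz by auto
  have "k = q * B * B2\<^sup>2 / (A * A2\<^sup>2)"
    unfolding k_def w_def u_def A_def[symmetric] B_def[symmetric] A2_def[symmetric] B2_def[symmetric]
    using nz by (simp add: field_simps)
  also have "\<dots> = q * (B * P10\<^sup>2) * B2\<^sup>2 / ((A * P10\<^sup>2) * A2\<^sup>2)" using nz by simp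
  also have "\<dots> = q * B2 * T1 / (T3 * A2)"
    unfolding split using nz T_nz by (simp add: field_simps power2_eq_square)
  finally have k: "k = q * B2 * T1 / (T3 * A2)" .
  have kp: "(1 + k) * (T3 * A2) = A * Bm" and km: "(1 - k) * (T3 * A2) = B * Am"
    unfolding g h k using nz T_nz by (simp_all add: field_simps)
  have uw: "u * B2 = A2" "w * B = A"
    using nz by (simp_all add: u_def w_def A_def B_def A2_def B2_def)
  have "u * (1 + k) * (T3 * A2) * (P10 * B2 * B\<^sup>2) = A2 * B\<^sup>2 * A * (Bm * P10)"
    using kp uw by algebra
  also have "\<dots> = A\<^sup>2 * B2 * B * (Am * P10)"
    using sqr by algebra
  also have "\<dots> = w\<^sup>2 * (1 - k) * (T3 * A2) * (P10 * B2 * B\<^sup>2)"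
    using km uw by algebra
  finally show "u * (1 + k) = w\<^sup>2 * (1 - k)" using nz T_nz by simp
  have "(1 - k\<^sup>2) * (T3 * A2)\<^sup>2 * P10\<^sup>2 = (A * Am * P10) * (B * Bm * P10)"
    using kp km by algebra
  then have "(1 - k\<^sup>2) * (T3 * A2)\<^sup>2 * P10\<^sup>2 = A2 * B2 * P5 ^ 4" unfolding sqr by algebra
  then have "(1 - k\<^sup>2) * q * P1 * P10 ^ 5 * (T3 * A2)\<^sup>2 = A2 * B2 * P5 ^ 4 * q * P1 * P10 ^ 3"
    by algebra
  moreover have "k * (P2 * P5 ^ 5) * (T3 * A2)\<^sup>2 = q * (B2 * T3) * (T1 * A2) * P2 * P5 ^ 5"
    unfolding k using nz T_nz by (simp add: field_simps power2_eq_square)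
  moreover have "q * (B2 * T3) * (T1 * A2) * P2 * P5 ^ 5 = A2 * B2 * P5 ^ 4 * q * P1 * P10 ^ 3"
  proof -
    have "P5\<^sup>2 * ((B2 * T3) * (T1 * A2)) = P1 * P5 * P10 ^ 4" using split AB by algebra
    then have "P5 * ((B2 * T3) * (T1 * A2)) = P1 * P10 ^ 4" using nz by (simp add: power2_eq_square mult.assoc)
    then show ?thesis using AB by algebra
  qed
  ultimately have "k * (P2 * P5 ^ 5) * (T3 * A2)\<^sup>2 = (1 - k\<^sup>2) * q * P1 * P10 ^ 5 * (T3 * A2)\<^sup>2" by (simp only:)
  then show "k * (eulerP (q\<^sup>2) * eulerP (q ^ 5) ^ 5) = (1 - k\<^sup>2) * q * eulerP q * eulerP (q ^ 10) ^ 5"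
    using nz T_nz by (simp add: P1_def P2_def P5_def P10_def)
qed

section \<open>Formal Laurent series and the operator \<open>U5\<close>\<close>

unbundle fps_syntax

abbreviation pull :: "nat \<Rightarrow> complex fls \<Rightarrow> complex fls" where
  "pull m f \<equiv> fls_compose_power f m"

definition qv :: "complex fls" where
  "qv = fls_X"

lemma qv_nz [simp]: "qv \<noteq> 0" by (simp add: qv_def)

definition ld :: "complex fls \<Rightarrow> complex fls" where
  "ld f = qv * fls_deriv f / f"

definition U5 :: "complex fls \<Rightarrow> complex fls" where
  "U5 f = Abs_fls (\<lambda>n. f $$ (5 * n))"

lemma U5_nth [simp]: "U5 f $$ n = f $$ (5 * n)"
  unfolding U5_def
proof (rule nth_Abs_fls_lower_bound[of "min 0 (fls_subdegree f)"], intro allI impI)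
  fix k assume "k < min 0 (fls_subdegree f)"
  then have "5 * k < fls_subdegree f" by linarith
  then show "f $$ (5 * k) = 0" by (rule fls_eq0_below_subdegree)
qed

lemma U5_add [simp]: "U5 (f + g) = U5 f + U5 g" by (rule fls_eqI) simp
lemma U5_diff [simp]: "U5 (f - g) = U5 f - U5 g" by (rule fls_eqI) simp
lemma U5_minus [simp]: "U5 (- f) = - U5 f" by (rule fls_eqI) simp

lemma fls_mult_nth_Icc:
  fixes f g :: "'a::comm_semiring_1 fls"
  assumes "a \<le> fls_subdegree f" "n - fls_subdegree g \<le> b"
  shows "(f * g) $$ n = (\<Sum>i=a..b. f $$ i * g $$ (n - i))"
  unfolding fls_times_nth(2)
  by (rule sum.mono_neutral_left) (use assms in auto)

text \<open>In the convolution only indices divisible by 5 meet a nonzero coefficient of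
  \<open>pull 5 g\<close>. This linearity over series in the fifth power of \<open>q\<close> is what
  turns dissections into values of \<open>U5\<close>.\<close>

lemma U5_pull_mult: "U5 (pull 5 g * f) = g * U5 f"
proof (rule fls_eqI)
  fix n :: int
  \<comment> \<open>\<open>a\<close> and \<open>b\<close> are merely wide enough to contain the
    supports of both convolution sums.\<close>
  define a where "a = min (fls_subdegree g) (fls_subdegree (pull 5 g)) - \<bar>fls_subdegree (pull 5 g)\<bar>"
  define b where "b = max 0 (5 * n - fls_subdegree f) + max 0 (n - fls_subdegree (U5 f))"
  have b: "5 * n - fls_subdegree f \<le> 5 * b" "n - fls_subdegree (U5 f) \<le> b"
    by (auto simp: b_def max_def)
  have "U5 (pull 5 g * f) $$ n = (\<Sum>i=5*a..5*b. pull 5 g $$ i * f $$ (5 * n - i))"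
    unfolding U5_nth by (rule fls_mult_nth_Icc) (use b in \<open>auto simp: a_def\<close>)
  also have "\<dots> = (\<Sum>i\<in>(*) 5 ` {a..b}. pull 5 g $$ i * f $$ (5 * n - i))"
  proof (rule sum.mono_neutral_right)
    show "\<forall>i\<in>{5*a..5*b} - (*) 5 ` {a..b}. pull 5 g $$ i * f $$ (5 * n - i) = 0"
    proof
      fix i assume i: "i \<in> {5*a..5*b} - (*) 5 ` {a..b}"
      have "\<not> 5 dvd i"
      proof
        assume "5 dvd i"
        then obtain j where "i = 5 * j" by auto
        with i show False by auto
      qed
      then show "pull 5 g $$ i * f $$ (5 * n - i) = 0" by (simp add: fls_nth_compose_power del: fls_compose_power_mult)
    qed
  qed auto
  also have "\<dots> = (\<Sum>i=a..b. g $$ i * U5 f $$ (n - i))"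
    by (subst sum.reindex) (auto simp: inj_on_def fls_nth_compose_power right_diff_distrib)
  also have "\<dots> = (g * U5 f) $$ n"
    by (rule fls_mult_nth_Icc[symmetric]) (use b in \<open>auto simp: a_def\<close>)
  finally show "U5 (pull 5 g * f) $$ n = (g * U5 f) $$ n" .
qed

lemma U5_one [simp]: "U5 1 = 1" by (rule fls_eqI) auto

lemma U5_pull [simp]: "U5 (pull 5 g) = g"
  using U5_pull_mult[of g 1] by simp

lemma pull_numeral [simp]: "d > 0 \<Longrightarrow> pull d (numeral n) = numeral n"
  by (metis fls_compose_power_const_left fls_const_numeral)

lemma U5_numeral_mult [simp]: "U5 (numeral n * f) = numeral n * U5 f"
  using U5_pull_mult[of "numeral n" f] by simp
lemma U5_mult_numeral [simp]: "U5 (f * numeral n) = U5 f * numeral n"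
  using U5_numeral_mult[of n f] by (simp add: mult.commute)

lemma U5_numeral [simp]: "U5 (numeral n) = numeral n"
  using U5_numeral_mult[of n 1] by simp

lemma pull_inverse: "d > 0 \<Longrightarrow> pull d (inverse f) = inverse (pull d f)"
proof (cases "f = 0")
  case False
  assume d: "d > 0"
  have "pull d f * pull d (inverse f) = 1"
    using False d by (simp flip: fls_compose_power_mult)
  then show ?thesis by (simp add: inverse_unique)
qed simp

lemma pull_divide: "d > 0 \<Longrightarrow> pull d (f / g) = pull d f / pull d g"
  by (simp add: divide_inverse pull_inverse)

lemma pull_powi: "d > 0 \<Longrightarrow> pull d (f powi n) = pull d f powi n"
  by (cases "n \<ge> 0") (auto simp: power_int_def pull_inverse)

lemma pull_eq_0_iff: "d > 0 \<Longrightarrow> pull d f = 0 \<longleftrightarrow> f = 0"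
  by (metis U5_pull fls_compose_power_0_left  divide_self_if fls_compose_power_1_left pull_divide zero_neq_one)

lemma pull_pull: "d > 0 \<Longrightarrow> e > 0 \<Longrightarrow> pull d (pull e f) = pull (d * e) f"
proof (rule fls_eqI)
  fix n :: int
  assume d: "d > 0" "e > 0"
  have "int d dvd n \<and> int e dvd n div int d \<longleftrightarrow> int (d * e) dvd n"
    using d by (auto simp: dvd_div_iff_mult mult.commute dest: dvd_mult_left dvd_mult_right)
  then show "pull d (pull e f) $$ n = pull (d * e) f $$ n"
    using d by (auto simp: fls_nth_compose_power zdiv_zmult2_eq)
qed

lemma pull_qv [simp]: "d > 0 \<Longrightarrow> pull d qv = qv ^ d"
  by (simp add: qv_def fls_X_power_conv_shift_1)

lemma U5_qv_powi: "\<not> 5 dvd n \<Longrightarrow> U5 (qv powi n) = 0"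
  unfolding qv_def by (rule fls_eqI) auto

lemma ld_mult: "f \<noteq> 0 \<Longrightarrow> g \<noteq> 0 \<Longrightarrow> ld (f * g) = ld f + ld g"
  by (simp add: ld_def field_simps)

lemma ld_divide: "f \<noteq> 0 \<Longrightarrow> g \<noteq> 0 \<Longrightarrow> ld (f / g) = ld f - ld g"
  using ld_mult[of "f / g" g] by (simp add: field_simps)

lemma ld_one [simp]: "ld 1 = 0" by (simp add: ld_def)

lemma ld_qv [simp]: "ld qv = 1" by (simp add: ld_def qv_def)

lemma ld_power: "f \<noteq> 0 \<Longrightarrow> ld (f ^ n) = of_nat n * ld f"
  by (induction n) (auto simp: ld_mult algebra_simps)

lemma qv_deriv_pull: "d > 0 \<Longrightarrow> qv * fls_deriv (pull d f) = of_nat d * pull d (qv * fls_deriv f)"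
  unfolding qv_def
proof (rule fls_eqI)
  fix n :: int
  assume d: "d > 0"
  have X: "(fls_X * fls_deriv h) $$ n = of_int n * h $$ n" for h :: "complex fls" and n
    by (simp add: fls_X_times_conv_shift(1))
  show "(fls_X * fls_deriv (pull d f)) $$ n = (of_nat d * pull d (fls_X * fls_deriv f)) $$ n"
  proof (cases "int d dvd n")
    case True
    then obtain m where m: "n = int d * m" by auto
    show ?thesis
      unfolding X fls_of_nat fls_mult_const_nth m using d
      by (simp add: fls_nth_compose_power X del: fls_compose_power_mult)
  next
    case False
    then show ?thesis
      unfolding X fls_of_nat fls_mult_const_nth using d
      by (simp add: fls_nth_compose_power del: fls_compose_power_mult)
  qed
qed

lemma ld_pull: "d > 0 \<Longrightarrow> ld (pull d f) = of_nat d * pull d (ld f)"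
  unfolding ld_def by (subst qv_deriv_pull) (auto simp: pull_divide)

lemma divide_nonzero: "a \<noteq> 0 \<Longrightarrow> b \<noteq> 0 \<Longrightarrow> a / b \<noteq> (0 :: 'a :: field)"
  by simp

section \<open>Parametrization of level 10 by \<open>k\<close>\<close>

context
  fixes k :: "'a :: field"
  assumes k: "k \<noteq> 0" "1 - k \<noteq> 0" "1 + k \<noteq> 0"
begin

lemma one_minus_square: "1 - k\<^sup>2 = (1 - k) * (1 + k)"
  by (simp add: power2_eq_square algebra_simps)

text \<open>The left side is \<open>1 / \<kappa> - 11 - \<kappa>\<close> at
  \<open>\<kappa> = k * \<rho> ^ 2\<close> with \<open>\<rho> = (1 - k) / (1 + k)\<close>; it will
  be \<open>1 / t1\<close>.\<close>

lemma level10_identity1: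
  "1 / (k * ((1 - k) / (1 + k))\<^sup>2) - 11 - k * ((1 - k) / (1 + k))\<^sup>2 =
     (1 - 4 * k - k\<^sup>2)\<^sup>2 * (1 + k - k\<^sup>2) / (k * (1 - k\<^sup>2)\<^sup>2)"
proof -
  define n p where "n = 1 - k" and "p = 1 + k"
  have nz: "n \<noteq> 0" "p \<noteq> 0" using k by (simp_all add: n_def p_def)
  have "p ^ 4 - 11 * k * n\<^sup>2 * p\<^sup>2 - k\<^sup>2 * n ^ 4 = (1 - 4 * k - k\<^sup>2)\<^sup>2 * (1 + k - k\<^sup>2)"
    unfolding n_def p_def by algebra
  then have "(1 - 4 * k - k\<^sup>2)\<^sup>2 * (1 + k - k\<^sup>2) / (k * (n * p)\<^sup>2)
        = (p ^ 4 - 11 * k * n\<^sup>2 * p\<^sup>2 - k\<^sup>2 * n ^ 4) / (k * (n * p)\<^sup>2)" by simp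
  also have "\<dots> = 1 / (k * (n / p)\<^sup>2) - 11 - k * (n / p)\<^sup>2"
    using nz k(1) by (simp add: divide_simps) (simp add: algebra_simps eval_nat_numeral)
  finally show ?thesis by (simp add: one_minus_square n_def p_def)
qed

text \<open>The companion at \<open>\<mu> = k ^ 2 / \<rho>\<close>; it will be
  \<open>1 / t\<close>.\<close>

lemma level10_identity2:
  "1 / (k\<^sup>2 / ((1 - k) / (1 + k))) - 11 - k\<^sup>2 / ((1 - k) / (1 + k)) =
     (1 - 4 * k - k\<^sup>2) * (1 + k - k\<^sup>2)\<^sup>2 / (k\<^sup>2 * (1 - k\<^sup>2))"
proof -
  define n p where "n = 1 - k" and "p = 1 + k"
  have nz: "n \<noteq> 0" "p \<noteq> 0" using k by (simp_all add: n_def p_def)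
  have "n\<^sup>2 - 11 * k\<^sup>2 * n * p - k ^ 4 * p\<^sup>2 = (1 - 4 * k - k\<^sup>2) * (1 + k - k\<^sup>2)\<^sup>2"
    unfolding n_def p_def by algebra
  then have "(1 - 4 * k - k\<^sup>2) * (1 + k - k\<^sup>2)\<^sup>2 / (k\<^sup>2 * (n * p))
        = (n\<^sup>2 - 11 * k\<^sup>2 * n * p - k ^ 4 * p\<^sup>2) / (k\<^sup>2 * (n * p))" by simp
  also have "\<dots> = 1 / (k\<^sup>2 / (n / p)) - 11 - k\<^sup>2 / (n / p)"
    using nz k(1) by (simp add: divide_simps) (simp add: algebra_simps eval_nat_numeral)
  finally show ?thesis by (simp add: one_minus_square n_def p_def)
qed

end

lemma inverse_eta_power: "a \<noteq> 0 \<Longrightarrow> b \<noteq> 0 \<Longrightarrow> 1 / (c * (b / a) ^ n) = (a / b) ^ n / (c :: 'a :: field)"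
  by (simp add: power_divide)

lemma norm_div: "c \<noteq> 0 \<Longrightarrow> a \<noteq> 0 \<Longrightarrow> (a - 11 * c - c\<^sup>2 / a) / c = 1 / (c / a) - 11 - c / (a :: 'a :: field)"
  by (simp add: field_simps power2_eq_square)

text \<open>
  In the application \<open>P = (q;q)\<^sub>\<infinity>\<close> and \<open>w\<close> is \<open>1/R(q)\<close> without its fractional power of \<open>q\<close>. Then \<open>k\<close> is Ramanujan's
  parameter, \<open>\<kappa> = R(q)\<^sup>5\<close>, \<open>\<mu> = R(q\<^sup>2)\<^sup>5\<close>, and \<open>X\<close>, \<open>x\<close> are \<open>1/R\<close> at \<open>q\<close> to the 5 and 10; \<open>z\<close> is the weight two form
  in terms of which everything is expressed.
\<close>

locale eta_quintic =
  fixes P w :: "complex fls"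
  assumes P_nz: "P \<noteq> 0" and w_nz: "w \<noteq> 0"
    and dissection: "P / pull 25 P = pull 5 w - qv - qv\<^sup>2 / pull 5 w"
    and norm: "(P / pull 5 P) ^ 6 = w ^ 5 - 11 * qv - qv\<^sup>2 / w ^ 5"
    and level10: "pull 2 w * (1 + qv / (w * (pull 2 w)\<^sup>2)) = w\<^sup>2 * (1 - qv / (w * (pull 2 w)\<^sup>2))"
    and eta_quotient: "qv / (w * (pull 2 w)\<^sup>2) * (pull 2 P * pull 5 P ^ 5)
           = (1 - (qv / (w * (pull 2 w)\<^sup>2))\<^sup>2) * qv * P * pull 10 P ^ 5"
begin

definition "u = pull 2 w"
definition "k = qv / (w * u\<^sup>2)"
text \<open>By \<open>u_eq\<close> this is \<open>u / w ^ 2\<close>, that is R(q)^2 /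
  R(q^2).\<close>

definition "\<rho> = (1 - k) / (1 + k)"
definition "\<kappa> = qv / w ^ 5"
definition "\<mu> = qv\<^sup>2 / u ^ 5"
definition "t1 = qv * (pull 5 P / P) ^ 6"
definition "t = pull 2 t1"
text \<open>The coefficient 2 of E_2(2 tau) is absorbed here, since \<open>ld (pull 2 P)\<close> is
  \<open>2 * pull 2 (ld P)\<close>.\<close>

definition "E = 1 + 24 * (ld (pull 2 P) - ld P)"
definition "E5 = pull 5 E"
definition "z = ld k"
definition "Z = qv\<^sup>2 * pull 50 P / pull 2 P"
text \<open>It is \<open>y\<close>, not \<open>Z\<close>, that is a Laurent polynomial in
  \<open>x\<close>, so \<open>U5\<close> is evaluated first on powers of \<open>y\<close>.\<close>

definition "y = 1 / Z"
definition "X = pull 5 w / qv"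
definition "x = pull 5 u / qv\<^sup>2"

lemma u_nz: "u \<noteq> 0" by (simp add: u_def pull_eq_0_iff w_nz)
lemma k_nz: "k \<noteq> 0" by (simp add: k_def u_nz w_nz)
lemma X_nz: "X \<noteq> 0" unfolding X_def by (rule divide_nonzero) (simp_all add: pull_eq_0_iff w_nz)
lemma x_nz: "x \<noteq> 0" unfolding x_def by (rule divide_nonzero) (simp_all add: pull_eq_0_iff u_nz)
lemma pull_P_nz: "d > 0 \<Longrightarrow> pull d P \<noteq> 0" by (simp add: pull_eq_0_iff P_nz)
lemma t1_nz: "t1 \<noteq> 0" by (simp add: t1_def P_nz pull_P_nz)
lemma t_nz: "t \<noteq> 0" by (simp add: t_def t1_nz pull_eq_0_iff)
lemma Z_nz: "Z \<noteq> 0" by (simp add: Z_def pull_P_nz)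
lemma y_nz: "y \<noteq> 0" by (simp add: y_def Z_nz)

lemma eta_quotient': "k * (pull 2 P * pull 5 P ^ 5) = (1 - k\<^sup>2) * qv * P * pull 10 P ^ 5"
  using eta_quotient unfolding k_def u_def .

lemma one_minus_k2_nz: "1 - k\<^sup>2 \<noteq> 0"
  using eta_quotient' k_nz pull_P_nz[of 2] pull_P_nz[of 5] by auto

lemma k_pm_nz: "1 - k \<noteq> 0" "1 + k \<noteq> 0"
proof -
  have "(1 - k) * (1 + k) \<noteq> 0"
    using one_minus_k2_nz by (simp add: power2_eq_square algebra_simps)
  then show "1 - k \<noteq> 0" "1 + k \<noteq> 0" by (metis mult_zero_left, metis mult_zero_right)
qed

lemma \<rho>_nz: "\<rho> \<noteq> 0" unfolding \<rho>_def by (rule divide_nonzero[OF k_pm_nz])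

lemma u_eq: "u = \<rho> * w\<^sup>2"
  using level10 k_pm_nz unfolding \<rho>_def k_def[symmetric] u_def[symmetric]
  by (simp add: field_simps)

text \<open>Together with \<open>u_eq\<close> this makes the powers of \<open>w\<close> cancel in
  \<open>\<kappa>\<close> and \<open>\<mu>\<close>, which thus become rational functions of
  \<open>k\<close>.\<close>

lemma X_eq: "qv = k * \<rho>\<^sup>2 * w ^ 5"
proof -
  have "qv = k * (w * u\<^sup>2)" by (simp add: k_def w_nz u_nz)
  also have "\<dots> = k * \<rho>\<^sup>2 * w ^ 5" unfolding u_eq by algebra
  finally show ?thesis .
qed

lemma \<kappa>_eq: "\<kappa> = k * \<rho>\<^sup>2"
  using w_nz unfolding \<kappa>_def X_eq by simp

lemma \<mu>_eq: "\<mu> = k\<^sup>2 / \<rho>"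
  using w_nz \<rho>_nz unfolding \<mu>_def X_eq u_eq by (simp add: field_simps eval_nat_numeral)

lemma t1_eq: "1 / t1 = 1 / \<kappa> - 11 - \<kappa>"
  unfolding t1_def \<kappa>_def inverse_eta_power[OF P_nz pull_P_nz[of 5, simplified]] norm
  by (rule norm_div) (simp_all add: w_nz)

lemma pull2_\<kappa>: "pull 2 \<kappa> = \<mu>"
  by (simp add: \<kappa>_def \<mu>_def u_def pull_divide )

lemma t_eq: "1 / t = 1 / \<mu> - 11 - \<mu>"
proof -
  have "1 / t = pull 2 (1 / t1)" by (simp add: t_def pull_divide)
  also have "\<dots> = 1 / \<mu> - 11 - \<mu>" unfolding t1_eq by (simp add: pull_divide pull2_\<kappa>)
  finally show ?thesis .
qed

definition "\<phi> = 1 + k - k\<^sup>2"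
definition "\<psi> = 1 - 4 * k - k\<^sup>2"

lemma t1_factor: "1 / t1 = \<psi>\<^sup>2 * \<phi> / (k * (1 - k\<^sup>2)\<^sup>2)"
  unfolding t1_eq \<kappa>_eq \<rho>_def \<phi>_def \<psi>_def by (rule level10_identity1[OF k_nz k_pm_nz])

lemma t_factor: "1 / t = \<psi> * \<phi>\<^sup>2 / (k\<^sup>2 * (1 - k\<^sup>2))"
  unfolding t_eq \<mu>_eq \<rho>_def \<phi>_def \<psi>_def by (rule level10_identity2[OF k_nz k_pm_nz])

lemma \<phi>_nz: "\<phi> \<noteq> 0" using t1_nz t1_factor by auto
lemma \<psi>_nz: "\<psi> \<noteq> 0" using t1_nz t1_factor by auto

lemma qv_deriv_k: "qv * fls_deriv k = k * z"
  using k_nz by (simp add: z_def ld_def)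

lemma ld_one_minus_k2: "ld (1 - k\<^sup>2) = - 2 * k\<^sup>2 * z / (1 - k\<^sup>2)"
proof -
  have "qv * fls_deriv (1 - k\<^sup>2) = - 2 * k * (qv * fls_deriv k)"
    by (simp add: power2_eq_square algebra_simps)
  then show ?thesis unfolding ld_def qv_deriv_k by (simp add: power2_eq_square mult_ac)
qed

lemma ld_\<phi>: "ld \<phi> = k * (1 - 2 * k) * z / \<phi>"
proof -
  have "qv * fls_deriv \<phi> = (1 - 2 * k) * (qv * fls_deriv k)"
    by (simp add: \<phi>_def power2_eq_square algebra_simps)
  then show ?thesis unfolding ld_def qv_deriv_k by (simp add: mult_ac)
qed

lemma ld_\<psi>: "ld \<psi> = - k * (4 + 2 * k) * z / \<psi>"
proof -
  have "qv * fls_deriv \<psi> = - (4 + 2 * k) * (qv * fls_deriv k)"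
    by (simp add: \<psi>_def power2_eq_square algebra_simps)
  then have "qv * fls_deriv \<psi> = - k * (4 + 2 * k) * z"
    unfolding qv_deriv_k by (simp add: algebra_simps)
  then show ?thesis unfolding ld_def by simp
qed

lemma ld_\<rho>: "ld \<rho> = - 2 * k * z / (1 - k\<^sup>2)"
proof -
  have "qv * fls_deriv (1 - k) = - (qv * fls_deriv k)"
       "qv * fls_deriv (1 + k) = qv * fls_deriv k" by simp_all
  then have "ld (1 - k) = - k * z / (1 - k)" "ld (1 + k) = k * z / (1 + k)"
    unfolding ld_def qv_deriv_k by simp_all
  then have "ld \<rho> = - k * z / (1 - k) - k * z / (1 + k)"
    unfolding \<rho>_def using ld_divide k_pm_nz by simp
  also have "(1 - k\<^sup>2) = (1 - k) * (1 + k)" by algebra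
  then have "- k * z / (1 - k) - k * z / (1 + k) = - 2 * k * z / (1 - k\<^sup>2)" 
    using k_pm_nz by (simp add: divide_simps) (simp add: algebra_simps)
  finally show ?thesis .
qed

text \<open>Logarithmic derivatives of \<open>eta_quotient'\<close>, \<open>t1_factor\<close> and
  \<open>t_factor\<close>. There are four unknowns, but \<open>E\<close> and \<open>E5\<close> need
  only \<open>p2 - p1\<close> and \<open>p10 - p5\<close>: the first relation links these two, and
  so does the difference of the other two.\<close>

lemma ld_eta_relations:
  defines "p1 \<equiv> ld P" and "p2 \<equiv> ld (pull 2 P)" and "p5 \<equiv> ld (pull 5 P)" and "p10 \<equiv> ld (pull 10 P)"
  shows "z + p2 + 5 * p5 = - 2 * k\<^sup>2 * z / (1 - k\<^sup>2) + 1 + p1 + 5 * p10"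
    and "1 + 6 * (p5 - p1) = z + 2 * ld (1 - k\<^sup>2) - 2 * ld \<psi> - ld \<phi>"
    and "2 + 6 * (p10 - p2) = 2 * z + ld (1 - k\<^sup>2) - ld \<psi> - 2 * ld \<phi>"
proof -
  have "ld (k * (pull 2 P * pull 5 P ^ 5)) = z + p2 + 5 * p5"
    using k_nz pull_P_nz by (simp add: ld_mult ld_power z_def p2_def p5_def)
  moreover have "ld ((1 - k\<^sup>2) * qv * P * pull 10 P ^ 5) = ld (1 - k\<^sup>2) + 1 + p1 + 5 * p10"
    using one_minus_k2_nz pull_P_nz P_nz by (simp add: ld_mult ld_power p1_def p10_def)
  ultimately show "z + p2 + 5 * p5 = - 2 * k\<^sup>2 * z / (1 - k\<^sup>2) + 1 + p1 + 5 * p10"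
    by (simp add: eta_quotient' ld_one_minus_k2)
  have "t1 = (k * (1 - k\<^sup>2)\<^sup>2) / (\<psi>\<^sup>2 * \<phi>)"
    using arg_cong[OF t1_factor, of inverse] by simp
  moreover have "ld t1 = 1 + 6 * (p5 - p1)"
    using P_nz pull_P_nz[of 5] by (simp add: t1_def ld_mult ld_power ld_divide p1_def p5_def algebra_simps)
  ultimately show "1 + 6 * (p5 - p1) = z + 2 * ld (1 - k\<^sup>2) - 2 * ld \<psi> - ld \<phi>"
    using k_nz one_minus_k2_nz \<phi>_nz \<psi>_nz by (simp add: ld_mult ld_power ld_divide z_def algebra_simps)
  have "t = (k\<^sup>2 * (1 - k\<^sup>2)) / (\<psi> * \<phi>\<^sup>2)"
    using arg_cong[OF t_factor, of inverse] by simp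
  moreover have "t = qv ^ 2 * (pull 10 P / pull 2 P) ^ 6"
    by (simp add: t_def t1_def pull_divide pull_pull )
  then have "ld t = 2 + 6 * (p10 - p2)"
    using pull_P_nz by (simp add: ld_mult ld_power ld_divide p2_def p10_def)
  ultimately show "2 + 6 * (p10 - p2) = 2 * z + ld (1 - k\<^sup>2) - ld \<psi> - 2 * ld \<phi>"
    using k_nz one_minus_k2_nz \<phi>_nz \<psi>_nz by (simp add: ld_mult ld_power ld_divide z_def diff_diff_eq)
qed

definition "coeffE = 1 + 5 * k * (1 - 2 * k) / \<phi> + 2 * k\<^sup>2 / (1 - k\<^sup>2) + 5 * k * (4 + 2 * k) / \<psi>"
definition "coeffE5 = 5 + k * (1 - 2 * k) / \<phi> + 10 * k\<^sup>2 / (1 - k\<^sup>2) + k * (4 + 2 * k) / \<psi>"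

lemma E_eq: "E = z * coeffE"
proof -
  note L = ld_eta_relations[unfolded ld_\<phi> ld_\<psi> ld_one_minus_k2]
  define F G M where "F = k * (1 - 2 * k) / \<phi>" and "G = k * (4 + 2 * k) / \<psi>" and "M = 2 * k\<^sup>2 / (1 - k\<^sup>2)"
  have 1: "z + ld (pull 2 P) + 5 * ld (pull 5 P) = - M * z + 1 + ld P + 5 * ld (pull 10 P)"
    using L(1) by (simp add: M_def mult_ac)
  have 2: "1 + 6 * (ld (pull 5 P) - ld P) = z - 2 * M * z + 2 * G * z - F * z"
    using L(2) by (simp add: M_def F_def G_def mult_ac)
  have 3: "2 + 6 * (ld (pull 10 P) - ld (pull 2 P)) = 2 * z - M * z + G * z - 2 * F * z"
    using L(3) by (simp add: M_def F_def G_def mult_ac)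
  have "E = z * (1 + 5 * F + M + 5 * G)"
    unfolding E_def using 1 2 3 by algebra
  then show ?thesis by (simp add: coeffE_def F_def G_def M_def mult_ac)
qed

lemma E5_eq: "5 * E5 = z * coeffE5"
proof -
  note L = ld_eta_relations[unfolded ld_\<phi> ld_\<psi> ld_one_minus_k2]
  define F G M where "F = k * (1 - 2 * k) / \<phi>" and "G = k * (4 + 2 * k) / \<psi>" and "M = 2 * k\<^sup>2 / (1 - k\<^sup>2)"
  have 1: "z + ld (pull 2 P) + 5 * ld (pull 5 P) = - M * z + 1 + ld P + 5 * ld (pull 10 P)"
    using L(1) by (simp add: M_def mult_ac)
  have 2: "1 + 6 * (ld (pull 5 P) - ld P) = z - 2 * M * z + 2 * G * z - F * z"
    using L(2) by (simp add: M_def F_def G_def mult_ac)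
  have 3: "2 + 6 * (ld (pull 10 P) - ld (pull 2 P)) = 2 * z - M * z + G * z - 2 * F * z"
    using L(3) by (simp add: M_def F_def G_def mult_ac)
  have 4: "ld (pull 10 P) = 5 * pull 5 (ld (pull 2 P))" "ld (pull 5 P) = 5 * pull 5 (ld P)"
    using ld_pull[of 5 "pull 2 P"] ld_pull[of 5 P] by (simp_all add: pull_pull)
  have "E5 = 1 + 24 * (pull 5 (ld (pull 2 P)) - pull 5 (ld P))"
    by (simp add: E5_def E_def)
  then have "5 * E5 = z * (5 + F + 5 * M + G)"
    using 1 2 3 4 by algebra
  then show ?thesis by (simp add: coeffE5_def F_def G_def M_def mult_ac)
qed

text \<open>\<open>a1\<close> and \<open>b1\<close> are minus the logarithmic derivatives of
  \<open>\<mu>\<close> and \<open>\<kappa>\<close>; under \<open>pull 5\<close> they become those of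
  \<open>x\<close> and \<open>X\<close>.\<close>

definition "a1 = - 2 * z * (1 + k / (1 - k\<^sup>2))"
definition "b1 = - z * (1 - 4 * k / (1 - k\<^sup>2))"

lemma ld_w: "5 * ld w - 1 = b1"
proof -
  have "ld \<kappa> = 1 - 5 * ld w" using w_nz by (simp add: \<kappa>_def ld_divide ld_power)
  moreover have "ld \<kappa> = z + 2 * ld \<rho>" using k_nz \<rho>_nz by (simp add: \<kappa>_eq ld_mult ld_power z_def)
  ultimately have "5 * ld w - 1 = - (z + 2 * ld \<rho>)" by algebra
  then show ?thesis by (simp add: ld_\<rho> b1_def algebra_simps)
qed

lemma ld_u: "5 * ld u - 2 = a1"
proof -
  have "ld \<mu> = 2 - 5 * ld u" using u_nz by (simp add: \<mu>_def ld_divide ld_power)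
  moreover have "ld \<mu> = 2 * z - ld \<rho>" using k_nz \<rho>_nz by (simp add: \<mu>_eq ld_divide ld_power z_def)
  ultimately have "5 * ld u - 2 = - (2 * z - ld \<rho>)" by algebra
  then show ?thesis by (simp add: ld_\<rho> a1_def algebra_simps)
qed

end

text \<open>The long factor is the product of the other four conjugates of
  \<open>x - 1 - 1 / x\<close> when \<open>x\<close> is multiplied by fifth roots of unity. Dividing
  by this quadratic expression thus becomes multiplying by a Laurent polynomial over a function of
  \<open>x ^ 5\<close>.\<close>

lemma quintic_norm: "(x::'a::field) \<noteq> 0 \<Longrightarrow> (x - 1 - 1 / x) *
   (x ^ 4 + x ^ 3 + 2 * x\<^sup>2 + 3 * x + 5 - 3 / x + 2 / x\<^sup>2 - 1 / x ^ 3 + 1 / x ^ 4) = x ^ 5 - 11 - 1 / x ^ 5"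
  by (simp add: divide_simps) (simp add: algebra_simps eval_nat_numeral)

section \<open>The 5-dissection of \<open>E\<close> in monomials in \<open>X\<close> and
  \<open>x\<close>\<close>

context eta_quintic begin

text \<open>\<open>X\<close> and \<open>x\<close> are \<open>1/q\<close> and \<open>1/q\<^sup>2\<close> times series in the fifth power of \<open>q\<close>.\<close>

definition "mon a b = X powi a * x powi b"

lemma mon_mult: "mon a b * mon c d = mon (a + c) (b + d)"
  by (simp add: mon_def power_int_add X_nz x_nz)

lemma mon_mult': "mon a b * (mon c d * h) = mon (a + c) (b + d) * h"
  by (simp add: mon_mult flip: mult.assoc)

lemma mon_eq: "mon a b = pull 5 (w powi a * u powi b) * qv powi (- (a + 2 * b))"
proof -
  have "mon a b = pull 5 (w powi a * u powi b) * (qv powi (- a) * qv powi (- 2 * b))"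
    unfolding mon_def X_def x_def power_int_divide_distrib fls_compose_power_mult
    by (simp add: pull_powi power_int_minus divide_inverse power_int_mult power_int_mult_distrib power2_eq_square mult_ac)
  also have "qv powi (- a) * qv powi (- 2 * b) = (qv powi (- (a + 2 * b)) :: complex fls)"
    by (subst power_int_add[symmetric]) auto
  finally show ?thesis .
qed

lemma U5_mon_0: "\<not> 5 dvd a + 2 * b \<Longrightarrow> U5 (mon a b) = 0"
  unfolding mon_eq U5_pull_mult by (subst U5_qv_powi) (simp_all only: dvd_minus_iff, simp_all)

text \<open>Substituting \<open>u_eq\<close> and \<open>X_eq\<close> leaves a monomial in
  \<open>\<rho>\<close>, \<open>k\<close> and \<open>w\<close>, in which \<open>w\<close> has
  exponent \<open>a + 2 * b - 5 * c = 0\<close>.\<close>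

lemma U5_mon: 
  assumes "a + 2 * b = 5 * c"
  shows "U5 (mon a b) = \<rho> powi (b - 2 * c) * k powi (- c)"
proof -
  have "qv powi (- (a + 2 * b)) = pull 5 (qv powi (- c))"
    unfolding assms by (simp add: pull_powi pull_inverse power_int_minus power_int_mult)
  then have "U5 (mon a b) = w powi a * u powi b * qv powi (- c)"
    unfolding mon_eq by (simp only: U5_pull flip: fls_compose_power_mult)
  also have "\<dots> = w powi a * (\<rho> * w\<^sup>2) powi b * (k * \<rho>\<^sup>2 * w ^ 5) powi (- c)"
    unfolding u_eq[symmetric] X_eq[symmetric] ..
  also have "\<dots> = (w powi a * w powi (2 * b) * w powi (5 * (- c))) * (\<rho> powi b * \<rho> powi (2 * (- c))) * k powi (- c)"
    by (simp add: power_int_mult_distrib power_int_mult del: mult_minus_right)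
  also have "w powi a * w powi (2 * b) * w powi (5 * (- c)) = 1"
    by (subst power_int_add[symmetric], simp add: w_nz)+ (simp add: assms)
  also have "\<rho> powi b * \<rho> powi (2 * (- c)) = \<rho> powi (b - 2 * c)"
    by (subst power_int_add[symmetric]) (simp_all add: \<rho>_nz)
  finally show ?thesis by simp
qed

lemma y_dissect: "y = x - 1 - 1 / x"
proof -
  have "pull 2 P / pull 50 P = pull 2 (P / pull 25 P)"
    by (simp add: pull_divide pull_pull)
  also have "\<dots> = pull 5 u - qv\<^sup>2 - qv ^ 4 / pull 5 u"
    unfolding dissection by (simp add: pull_divide pull_pull u_def)
  finally have 1: "pull 2 P / pull 50 P = pull 5 u - qv\<^sup>2 - qv ^ 4 / pull 5 u" .
  have "y = pull 2 P / pull 50 P / qv\<^sup>2"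
    unfolding y_def Z_def by (metis divide_divide_eq_left' divide_divide_eq_right mult_1)
  also have "\<dots> = (pull 5 u - qv\<^sup>2 - qv ^ 4 / pull 5 u) / qv\<^sup>2" unfolding 1 ..
  also have "\<dots> = x - 1 - 1 / x"
  proof -
    have *: "(a - q\<^sup>2 - q ^ 4 / a) / q\<^sup>2 = a / q\<^sup>2 - 1 - 1 / (a / q\<^sup>2)" if "q \<noteq> 0" for a q :: "complex fls"
      using that by (simp add: diff_divide_distrib eval_nat_numeral)
    show ?thesis unfolding x_def by (rule *) auto
  qed
  finally show ?thesis .
qed

text \<open>The counterpart of \<open>y\<close> with \<open>q\<close> in place of its
  square.\<close>

definition "v = P / (qv * pull 25 P)"

lemma v_dissect: "v = X - 1 - 1 / X"
proof -
  have "v = P / pull 25 P / qv" by (simp add: v_def)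
  also have "\<dots> = (pull 5 w - qv - qv\<^sup>2 / pull 5 w) / qv" unfolding dissection ..
  also have "\<dots> = X - 1 - 1 / X"
  proof -
    have *: "(a - q - q\<^sup>2 / a) / q = a / q - 1 - 1 / (a / q)" if "q \<noteq> 0" for a q :: "complex fls"
      using that by (simp add: diff_divide_distrib eval_nat_numeral)
    show ?thesis unfolding X_def by (rule *) auto
  qed
  finally show ?thesis .
qed

lemma v_nz: "v \<noteq> 0"
  unfolding v_def by (rule divide_nonzero) (simp_all add: P_nz pull_P_nz)

lemma ld_quadratic: "h \<noteq> 0 \<Longrightarrow> ld (h - 1 - 1 / h) = (h + 1 / h) * ld h / (h - 1 - 1 / h)"
proof -
  assume h: "h \<noteq> 0"
  have "fls_deriv (1 / h) = - fls_deriv h / h\<^sup>2"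
    using fls_inverse_deriv'[of h] by (simp add: inverse_eq_divide)
  then have "fls_deriv (h - 1 - 1 / h) = fls_deriv h + fls_deriv h / h\<^sup>2"
    by simp
  then have "qv * fls_deriv (h - 1 - 1 / h) = (h + 1 / h) * (qv * fls_deriv h / h)"
    using h by (simp add: power2_eq_square field_simps)
  then show ?thesis unfolding ld_def by simp
qed

lemma ld_x: "ld x = pull 5 a1"
proof -
  have "ld x = 5 * pull 5 (ld u) - 2"
    unfolding x_def using ld_pull[of 5 u] by (subst ld_divide) (auto simp: pull_eq_0_iff u_nz ld_power)
  also have "\<dots> = pull 5 (5 * ld u - 2)" by simp
  finally show ?thesis unfolding ld_u .
qed

lemma ld_X: "ld X = pull 5 b1"
proof -
  have "ld X = 5 * pull 5 (ld w) - 1"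
    unfolding X_def using ld_pull[of 5 w] by (subst ld_divide) (auto simp: pull_eq_0_iff w_nz)
  also have "\<dots> = pull 5 (5 * ld w - 1)" by simp
  finally show ?thesis unfolding ld_w .
qed

text \<open>\<open>pull 5 E5\<close> is \<open>E\<close> at 25 tau, and
  \<open>E - 25 * pull 5 E5\<close> is 24 times the logarithmic derivative of \<open>y / v\<close>.
  By the dissections, \<open>y\<close> and \<open>v\<close> depend only on \<open>x\<close> and on
  \<open>X\<close>, whose logarithmic derivatives are series in the fifth power of
  \<open>q\<close>.\<close>

lemma E_dissect: "E = 25 * pull 5 E5 + 24 * pull 5 a1 * ((x + 1 / x) / y) - 24 * pull 5 b1 * ((X + 1 / X) / v)"
proof -
  have "y = pull 2 P / (qv\<^sup>2 * pull 50 P)" by (simp add: y_def Z_def)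
  then have "ld y = ld (pull 2 P) - 2 - ld (pull 50 P)"
    using pull_P_nz by (simp add: ld_divide ld_mult ld_power)
  moreover have "ld v = ld P - 1 - ld (pull 25 P)"
    using pull_P_nz P_nz by (simp add: v_def ld_divide ld_mult)
  moreover have "ld (pull 50 P) = 25 * pull 25 (ld (pull 2 P))" "ld (pull 25 P) = 25 * pull 25 (ld P)"
    using ld_pull[of 25 "pull 2 P"] ld_pull[of 25 P] by (simp_all add: pull_pull)
  moreover have "pull 5 E5 = 1 + 24 * (pull 25 (ld (pull 2 P)) - pull 25 (ld P))"
    by (simp add: E5_def E_def pull_pull)
  ultimately have "E = 25 * pull 5 E5 + 24 * ld y - 24 * ld v"
    unfolding E_def by simp
  also have "ld y = (x + 1 / x) * pull 5 a1 / y"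
    unfolding y_dissect ld_quadratic[OF x_nz] ld_x ..
  also have "ld v = (X + 1 / X) * pull 5 b1 / v"
    unfolding v_dissect ld_quadratic[OF X_nz] ld_X ..
  finally show ?thesis by (simp add: mult_ac)
qed

lemma a1_eq: "a1 = - 2 * z * \<phi> / (1 - k\<^sup>2)"
  unfolding a1_def \<phi>_def using one_minus_k2_nz by (simp add: field_simps del: right_minus_eq)

lemma b1_eq: "b1 = - z * \<psi> / (1 - k\<^sup>2)"
  unfolding b1_def \<psi>_def using one_minus_k2_nz by (simp add: field_simps del: right_minus_eq)

lemma pull5_t1: "1 / pull 5 t1 = X ^ 5 - 11 - 1 / X ^ 5"
proof -
  have "1 / pull 5 t1 = pull 5 (1 / t1)" by (simp add: pull_divide)
  also have "\<dots> = 1 / pull 5 \<kappa> - 11 - pull 5 \<kappa>" unfolding t1_eq by (simp add: pull_divide)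
  also have "pull 5 \<kappa> = 1 / X ^ 5"
    by (simp add: \<kappa>_def X_def pull_divide power_divide)
  finally show ?thesis by simp
qed

lemma pull5_t: "1 / pull 5 t = x ^ 5 - 11 - 1 / x ^ 5"
proof -
  have "1 / pull 5 t = pull 5 (1 / t)" by (simp add: pull_divide)
  also have "\<dots> = 1 / pull 5 \<mu> - 11 - pull 5 \<mu>" unfolding t_eq by (simp add: pull_divide)
  also have "pull 5 \<mu> = 1 / x ^ 5"
    by (simp add: \<mu>_def x_def pull_divide power_divide flip: power_mult)
  finally show ?thesis by simp
qed


text \<open>\<open>quintic_norm\<close> removes the denominator \<open>v\<close>, after which
  \<open>U5\<close> can be applied monomial by monomial.\<close>

lemma quotient_X: "(X + 1 / X) / v = pull 5 t1 *
   (mon 5 0 + mon 4 0 + 3 * mon 3 0 + 4 * mon 2 0 + 7 * mon 1 0 + 7 * mon (-1) 0 - 4 * mon (-2) 0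
     + 3 * mon (-3) 0 - mon (-4) 0 + mon (-5) 0)"
proof -
  have "1 / v = pull 5 t1 * (X ^ 4 + X ^ 3 + 2 * X\<^sup>2 + 3 * X + 5 - 3 / X + 2 / X\<^sup>2 - 1 / X ^ 3 + 1 / X ^ 4)"
    using quintic_norm[OF X_nz] v_nz t1_nz
    unfolding pull5_t1[symmetric] v_dissect[symmetric] by (simp add: field_simps pull_eq_0_iff)
  then have "(X + 1 / X) / v = pull 5 t1 * ((X + 1 / X) * 
      (X ^ 4 + X ^ 3 + 2 * X\<^sup>2 + 3 * X + 5 - 3 / X + 2 / X\<^sup>2 - 1 / X ^ 3 + 1 / X ^ 4))"
    by (simp add: divide_inverse mult_ac)
  also have "(X + 1 / X) * 
      (X ^ 4 + X ^ 3 + 2 * X\<^sup>2 + 3 * X + 5 - 3 / X + 2 / X\<^sup>2 - 1 / X ^ 3 + 1 / X ^ 4) =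
    X ^ 5 + X ^ 4 + 3 * X ^ 3 + 4 * X\<^sup>2 + 7 * X + 7 / X - 4 / X\<^sup>2 + 3 / X ^ 3 - 1 / X ^ 4 + 1 / X ^ 5"
    using X_nz by (simp add: field_simps eval_nat_numeral)
  also have "\<dots> = mon 5 0 + mon 4 0 + 3 * mon 3 0 + 4 * mon 2 0 + 7 * mon 1 0 + 7 * mon (-1) 0 - 4 * mon (-2) 0
     + 3 * mon (-3) 0 - mon (-4) 0 + mon (-5) 0"
    by (simp add: mon_def power_int_minus divide_inverse)
  finally show ?thesis .
qed

lemma quotient_x: "(x + 1 / x) / y = pull 5 t *
   (mon 0 5 + mon 0 4 + 3 * mon 0 3 + 4 * mon 0 2 + 7 * mon 0 1 + 7 * mon 0 (-1) - 4 * mon 0 (-2)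
     + 3 * mon 0 (-3) - mon 0 (-4) + mon 0 (-5))"
proof -
  have "1 / y = pull 5 t * (x ^ 4 + x ^ 3 + 2 * x\<^sup>2 + 3 * x + 5 - 3 / x + 2 / x\<^sup>2 - 1 / x ^ 3 + 1 / x ^ 4)"
    using quintic_norm[OF x_nz] y_nz t_nz
    unfolding pull5_t[symmetric] y_dissect[symmetric] by (simp add: field_simps pull_eq_0_iff)
  then have "(x + 1 / x) / y = pull 5 t * ((x + 1 / x) * 
      (x ^ 4 + x ^ 3 + 2 * x\<^sup>2 + 3 * x + 5 - 3 / x + 2 / x\<^sup>2 - 1 / x ^ 3 + 1 / x ^ 4))"
    by (simp add: divide_inverse mult_ac)
  also have "(x + 1 / x) * 
      (x ^ 4 + x ^ 3 + 2 * x\<^sup>2 + 3 * x + 5 - 3 / x + 2 / x\<^sup>2 - 1 / x ^ 3 + 1 / x ^ 4) =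
    x ^ 5 + x ^ 4 + 3 * x ^ 3 + 4 * x\<^sup>2 + 7 * x + 7 / x - 4 / x\<^sup>2 + 3 / x ^ 3 - 1 / x ^ 4 + 1 / x ^ 5"
    using x_nz by (simp add: field_simps eval_nat_numeral)
  also have "\<dots> = mon 0 5 + mon 0 4 + 3 * mon 0 3 + 4 * mon 0 2 + 7 * mon 0 1 + 7 * mon 0 (-1) - 4 * mon 0 (-2)
     + 3 * mon 0 (-3) - mon 0 (-4) + mon 0 (-5)"
    by (simp add: mon_def power_int_minus divide_inverse)
  finally show ?thesis .
qed

definition "SX = mon 5 0 + mon 4 0 + 3 * mon 3 0 + 4 * mon 2 0 + 7 * mon 1 0 + 7 * mon (-1) 0 - 4 * mon (-2) 0
     + 3 * mon (-3) 0 - mon (-4) 0 + mon (-5) 0"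

lemma y_mon: 
  "y = mon 0 1 - 1 - mon 0 (-1)"
  "y\<^sup>2 = mon 0 2 - 2 * mon 0 1 - 1 + 2 * mon 0 (-1) + mon 0 (-2)"
  "y ^ 3 = mon 0 3 - 3 * mon 0 2 + 5 - 3 * mon 0 (-2) - mon 0 (-3)"
  "y ^ 4 = mon 0 4 - 4 * mon 0 3 + 2 * mon 0 2 + 8 * mon 0 1 - 5 - 8 * mon 0 (-1) + 2 * mon 0 (-2) + 4 * mon 0 (-3) + mon 0 (-4)"
  unfolding y_dissect mon_def using x_nz
  by (simp_all add: power_int_minus field_simps eval_nat_numeral)

lemma x_mon: "x + 1 / x = mon 0 1 + mon 0 (-1)"
  by (simp add: mon_def power_int_minus divide_inverse)

text \<open>In a Laurent polynomial in \<open>x\<close> with exponents between -4 and 4 only the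
  constant term survives \<open>U5\<close>.\<close>

lemma U5_y:
  "U5 y = -1" "U5 (y\<^sup>2) = -1" "U5 (y ^ 3) = 5" "U5 (y ^ 4) = -5"
  unfolding y_mon(2-4) unfolding y_mon(1) by (simp_all add: U5_mon_0)

text \<open>Since \<open>x + 1 / x\<close> is \<open>x\<close> times the derivative of
  \<open>y\<close> with respect to \<open>x\<close>, each product is \<open>x\<close> times the
  derivative of a multiple of a power of \<open>y\<close>, so its constant term is 0. The exponents
  stay between -4 and 4, and no other term survives.\<close>

lemma U5_xy:
  "U5 (x + 1 / x) = 0"
  "U5 ((x + 1 / x) * y) = 0"
  "U5 ((x + 1 / x) * y\<^sup>2) = 0"
  "U5 ((x + 1 / x) * y ^ 3) = 0"
  unfolding y_mon(2-4) unfolding y_mon(1) x_mon by (simp_all add: algebra_simps mon_mult mon_mult' U5_mon_0)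

end

section \<open>The values of \<open>U5\<close> on \<open>E * y ^ j\<close> for \<open>j\<close> from
  0 to 4\<close>

context eta_quintic begin

lemma mon_numeral: "mon a b * (numeral n * h) = numeral n * (mon a b * h)"
  by simp

lemmas U5_mon_num = U5_mon[where c="-3"] U5_mon[where c="-2"] U5_mon[where c="-1"] U5_mon[where c=0]
  U5_mon[where c=1] U5_mon[where c=2] U5_mon[where c=3]

lemma U5_SX: "U5 SX = k * \<rho>\<^sup>2 + 1 / (k * \<rho>\<^sup>2)"
  unfolding SX_def by (simp add: U5_mon_0 U5_mon_num power_int_minus divide_inverse mult.commute)

lemma U5_SX_y: "U5 (SX * y) = 3 / (\<rho> * k) - 4 * \<rho> - 4 / \<rho> - 3 * k * \<rho> - k * \<rho>\<^sup>2 - 1 / (k * \<rho>\<^sup>2)"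
  unfolding y_mon(1) SX_def
  by (simp add: algebra_simps mon_mult U5_mon_0 U5_mon_num power_int_minus divide_inverse)

lemma U5_SX_y2: "U5 (SX * y\<^sup>2) = 7 * k + 1 / \<rho>\<^sup>2 + 8 * \<rho> + 7 / k + 8 / \<rho> + 6 * k * \<rho>
   - \<rho>\<^sup>2 - k * \<rho>\<^sup>2 - 1 / (k * \<rho>\<^sup>2) - 6 / (\<rho> * k)"
  unfolding y_mon(2) SX_def
  by (simp add: algebra_simps mon_mult mon_mult' mon_numeral U5_mon_0 U5_mon_num power_int_minus divide_inverse)

lemma U5_SX_y3: "U5 (SX * y ^ 3) = \<rho> * k\<^sup>2 + 3 * \<rho>\<^sup>2 + 7 * \<rho> / k + 1 / (\<rho> * k\<^sup>2) + 5 * k * \<rho>\<^sup>2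
   + 5 / (k * \<rho>\<^sup>2) - 21 * k - 21 / k - 7 * k / \<rho> - 3 / \<rho>\<^sup>2"
  unfolding y_mon(3) SX_def
  by (simp add: algebra_simps mon_mult mon_mult' mon_numeral U5_mon_0 U5_mon_num power_int_minus divide_inverse)

lemma U5_SX_y4: "U5 (SX * y ^ 4) = 14 * k + 14 / k + 2 / \<rho>\<^sup>2 + 4 / k\<^sup>2 + 28 * k / \<rho> + 3 * k / \<rho>\<^sup>2
   + 24 / (\<rho> * k) + 3 * \<rho>\<^sup>2 / k - 32 * \<rho> - 2 * \<rho>\<^sup>2 - 32 / \<rho> - 4 * k\<^sup>2 - 24 * \<rho> * k - 28 * \<rho> / k
   - 4 * \<rho> * k\<^sup>2 - 5 * k * \<rho>\<^sup>2 - 4 / (\<rho> * k\<^sup>2) - 5 / (k * \<rho>\<^sup>2)"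
  unfolding y_mon(4) SX_def
  by (simp add: algebra_simps mon_mult mon_mult' mon_numeral U5_mon_0 U5_mon_num power_int_minus divide_inverse)

text \<open>\<open>num\<close> and \<open>num5\<close> are the numerators of \<open>coeffE\<close>
  and \<open>coeffE5\<close> over a common denominator. With \<open>cz\<close> factored out, the
  evaluations below reduce to polynomial identities in \<open>k\<close>.\<close>

definition "num = \<phi> * \<psi> * (1 - k\<^sup>2) + 5 * k * (1 - 2 * k) * \<psi> * (1 - k\<^sup>2) + 2 * k\<^sup>2 * \<phi> * \<psi>
  + 5 * k * (4 + 2 * k) * \<phi> * (1 - k\<^sup>2)"
definition "num5 = 5 * \<phi> * \<psi> * (1 - k\<^sup>2) + k * (1 - 2 * k) * \<psi> * (1 - k\<^sup>2) + 10 * k\<^sup>2 * \<phi> * \<psi>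
  + k * (4 + 2 * k) * \<phi> * (1 - k\<^sup>2)"
definition "cz = z / ((1 - k\<^sup>2) * \<phi> * \<psi>)"

lemma E_num: "E = cz * num"
proof -
  have "coeffE = num / ((1 - k\<^sup>2) * \<phi> * \<psi>)"
    unfolding coeffE_def num_def using one_minus_k2_nz \<phi>_nz \<psi>_nz
    by (simp add: field_simps del: right_minus_eq)
  then show ?thesis by (simp add: E_eq cz_def)
qed

lemma E5_num: "E5 = cz * num5 / 5"
proof -
  have "coeffE5 = num5 / ((1 - k\<^sup>2) * \<phi> * \<psi>)"
    unfolding coeffE5_def num5_def using one_minus_k2_nz \<phi>_nz \<psi>_nz
    by (simp add: field_simps del: right_minus_eq)
  then have "5 * E5 = cz * num5" by (simp add: E5_eq cz_def)
  then show ?thesis by (simp add: field_simps)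
qed

lemma E_y_power: "E * y ^ j = 25 * (pull 5 E5 * y ^ j) + 24 * (pull 5 a1 * ((x + 1 / x) / y * y ^ j))
    - 24 * (pull 5 (b1 * t1) * (SX * y ^ j))"
proof -
  have "E * y ^ j = (25 * pull 5 E5 + 24 * pull 5 a1 * ((x + 1 / x) / y) - 24 * pull 5 b1 * (pull 5 t1 * SX)) * y ^ j"
    unfolding E_dissect quotient_X SX_def[symmetric] ..
  then show ?thesis by (simp add: algebra_simps)
qed

lemma b1_t1: "b1 * t1 = - cz * k * (1 - k\<^sup>2)\<^sup>2"
proof -
  have "t1 = (k * (1 - k\<^sup>2)\<^sup>2) / (\<psi>\<^sup>2 * \<phi>)"
    using arg_cong[OF t1_factor, of inverse] by simp
  moreover define M where "M = 1 - k\<^sup>2"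
  moreover have "M \<noteq> 0" using one_minus_k2_nz by (simp add: M_def)
  ultimately show ?thesis unfolding b1_eq cz_def M_def[symmetric] using \<psi>_nz \<phi>_nz
    by (simp add: field_simps power2_eq_square)
qed

text \<open>For positive powers of \<open>y\<close> the denominator of
  \<open>(x + 1 / x) / y\<close> cancels, so the term with \<open>a1\<close> falls under
  \<open>U5_xy\<close> and only the part coming from \<open>X\<close> remains to be
  computed.\<close>

lemma U5_E_y_Suc: "U5 (E * y ^ Suc j) = 25 * E5 * U5 (y ^ Suc j) + 24 * a1 * U5 ((x + 1 / x) * y ^ j)
    + 24 * (cz * k * (1 - k\<^sup>2)\<^sup>2 * U5 (SX * y ^ Suc j))"
proof -
  have "(x + 1 / x) / y * y ^ Suc j = (x + 1 / x) * y ^ j" using y_nz by simp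
  then show ?thesis unfolding E_y_power
    by (simp only: U5_add U5_diff U5_numeral_mult U5_pull_mult b1_t1) (simp add: algebra_simps)
qed

text \<open>\<open>n1\<close> and \<open>p1\<close> serve as atoms while the denominators of
  \<open>\<rho> = n1 / p1\<close> are cleared; they are unfolded only in the final polynomial
  identities.\<close>

definition "n1 = 1 - k"
definition "p1 = 1 + k"
lemma n1_nz: "n1 \<noteq> 0" and p1_nz: "p1 \<noteq> 0" using k_pm_nz by (simp_all add: n1_def p1_def)
lemma one_minus_k2_eq: "1 - k\<^sup>2 = n1 * p1" by (simp add: n1_def p1_def algebra_simps power2_eq_square)
lemma \<rho>_eq: "\<rho> = n1 / p1" by (simp add: \<rho>_def n1_def p1_def)

lemma U5_E_y1: "U5 (E * y) = 25 * E5 - 2 * E"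
proof -
  have "k * (1 - k\<^sup>2)\<^sup>2 * U5 (SX * y) = 3 * p1 ^ 3 * n1 - 4 * k * n1 ^ 3 * p1 - 4 * k * p1 ^ 3 * n1
      - 3 * k\<^sup>2 * n1 ^ 3 * p1 - k\<^sup>2 * n1 ^ 4 - p1 ^ 4"
    unfolding U5_SX_y one_minus_k2_eq \<rho>_eq using n1_nz p1_nz k_nz
    by (simp add: field_simps eval_nat_numeral)
  moreover have "24 * (3 * p1 ^ 3 * n1 - 4 * k * n1 ^ 3 * p1 - 4 * k * p1 ^ 3 * n1
      - 3 * k\<^sup>2 * n1 ^ 3 * p1 - k\<^sup>2 * n1 ^ 4 - p1 ^ 4) = 10 * num5 - 2 * num"
    unfolding num_def num5_def \<phi>_def \<psi>_def n1_def p1_def by algebra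
  ultimately have "24 * (k * (1 - k\<^sup>2)\<^sup>2 * U5 (SX * y)) = 10 * num5 - 2 * num"
    by simp
  then have "24 * (cz * k * (1 - k\<^sup>2)\<^sup>2 * U5 (SX * y)) = 50 * E5 - 2 * E"
    unfolding E_num E5_num by algebra
  then show ?thesis using U5_E_y_Suc[of 0] U5_xy(1) U5_y(1) by simp
qed

lemma U5_E_y2: "U5 (E * y\<^sup>2) = - 25 * E5"
proof -
  have "k * (1 - k\<^sup>2)\<^sup>2 * U5 (SX * y\<^sup>2) = 7 * k\<^sup>2 * n1\<^sup>2 * p1\<^sup>2 + k * p1 ^ 4 + 8 * k * n1 ^ 3 * p1
     + 7 * n1\<^sup>2 * p1\<^sup>2 + 8 * k * n1 * p1 ^ 3 + 6 * k\<^sup>2 * n1 ^ 3 * p1 - k * n1 ^ 4 - k\<^sup>2 * n1 ^ 4 - p1 ^ 4 - 6 * n1 * p1 ^ 3"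
    unfolding U5_SX_y2 one_minus_k2_eq \<rho>_eq using n1_nz p1_nz k_nz
    by (simp add: field_simps eval_nat_numeral)
  also have "\<dots> = 0" unfolding n1_def p1_def by algebra
  finally have "k * (1 - k\<^sup>2)\<^sup>2 * U5 (SX * y\<^sup>2) = 0" .
  then show ?thesis using U5_E_y_Suc[of 1] U5_xy(2) U5_y(2) by (simp add: eval_nat_numeral mult.assoc)
qed

lemma U5_E_y4: "U5 (E * y ^ 4) = - 125 * E5"
proof -
  have "k\<^sup>2 * (1 - k\<^sup>2)\<^sup>2 * U5 (SX * y ^ 4) = 14 * k ^ 3 * n1\<^sup>2 * p1\<^sup>2 + 14 * k * n1\<^sup>2 * p1\<^sup>2 + 2 * k\<^sup>2 * p1 ^ 4
     + 4 * n1\<^sup>2 * p1\<^sup>2 + 28 * k ^ 3 * n1 * p1 ^ 3 + 3 * k ^ 3 * p1 ^ 4 + 24 * k * n1 * p1 ^ 3 + 3 * k * n1 ^ 4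
     - 32 * k\<^sup>2 * n1 ^ 3 * p1 - 2 * k\<^sup>2 * n1 ^ 4 - 32 * k\<^sup>2 * n1 * p1 ^ 3 - 4 * k ^ 4 * n1\<^sup>2 * p1\<^sup>2 - 24 * k ^ 3 * n1 ^ 3 * p1
     - 28 * k * n1 ^ 3 * p1 - 4 * k ^ 4 * n1 ^ 3 * p1 - 5 * k ^ 3 * n1 ^ 4 - 4 * n1 * p1 ^ 3 - 5 * k * p1 ^ 4"
    unfolding U5_SX_y4 one_minus_k2_eq \<rho>_eq using n1_nz p1_nz k_nz
    by (simp add: field_simps eval_nat_numeral)
  also have "\<dots> = 0" unfolding n1_def p1_def by algebra
  finally have "U5 (SX * y ^ 4) = 0" using k_nz one_minus_k2_nz by simp
  then show ?thesis using U5_E_y_Suc[of 3] U5_xy(4) U5_y(4) by (simp add: eval_nat_numeral mult.assoc)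
qed

text \<open>The only exponent with a pole at the cusp: in the application \<open>E - E5\<close>
  starts at \<open>q\<close> and \<open>t\<close> at the square of \<open>q\<close>, so the first
  summand has a simple pole.\<close>

lemma U5_E_y3: "U5 (E * y ^ 3) = (E - E5) / t + 5 * E"
proof -
  define N3 where "N3 = k ^ 4 * n1 ^ 3 * p1 + 3 * k\<^sup>2 * n1 ^ 4 + 7 * k * n1 ^ 3 * p1 + p1 ^ 3 * n1 + 5 * k ^ 3 * n1 ^ 4
     + 5 * k * p1 ^ 4 - 21 * k ^ 3 * n1\<^sup>2 * p1\<^sup>2 - 21 * k * n1\<^sup>2 * p1\<^sup>2 - 7 * k ^ 3 * p1 ^ 3 * n1 - 3 * k\<^sup>2 * p1 ^ 4"
  have "k\<^sup>2 * (1 - k\<^sup>2)\<^sup>2 * U5 (SX * y ^ 3) = N3"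
    unfolding U5_SX_y3 one_minus_k2_eq \<rho>_eq N3_def using n1_nz p1_nz k_nz
    by (simp add: field_simps eval_nat_numeral)
  then have 1: "k * (1 - k\<^sup>2)\<^sup>2 * U5 (SX * y ^ 3) = N3 / k"
    using k_nz by (simp add: field_simps power2_eq_square)
  \<comment> \<open>The claim after inserting \<open>t_factor\<close>, multiplied by
    \<open>5 * k ^ 2 * (1 - k ^ 2)\<close>.\<close>
  have "(5 * num - num5) * (\<psi> * \<phi>\<^sup>2) + 25 * num * (k\<^sup>2 * (1 - k\<^sup>2)) = 125 * num5 * (k\<^sup>2 * (1 - k\<^sup>2)) + 120 * N3 * k * (1 - k\<^sup>2)"
    unfolding num_def num5_def \<phi>_def \<psi>_def N3_def n1_def p1_def by (simp add: algebra_simps eval_nat_numeral)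
  moreover define M where "M = 1 - k\<^sup>2"
  moreover have "M \<noteq> 0" using one_minus_k2_nz by (simp add: M_def)
  ultimately have "25 * num5 + 24 * (N3 / k) = (num - num5 / 5) * (\<psi> * \<phi>\<^sup>2 / (k\<^sup>2 * (1 - k\<^sup>2))) + 5 * num"
    unfolding M_def[symmetric] using k_nz
    by (simp add: divide_simps) (simp add: algebra_simps eval_nat_numeral)
  then have "25 * num5 + 24 * (k * (1 - k\<^sup>2)\<^sup>2 * U5 (SX * y ^ 3)) = (num - num5 / 5) * (1 / t) + 5 * num"
    unfolding 1 t_factor .
  then have "cz * (25 * num5 + 24 * (k * (1 - k\<^sup>2)\<^sup>2 * U5 (SX * y ^ 3))) = cz * ((num - num5 / 5) * (1 / t) + 5 * num)"
    by simp
  then have "125 * E5 + 24 * (cz * k * (1 - k\<^sup>2)\<^sup>2 * U5 (SX * y ^ 3)) = (E - E5) / t + 5 * E"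
    unfolding E_num E5_num by (simp add: algebra_simps diff_divide_distrib)
  then show ?thesis using U5_E_y_Suc[of 2] U5_xy(3) U5_y(3) by (simp add: eval_nat_numeral)
qed

text \<open>At \<open>j = 0\<close> the denominator \<open>y\<close> does not cancel, so the part in
  \<open>x\<close> needs \<open>quotient_x\<close> and the monomials with exponents 5 and -5
  contribute.\<close>

lemma U5_E: "U5 E = 6 * E - 5 * E5"
proof -
  define Sx where "Sx = mon 0 5 + mon 0 4 + 3 * mon 0 3 + 4 * mon 0 2 + 7 * mon 0 1 + 7 * mon 0 (-1) - 4 * mon 0 (-2)
     + 3 * mon 0 (-3) - mon 0 (-4) + mon 0 (-5)"
  have U: "U5 Sx = \<rho> / k\<^sup>2 + k\<^sup>2 / \<rho>"
    by (simp add: Sx_def U5_mon_0 U5_mon_num power_int_minus divide_inverse mult.commute)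
  have t: "t = k\<^sup>2 * (1 - k\<^sup>2) / (\<psi> * \<phi>\<^sup>2)"
    using arg_cong[OF t_factor, of inverse] by simp
  have 1: "k * (1 - k\<^sup>2)\<^sup>2 * U5 SX = k\<^sup>2 * n1 ^ 4 + p1 ^ 4"
    unfolding U5_SX one_minus_k2_eq \<rho>_eq using n1_nz p1_nz k_nz
    by (simp add: field_simps eval_nat_numeral)
  have 2: "a1 * t * (\<rho> / k\<^sup>2 + k\<^sup>2 / \<rho>) = - 2 * cz * (n1\<^sup>2 + k ^ 4 * p1\<^sup>2)"
    unfolding a1_eq t cz_def \<rho>_eq one_minus_k2_eq using n1_nz p1_nz k_nz \<phi>_nz \<psi>_nz
    by (simp add: divide_simps) (simp add: algebra_simps eval_nat_numeral)
  have 3: "5 * num5 - 48 * (n1\<^sup>2 + k ^ 4 * p1\<^sup>2) + 24 * (k\<^sup>2 * n1 ^ 4 + p1 ^ 4) = 6 * num - num5"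
    unfolding num_def num5_def \<phi>_def \<psi>_def n1_def p1_def by algebra
  have "U5 E = 25 * E5 + 24 * (a1 * t * (\<rho> / k\<^sup>2 + k\<^sup>2 / \<rho>)) - 24 * (b1 * t1 * U5 SX)"
    using arg_cong[OF E_y_power[of 0], of U5]
    by (simp only: quotient_x Sx_def[symmetric] power_0 mult_1_right U5_add U5_diff U5_numeral_mult U5_pull_mult U U5_pull mult.assoc)
  also have "\<dots> = cz * (5 * num5 - 48 * (n1\<^sup>2 + k ^ 4 * p1\<^sup>2) + 24 * (k * (1 - k\<^sup>2)\<^sup>2 * U5 SX))"
    unfolding b1_t1 2 E5_num by (simp add: algebra_simps)
  also have "\<dots> = 6 * E - 5 * E5"
    unfolding 1 3 E_num E5_num by (simp add: algebra_simps)
  finally show ?thesis .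
qed

end

section \<open>Divisibility by powers of 5\<close>

definition additive_subgroup :: "complex fls set \<Rightarrow> bool" where
  "additive_subgroup S \<longleftrightarrow> 0 \<in> S \<and> (\<forall>x\<in>S. \<forall>y\<in>S. x + y \<in> S) \<and> (\<forall>x\<in>S. - x \<in> S)"

inductive_set zspan :: "complex fls set \<Rightarrow> complex fls set" for G where
  zspan_0: "0 \<in> zspan G"
| zspan_gen: "g \<in> G \<Longrightarrow> g \<in> zspan G"
| zspan_add: "x \<in> zspan G \<Longrightarrow> y \<in> zspan G \<Longrightarrow> x + y \<in> zspan G"
| zspan_uminus: "x \<in> zspan G \<Longrightarrow> - x \<in> zspan G"

lemma additive_subgroup_zspan: "additive_subgroup (zspan G)"
  unfolding additive_subgroup_def by (blast intro: zspan.intros)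

lemma zspan_linear:
  assumes "\<And>g. g \<in> G \<Longrightarrow> L g \<in> S" "x \<in> zspan G" "additive_subgroup S"
    and "\<And>x y. L (x + y) = L x + L y" "\<And>x. L (- x) = - L x"
  shows "L x \<in> S"
proof -
  have "L 0 + L 0 = L 0" using assms(4)[of 0 0] by simp
  then have "L 0 = 0" by simp
  with assms(2) show ?thesis
    by induction (use assms(1,3,4,5) in \<open>auto simp: additive_subgroup_def\<close>)
qed

lemma additive_subgroup_of_nat: "additive_subgroup S \<Longrightarrow> x \<in> S \<Longrightarrow> of_nat n * x \<in> S"
  by (induction n) (auto simp: additive_subgroup_def algebra_simps)

lemma additive_subgroup_add: "additive_subgroup S \<Longrightarrow> x \<in> S \<Longrightarrow> y \<in> S \<Longrightarrow> x + y \<in> S"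
  by (simp add: additive_subgroup_def)

lemma additive_subgroup_diff: "additive_subgroup S \<Longrightarrow> x \<in> S \<Longrightarrow> y \<in> S \<Longrightarrow> x - y \<in> S"
  unfolding additive_subgroup_def diff_conv_add_uminus by blast

lemma additive_subgroup_scale: "additive_subgroup S \<Longrightarrow> additive_subgroup ((*) h ` S)"
  unfolding additive_subgroup_def
  by (auto simp: image_iff) (metis distrib_left, metis mult_minus_right)

definition int_fls :: "complex fls \<Rightarrow> bool" where
  "int_fls f \<longleftrightarrow> (\<forall>n. f $$ n \<in> \<int>)"

lemma int_fls_0 [simp]: "int_fls 0" by (simp add: int_fls_def)
lemma int_fls_1 [simp]: "int_fls 1" by (simp add: int_fls_def)
lemma int_fls_add: "int_fls f \<Longrightarrow> int_fls g \<Longrightarrow> int_fls (f + g)" by (simp add: int_fls_def)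
lemma int_fls_uminus: "int_fls f \<Longrightarrow> int_fls (- f)" by (simp add: int_fls_def)
lemma int_fls_diff: "int_fls f \<Longrightarrow> int_fls g \<Longrightarrow> int_fls (f - g)" by (simp add: int_fls_def)
lemma int_fls_mult: "int_fls f \<Longrightarrow> int_fls g \<Longrightarrow> int_fls (f * g)"
  unfolding int_fls_def fls_times_nth(2) by (auto intro!: Ints_sum)
lemma int_fls_power: "int_fls f \<Longrightarrow> int_fls (f ^ n)"
  by (induction n) (auto intro: int_fls_mult)
lemma int_fls_numeral: "int_fls (numeral n)"
  by (auto simp: int_fls_def simp flip: fls_const_numeral)
lemma int_fls_qv: "int_fls qv" by (simp add: int_fls_def qv_def)
lemma int_fls_pull: "int_fls f \<Longrightarrow> d > 0 \<Longrightarrow> int_fls (pull d f)"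
  by (simp add: int_fls_def fls_nth_compose_power)
lemma int_fls_deriv: "int_fls f \<Longrightarrow> int_fls (fls_deriv f)"
  by (simp add: int_fls_def)
lemmas int_fls_intros = int_fls_add int_fls_uminus int_fls_diff int_fls_mult int_fls_power
  int_fls_numeral int_fls_qv int_fls_pull int_fls_deriv int_fls_1 int_fls_0


lemma additive_subgroup_int_fls: "additive_subgroup (Collect int_fls)"
  by (auto simp: additive_subgroup_def intro: int_fls_intros)

section \<open>Lattices of polynomials in \<open>t\<close> and \<open>Z\<close> with bounds on the
  orders at 5\<close>

context eta_quintic begin

text \<open>
  The condition \<open>5 j + \<delta> \<le> 2 i + 1\<close> says \<open>i \<ge> \<lfloor>(5 j + \<delta>)/2\<rfloor>\<close>, and \<open>m + \<delta> \<le> 2 i\<close> says \<open>i \<ge> \<lceil>(m + \<delta>)/2\<rceil>\<close>. The constant terms of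
  \<open>\<alpha>\<close> and \<open>\<beta>\<close> in \<open>E \<alpha>(t) + E5 \<beta>(t)\<close> always cancel, which is why they occur only through \<open>D\<close>.
\<close>

definition "M \<delta> = zspan {5 ^ i * t ^ j | i j. 1 \<le> j \<and> 5 * int j + \<delta> \<le> 2 * int i + 1}"
definition "N \<delta> = zspan {5 ^ i * Z ^ m | i m. 1 \<le> m \<and> int m + \<delta> \<le> 2 * int i}"
definition "D = E - E5"
definition "V \<gamma> \<delta> \<epsilon> = zspan ({5 ^ h * D | h. \<gamma> \<le> 2 * int h}
   \<union> {5 ^ i * t ^ j * E | i j. 1 \<le> j \<and> 5 * int j + \<delta> \<le> 2 * int i + 1}
   \<union> {5 ^ i * t ^ j * E5 | i j. 1 \<le> j \<and> 5 * int j + \<epsilon> \<le> 2 * int i + 1})"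

lemma subgroups: "additive_subgroup (M \<delta>)" "additive_subgroup (N \<delta>)" "additive_subgroup (V \<gamma> \<delta> \<epsilon>)"
  "additive_subgroup ((*) 5 ` V \<gamma> \<delta> \<epsilon>)"
  by (auto simp: M_def N_def V_def intro: additive_subgroup_zspan additive_subgroup_scale)

lemma M_gen: "1 \<le> j \<Longrightarrow> 5 * int j + \<delta> \<le> 2 * int i + 1 \<Longrightarrow> 5 ^ i * t ^ j \<in> M \<delta>"
  unfolding M_def by (rule zspan_gen) blast
lemma N_gen: "1 \<le> m \<Longrightarrow> int m + \<delta> \<le> 2 * int i \<Longrightarrow> 5 ^ i * Z ^ m \<in> N \<delta>"
  unfolding N_def by (rule zspan_gen) blast
lemma V_gen_D: "\<gamma> \<le> 2 * int h \<Longrightarrow> 5 ^ h * D \<in> V \<gamma> \<delta> \<epsilon>"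
  unfolding V_def by (rule zspan_gen) blast
lemma V_gen_E: "1 \<le> j \<Longrightarrow> 5 * int j + \<delta> \<le> 2 * int i + 1 \<Longrightarrow> 5 ^ i * t ^ j * E \<in> V \<gamma> \<delta> \<epsilon>"
  unfolding V_def by (rule zspan_gen) blast
lemma V_gen_E5: "1 \<le> j \<Longrightarrow> 5 * int j + \<epsilon> \<le> 2 * int i + 1 \<Longrightarrow> 5 ^ i * t ^ j * E5 \<in> V \<gamma> \<delta> \<epsilon>"
  unfolding V_def by (rule zspan_gen) blast

lemma M_linear:
  assumes "s \<in> M \<delta>" "additive_subgroup S"
    "\<And>i j. 1 \<le> j \<Longrightarrow> 5 * int j + \<delta> \<le> 2 * int i + 1 \<Longrightarrow> L (5 ^ i * t ^ j) \<in> S"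
    "\<And>s s'. L (s + s') = L s + L s'" "\<And>s. L (- s) = - L s"
  shows "L s \<in> S"
  by (rule zspan_linear[OF _ assms(1)[unfolded M_def] assms(2)]) (use assms(3-) in blast)+

lemma N_linear:
  assumes "s \<in> N \<delta>" "additive_subgroup S"
    "\<And>i m. 1 \<le> m \<Longrightarrow> int m + \<delta> \<le> 2 * int i \<Longrightarrow> L (5 ^ i * Z ^ m) \<in> S"
    "\<And>s s'. L (s + s') = L s + L s'" "\<And>s. L (- s) = - L s"
  shows "L s \<in> S"
  by (rule zspan_linear[OF _ assms(1)[unfolded N_def] assms(2)]) (use assms(3-) in blast)+

lemma V_linear:
  assumes "s \<in> V \<gamma> \<delta> \<epsilon>" "additive_subgroup S" "\<And>h. \<gamma> \<le> 2 * int h \<Longrightarrow> L (5 ^ h * D) \<in> S"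
    "\<And>i j. 1 \<le> j \<Longrightarrow> 5 * int j + \<delta> \<le> 2 * int i + 1 \<Longrightarrow> L (5 ^ i * t ^ j * E) \<in> S"
    "\<And>i j. 1 \<le> j \<Longrightarrow> 5 * int j + \<epsilon> \<le> 2 * int i + 1 \<Longrightarrow> L (5 ^ i * t ^ j * E5) \<in> S"
    "\<And>s s'. L (s + s') = L s + L s'" "\<And>s. L (- s) = - L s"
  shows "L s \<in> S"
  by (rule zspan_linear[OF _ assms(1)[unfolded V_def] assms(2)]) (use assms(3-) in blast)+

lemma M_pow5:
  assumes "s \<in> M \<delta>" "\<delta>' \<le> \<delta> + 2 * int n"
  shows "5 ^ n * s \<in> M \<delta>'"
proof (rule M_linear[where L = "\<lambda>s. 5 ^ n * s", OF assms(1) subgroups(1)])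
  fix i j :: nat assume ij: "1 \<le> j" "5 * int j + \<delta> \<le> 2 * int i + 1"
  have "5 ^ (n + i) * t ^ j \<in> M \<delta>'" by (rule M_gen) (use ij assms(2) in auto)
  then show "5 ^ n * (5 ^ i * t ^ j) \<in> M \<delta>'" by (simp add: power_add mult_ac)
qed (simp_all add: algebra_simps)

lemma M_mono: "s \<in> M \<delta> \<Longrightarrow> \<delta>' \<le> \<delta> \<Longrightarrow> s \<in> M \<delta>'"
  using M_pow5[of s \<delta> \<delta>' 0] by simp

lemma M_t:
  assumes "s \<in> M \<delta>" "\<delta>' \<le> \<delta> - 5"
  shows "t * s \<in> M \<delta>'"
proof (rule M_linear[where L = "\<lambda>s. t * s", OF assms(1) subgroups(1)])
  fix i j :: nat assume ij: "1 \<le> j" "5 * int j + \<delta> \<le> 2 * int i + 1"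
  have "5 ^ i * t ^ (Suc j) \<in> M \<delta>'" by (rule M_gen) (use ij assms(2) in auto)
  then show "t * (5 ^ i * t ^ j) \<in> M \<delta>'" by (simp add: mult_ac)
qed (simp_all add: algebra_simps)

text \<open>The second alternative for \<open>\<gamma>'\<close> uses that the exponent of 5 at
  \<open>D\<close> is never negative, however small \<open>\<gamma>\<close> is.\<close>

lemma V_pow5:
  assumes "s \<in> V \<gamma> \<delta> \<epsilon>" "\<gamma>' \<le> \<gamma> + 2 * int n \<or> \<gamma>' \<le> 2 * int n" "\<delta>' \<le> \<delta> + 2 * int n" "\<epsilon>' \<le> \<epsilon> + 2 * int n"
  shows "5 ^ n * s \<in> V \<gamma>' \<delta>' \<epsilon>'"
proof (rule V_linear[where L = "\<lambda>s. 5 ^ n * s", OF assms(1) subgroups(3)])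
  fix h :: nat assume "\<gamma> \<le> 2 * int h"
  then have "5 ^ (n + h) * D \<in> V \<gamma>' \<delta>' \<epsilon>'" by (intro V_gen_D) (use assms(2) in auto)
  then show "5 ^ n * (5 ^ h * D) \<in> V \<gamma>' \<delta>' \<epsilon>'" by (simp add: power_add mult_ac)
next
  fix i j :: nat assume ij: "1 \<le> j" "5 * int j + \<delta> \<le> 2 * int i + 1"
  have "5 ^ (n + i) * t ^ j * E \<in> V \<gamma>' \<delta>' \<epsilon>'" by (rule V_gen_E) (use ij assms(3) in auto)
  then show "5 ^ n * (5 ^ i * t ^ j * E) \<in> V \<gamma>' \<delta>' \<epsilon>'" by (simp add: power_add mult_ac)
next
  fix i j :: nat assume ij: "1 \<le> j" "5 * int j + \<epsilon> \<le> 2 * int i + 1"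
  have "5 ^ (n + i) * t ^ j * E5 \<in> V \<gamma>' \<delta>' \<epsilon>'" by (rule V_gen_E5) (use ij assms(4) in auto)
  then show "5 ^ n * (5 ^ i * t ^ j * E5) \<in> V \<gamma>' \<delta>' \<epsilon>'" by (simp add: power_add mult_ac)
qed (simp_all add: algebra_simps)

lemma V_mono: "s \<in> V \<gamma> \<delta> \<epsilon> \<Longrightarrow> \<gamma>' \<le> \<gamma> \<or> \<gamma>' \<le> 0 \<Longrightarrow> \<delta>' \<le> \<delta> \<Longrightarrow> \<epsilon>' \<le> \<epsilon> \<Longrightarrow> s \<in> V \<gamma>' \<delta>' \<epsilon>'"
  using V_pow5[of s \<gamma> \<delta> \<epsilon> \<gamma>' 0 \<delta>' \<epsilon>'] by simp

text \<open>Multiplication by \<open>t\<close> splits \<open>D\<close> into separate terms in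
  \<open>E\<close> and \<open>E5\<close>; this causes the bounds \<open>\<gamma> - 4\<close>, and it
  leaves \<open>\<gamma>'\<close> free because no term in \<open>D\<close> remains. Other generators
  have \<open>j\<close> raised by one, at a cost of 5.\<close>

lemma V_t:
  assumes "s \<in> V \<gamma> \<delta> \<epsilon>" "\<delta>' \<le> \<gamma> - 4" "\<delta>' \<le> \<delta> - 5" "\<epsilon>' \<le> \<gamma> - 4" "\<epsilon>' \<le> \<epsilon> - 5"
  shows "t * s \<in> V \<gamma>' \<delta>' \<epsilon>'"
proof (rule V_linear[where L = "\<lambda>s. t * s", OF assms(1) subgroups(3)])
  fix h :: nat assume h: "\<gamma> \<le> 2 * int h"
  have "5 ^ h * t ^ 1 * E \<in> V \<gamma>' \<delta>' \<epsilon>'" by (rule V_gen_E) (use h assms in auto)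
  moreover have "5 ^ h * t ^ 1 * E5 \<in> V \<gamma>' \<delta>' \<epsilon>'" by (rule V_gen_E5) (use h assms in auto)
  ultimately have "5 ^ h * t ^ 1 * E - 5 ^ h * t ^ 1 * E5 \<in> V \<gamma>' \<delta>' \<epsilon>'"
    by (rule additive_subgroup_diff[OF subgroups(3)])
  then show "t * (5 ^ h * D) \<in> V \<gamma>' \<delta>' \<epsilon>'" by (simp add: D_def algebra_simps)
next
  fix i j :: nat assume ij: "1 \<le> j" "5 * int j + \<delta> \<le> 2 * int i + 1"
  have "5 ^ i * t ^ Suc j * E \<in> V \<gamma>' \<delta>' \<epsilon>'" by (rule V_gen_E) (use ij assms in auto)
  then show "t * (5 ^ i * t ^ j * E) \<in> V \<gamma>' \<delta>' \<epsilon>'" by (simp add: mult_ac)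
next
  fix i j :: nat assume ij: "1 \<le> j" "5 * int j + \<epsilon> \<le> 2 * int i + 1"
  have "5 ^ i * t ^ Suc j * E5 \<in> V \<gamma>' \<delta>' \<epsilon>'" by (rule V_gen_E5) (use ij assms in auto)
  then show "t * (5 ^ i * t ^ j * E5) \<in> V \<gamma>' \<delta>' \<epsilon>'" by (simp add: mult_ac)
qed (simp_all add: algebra_simps)

text \<open>The three lower bounds are what forces the exponent of 5 to be at least 1 in every
  generator; for the terms with \<open>t\<close> the extreme case is \<open>j = 1\<close>.\<close>

lemma V_div5:
  assumes "s \<in> V \<gamma> \<delta> \<epsilon>" "1 \<le> \<gamma>" "- 2 \<le> \<delta>" "- 2 \<le> \<epsilon>"
  shows "s \<in> (*) 5 ` V (\<gamma> - 2) (\<delta> - 2) (\<epsilon> - 2)"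
proof (rule V_linear[where L = "\<lambda>s. s", OF assms(1) subgroups(4)])
  fix h :: nat assume h: "\<gamma> \<le> 2 * int h"
  with assms(2) obtain h' where h': "h = Suc h'" by (cases h) auto
  have "5 ^ h' * D \<in> V (\<gamma> - 2) (\<delta> - 2) (\<epsilon> - 2)" by (rule V_gen_D) (use h h' in auto)
  then show "5 ^ h * D \<in> (*) 5 ` V (\<gamma> - 2) (\<delta> - 2) (\<epsilon> - 2)" by (force simp: h' mult_ac)
next
  fix i j :: nat assume ij: "1 \<le> j" "5 * int j + \<delta> \<le> 2 * int i + 1"
  with assms(3) obtain i' where i': "i = Suc i'" by (cases i) auto
  have "5 ^ i' * t ^ j * E \<in> V (\<gamma> - 2) (\<delta> - 2) (\<epsilon> - 2)" by (rule V_gen_E) (use ij i' in auto)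
  then show "5 ^ i * t ^ j * E \<in> (*) 5 ` V (\<gamma> - 2) (\<delta> - 2) (\<epsilon> - 2)" by (force simp: i' mult_ac)
next
  fix i j :: nat assume ij: "1 \<le> j" "5 * int j + \<epsilon> \<le> 2 * int i + 1"
  with assms(4) obtain i' where i': "i = Suc i'" by (cases i) auto
  have "5 ^ i' * t ^ j * E5 \<in> V (\<gamma> - 2) (\<delta> - 2) (\<epsilon> - 2)" by (rule V_gen_E5) (use ij i' in auto)
  then show "5 ^ i * t ^ j * E5 \<in> (*) 5 ` V (\<gamma> - 2) (\<delta> - 2) (\<epsilon> - 2)" by (force simp: i' mult_ac)
qed simp_all

lemma M_E_V:
  assumes "s \<in> M \<delta>" shows "E * s \<in> V \<gamma> \<delta> \<epsilon>"
  by (rule M_linear[where L = "\<lambda>s. E * s", OF assms subgroups(3)])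
     (use V_gen_E in \<open>auto simp: algebra_simps\<close>)

lemma N_mult:
  assumes "s \<in> N \<delta>" "s' \<in> N \<delta>'"
  shows "s * s' \<in> N (\<delta> + \<delta>')"
proof (rule N_linear[where L = "\<lambda>s. s * s'", OF assms(1) subgroups(2)])
  fix i m :: nat assume im: "1 \<le> m" "int m + \<delta> \<le> 2 * int i"
  show "5 ^ i * Z ^ m * s' \<in> N (\<delta> + \<delta>')"
  proof (rule N_linear[where L = "\<lambda>s'. 5 ^ i * Z ^ m * s'", OF assms(2) subgroups(2)])
    fix i' m' :: nat assume im': "1 \<le> m'" "int m' + \<delta>' \<le> 2 * int i'"
    have "5 ^ (i + i') * Z ^ (m + m') \<in> N (\<delta> + \<delta>')" by (rule N_gen) (use im im' in auto)
    then show "5 ^ i * Z ^ m * (5 ^ i' * Z ^ m') \<in> N (\<delta> + \<delta>')" by (simp add: power_add mult_ac)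
  qed (simp_all add: algebra_simps)
qed (simp_all add: algebra_simps)

end

text \<open>The left side is invariant under replacing \<open>x\<close> by \<open>- 1 / x\<close>,
  hence a polynomial in \<open>x - 1 / x\<close>. For \<open>y = x - 1 - 1 / x\<close> this is the
  modular equation of degree 5.\<close>

lemma quintic_expand: "(x::'a::field) \<noteq> 0 \<Longrightarrow> x ^ 5 - 11 - 1 / x ^ 5 =
   (x - 1 - 1 / x) ^ 5 + 5 * (x - 1 - 1 / x) ^ 4 + 15 * (x - 1 - 1 / x) ^ 3 + 25 * (x - 1 - 1 / x)\<^sup>2 + 25 * (x - 1 - 1 / x)"
proof -
  assume "x \<noteq> 0"
  define a where "a = 1 / x"
  have a: "x * a = 1" using \<open>x \<noteq> 0\<close> by (simp add: a_def)
  have "x ^ 5 - 11 - a ^ 5 =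
   (x - 1 - a) ^ 5 + 5 * (x - 1 - a) ^ 4 + 15 * (x - 1 - a) ^ 3 + 25 * (x - 1 - a)\<^sup>2 + 25 * (x - 1 - a)"
    using a by algebra
  then show ?thesis by (simp add: a_def power_divide)
qed

section \<open>The modular equation of degree 5 and the resulting bounds for
  \<open>U5\<close>\<close>

context eta_quintic begin

lemma Z_y: "Z * y = 1" by (simp add: y_def Z_nz)

lemma pull5_t_y: "1 / pull 5 t = y ^ 5 + 5 * y ^ 4 + 15 * y ^ 3 + 25 * y\<^sup>2 + 25 * y"
  unfolding pull5_t quintic_expand[OF x_nz] y_dissect[symmetric] ..

text \<open>The modular equation multiplied by \<open>Z ^ 5\<close>; its coefficients are series in
  the fifth power of \<open>q\<close>, which is what makes a recursion for \<open>U5\<close>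
  possible.\<close>

lemma Z_quintic: "Z ^ 5 = pull 5 t * (1 + 5 * Z + 15 * Z\<^sup>2 + 25 * Z ^ 3 + 25 * Z ^ 4)"
proof -
  have "pull 5 t \<noteq> 0" by (simp add: pull_eq_0_iff t_nz)
  then have "1 = pull 5 t * (y ^ 5 + 5 * y ^ 4 + 15 * y ^ 3 + 25 * y\<^sup>2 + 25 * y)"
    unfolding pull5_t_y[symmetric] by simp
  then show ?thesis using Z_y by algebra
qed

text \<open>The factors \<open>pull 10 P\<close> cancel in \<open>t * pull 5 t = Z ^ 6\<close>, and
  the modular equation supplies \<open>1 / pull 5 t\<close>.\<close>

lemma t_Z: "t = Z + 5 * Z\<^sup>2 + 15 * Z ^ 3 + 25 * Z ^ 4 + 25 * Z ^ 5"
proof -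
  have 1: "t = qv ^ 2 * (pull 10 P / pull 2 P) ^ 6"
    by (simp add: t_def t1_def pull_divide pull_pull)
  then have "pull 5 t = qv ^ 10 * (pull 50 P / pull 10 P) ^ 6"
    by (simp add: pull_divide pull_pull flip: power_mult)
  then have "t * pull 5 t = Z ^ 6"
    unfolding 1 Z_def using pull_P_nz[of 10] pull_P_nz[of 2]
    by (simp add: power_divide power_mult_distrib eval_nat_numeral)
  moreover have "pull 5 t \<noteq> 0" by (simp add: pull_eq_0_iff t_nz)
  ultimately have "t = Z ^ 6 * (1 / pull 5 t)" by (simp add: field_simps)
  then have "t = Z ^ 6 * (y ^ 5 + 5 * y ^ 4 + 15 * y ^ 3 + 25 * y\<^sup>2 + 25 * y)"
    unfolding pull5_t_y .
  then show ?thesis using Z_y by algebra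
qed

lemma U5_Z_rec:
  "U5 (h * Z ^ 5) = t * (U5 h + 5 * U5 (h * Z) + 15 * U5 (h * Z\<^sup>2) + 25 * U5 (h * Z ^ 3) + 25 * U5 (h * Z ^ 4))"
proof -
  have "h * Z ^ 5 = pull 5 t * (h + 5 * (h * Z) + 15 * (h * Z\<^sup>2) + 25 * (h * Z ^ 3) + 25 * (h * Z ^ 4))"
    unfolding Z_quintic by (simp add: algebra_simps)
  then show ?thesis by (simp only: U5_pull_mult U5_add U5_numeral_mult)
qed

text \<open>The recursion is run at \<open>h * y ^ 4\<close> down to \<open>h * y\<close>: it climbs
  from the known negative powers of \<open>Z\<close> to the positive ones.\<close>

lemma U5_Z_rec_base:
  "U5 (h * Z) = t * (U5 (h * y ^ 4) + 5 * U5 (h * y ^ 3) + 15 * U5 (h * y\<^sup>2) + 25 * U5 (h * y) + 25 * U5 h)"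
  "U5 (h * Z\<^sup>2) = t * (U5 (h * y ^ 3) + 5 * U5 (h * y\<^sup>2) + 15 * U5 (h * y) + 25 * U5 h + 25 * U5 (h * Z))"
  "U5 (h * Z ^ 3) = t * (U5 (h * y\<^sup>2) + 5 * U5 (h * y) + 15 * U5 h + 25 * U5 (h * Z) + 25 * U5 (h * Z\<^sup>2))"
  "U5 (h * Z ^ 4) = t * (U5 (h * y) + 5 * U5 h + 15 * U5 (h * Z) + 25 * U5 (h * Z\<^sup>2) + 25 * U5 (h * Z ^ 3))"
proof -
  have *: "y ^ 4 * Z ^ 5 = Z" "y ^ 4 * Z = y ^ 3" "y ^ 4 * Z\<^sup>2 = y\<^sup>2" "y ^ 4 * Z ^ 3 = y" "y ^ 4 * Z ^ 4 = 1"
    "y ^ 3 * Z ^ 5 = Z\<^sup>2" "y ^ 3 * Z = y\<^sup>2" "y ^ 3 * Z\<^sup>2 = y" "y ^ 3 * Z ^ 3 = 1" "y ^ 3 * Z ^ 4 = Z"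
    "y\<^sup>2 * Z ^ 5 = Z ^ 3" "y\<^sup>2 * Z = y" "y\<^sup>2 * Z\<^sup>2 = 1" "y\<^sup>2 * Z ^ 3 = Z" "y\<^sup>2 * Z ^ 4 = Z\<^sup>2"
    "y * Z ^ 5 = Z ^ 4" "y * Z = 1" "y * Z\<^sup>2 = Z" "y * Z ^ 3 = Z\<^sup>2" "y * Z ^ 4 = Z ^ 3"
    using Z_y by algebra+
  show "U5 (h * Z) = t * (U5 (h * y ^ 4) + 5 * U5 (h * y ^ 3) + 15 * U5 (h * y\<^sup>2) + 25 * U5 (h * y) + 25 * U5 h)"
    using U5_Z_rec[of "h * y ^ 4"] by (simp only: mult.assoc * mult_1_right)
  show "U5 (h * Z\<^sup>2) = t * (U5 (h * y ^ 3) + 5 * U5 (h * y\<^sup>2) + 15 * U5 (h * y) + 25 * U5 h + 25 * U5 (h * Z))"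
    using U5_Z_rec[of "h * y ^ 3"] by (simp only: mult.assoc * mult_1_right)
  show "U5 (h * Z ^ 3) = t * (U5 (h * y\<^sup>2) + 5 * U5 (h * y) + 15 * U5 h + 25 * U5 (h * Z) + 25 * U5 (h * Z\<^sup>2))"
    using U5_Z_rec[of "h * y\<^sup>2"] by (simp only: mult.assoc * mult_1_right)
  show "U5 (h * Z ^ 4) = t * (U5 (h * y) + 5 * U5 h + 15 * U5 (h * Z) + 25 * U5 (h * Z\<^sup>2) + 25 * U5 (h * Z ^ 3))"
    using U5_Z_rec[of "h * y"] by (simp only: mult.assoc * mult_1_right)
qed

lemma U5_Z:
  "U5 Z = 5 * t"
  "U5 (Z\<^sup>2) = 10 * t + 125 * t\<^sup>2"
  "U5 (Z ^ 3) = 9 * t + 375 * t\<^sup>2 + 3125 * t ^ 3"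
  "U5 (Z ^ 4) = 4 * t + 550 * t\<^sup>2 + 12500 * t ^ 3 + 78125 * t ^ 4"
  "U5 (Z ^ 5) = t + 500 * t\<^sup>2 + 25000 * t ^ 3 + 390625 * t ^ 4 + 1953125 * t ^ 5"
proof -
  note b = U5_Z_rec_base[of 1, unfolded mult_1_left U5_y U5_one]
  show 1: "U5 Z = 5 * t" using b(1) by simp
  show 2: "U5 (Z\<^sup>2) = 10 * t + 125 * t\<^sup>2" using b(2) unfolding 1 by (simp add: algebra_simps power2_eq_square)
  show 3: "U5 (Z ^ 3) = 9 * t + 375 * t\<^sup>2 + 3125 * t ^ 3" using b(3) unfolding 1 2 by (simp add: algebra_simps eval_nat_numeral)
  show 4: "U5 (Z ^ 4) = 4 * t + 550 * t\<^sup>2 + 12500 * t ^ 3 + 78125 * t ^ 4"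
    using b(4) unfolding 1 2 3 by (simp add: algebra_simps eval_nat_numeral)
  show "U5 (Z ^ 5) = t + 500 * t\<^sup>2 + 25000 * t ^ 3 + 390625 * t ^ 4 + 1953125 * t ^ 5"
    using U5_Z_rec[of 1] unfolding mult_1_left 1 2 3 4 U5_one by (simp add: algebra_simps eval_nat_numeral)
qed

lemma U5_E_Z:
  "U5 (E * Z) = 5 * D + 125 * t * E"
  "U5 (E * Z\<^sup>2) = D + 250 * t * E + 3125 * t\<^sup>2 * E"
  "U5 (E * Z ^ 3) = 230 * t * E + 9375 * t\<^sup>2 * E + 78125 * t ^ 3 * E - 125 * t * E5"
  "U5 (E * Z ^ 4) = 128 * t * E + 13875 * t\<^sup>2 * E + 312500 * t ^ 3 * E + 1953125 * t ^ 4 * E - 100 * t * E5 - 3125 * t\<^sup>2 * E5"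
  "U5 (E * Z ^ 5) = 46 * t * E + 13325 * t\<^sup>2 * E + 628125 * t ^ 3 * E + 9765625 * t ^ 4 * E + 48828125 * t ^ 5 * E
     - 45 * t * E5 - 5625 * t\<^sup>2 * E5 - 78125 * t ^ 3 * E5"
proof -
  note b = U5_Z_rec_base[of E, unfolded U5_E U5_E_y1 U5_E_y2 U5_E_y3 U5_E_y4]
  \<comment> \<open>The pole of \<open>U5_E_y3\<close> meets the factor \<open>t\<close> of the
    recursion; this is the origin of the terms in \<open>D\<close>.\<close>
  have T: "t * ((E - E5) / t) = E - E5" using t_nz by simp
  show 1: "U5 (E * Z) = 5 * D + 125 * t * E"
    using b(1) unfolding D_def using T by algebra
  show 2: "U5 (E * Z\<^sup>2) = D + 250 * t * E + 3125 * t\<^sup>2 * E"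
    using b(2) unfolding 1 D_def using T by algebra
  show 3: "U5 (E * Z ^ 3) = 230 * t * E + 9375 * t\<^sup>2 * E + 78125 * t ^ 3 * E - 125 * t * E5"
    using b(3) unfolding 1 2 D_def by algebra
  show 4: "U5 (E * Z ^ 4) = 128 * t * E + 13875 * t\<^sup>2 * E + 312500 * t ^ 3 * E + 1953125 * t ^ 4 * E - 100 * t * E5 - 3125 * t\<^sup>2 * E5"
    using b(4) unfolding 1 2 3 D_def by algebra
  show "U5 (E * Z ^ 5) = 46 * t * E + 13325 * t\<^sup>2 * E + 628125 * t ^ 3 * E + 9765625 * t ^ 4 * E + 48828125 * t ^ 5 * E
     - 45 * t * E5 - 5625 * t\<^sup>2 * E5 - 78125 * t ^ 3 * E5"
    using U5_Z_rec[of E] unfolding 1 2 3 4 U5_E D_def by algebra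
qed

lemma M_term: "1 \<le> j \<Longrightarrow> 5 * int j + \<delta> \<le> 2 * int i + 1 \<Longrightarrow> of_nat n * (5 ^ i * t ^ j) \<in> M \<delta>"
  by (intro additive_subgroup_of_nat subgroups M_gen)

text \<open>Watson's bound. In the recursion the coefficients 1, 5, 15, 25, 25 have order at least
  \<open>i / 2\<close> at 5, which pays for the index shift \<open>i\<close>, while the factor
  \<open>t\<close> costs 5, the distance from \<open>n\<close> to \<open>m\<close>. In the base
  cases each coefficient is written as an integer times a power of 5.\<close>

lemma U5_Z_in_M: "1 \<le> m \<Longrightarrow> U5 (Z ^ m) \<in> M (- 1 - int m)"
proof (induction m rule: less_induct)
  case (less m)
  consider "m = 1" | "m = 2" | "m = 3" | "m = 4" | "m = 5" | "m > 5" using less.prems by linarith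
  then show ?case
  proof cases
    case 1
    have "of_nat 1 * (5 ^ 1 * t ^ 1) \<in> M (- 2)" by (rule M_term) auto
    then show ?thesis by (simp add: 1 U5_Z)
  next
    case 2
    have "of_nat 2 * (5 ^ 1 * t ^ 1) + of_nat 1 * (5 ^ 3 * t ^ 2) \<in> M (- 3)"
      by (intro additive_subgroup_add subgroups M_term) auto
    then show ?thesis by (simp add: 2 U5_Z)
  next
    case 3
    have "of_nat 9 * (5 ^ 0 * t ^ 1) + of_nat 3 * (5 ^ 3 * t ^ 2) + of_nat 1 * (5 ^ 5 * t ^ 3) \<in> M (- 4)"
      by (intro additive_subgroup_add subgroups M_term) auto
    then show ?thesis by (simp add: 3 U5_Z)
  next
    case 4
    have "of_nat 4 * (5 ^ 0 * t ^ 1) + of_nat 22 * (5 ^ 2 * t ^ 2) + of_nat 4 * (5 ^ 5 * t ^ 3) + of_nat 1 * (5 ^ 7 * t ^ 4) \<in> M (- 5)"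
      by (intro additive_subgroup_add subgroups M_term) auto
    then show ?thesis by (simp add: 4 U5_Z)
  next
    case 5
    have "of_nat 1 * (5 ^ 0 * t ^ 1) + of_nat 4 * (5 ^ 3 * t ^ 2) + of_nat 8 * (5 ^ 5 * t ^ 3) + of_nat 1 * (5 ^ 8 * t ^ 4)
       + of_nat 1 * (5 ^ 9 * t ^ 5) \<in> M (- 6)"
      by (intro additive_subgroup_add subgroups M_term) auto
    then show ?thesis by (simp add: 5 U5_Z)
  next
    case 6
    define n where "n = m - 5"
    have m: "m = n + 5" and n: "n \<ge> 1" using 6 by (auto simp: n_def)
    have IH: "U5 (Z ^ (n + i)) \<in> M (- 1 - int n - int i)" if "i < 5" for i
      by (rule M_mono[OF less.IH[of "n + i"]]) (use that n in \<open>auto simp: m\<close>)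
    have S: "5 ^ r * U5 (Z ^ (n + i)) \<in> M (- 1 - int n)" if "i < 5" "i \<le> 2 * r" for i r
      by (rule M_pow5[OF IH]) (use that in auto)
    have "t * (U5 (Z ^ n) + 5 * U5 (Z ^ (n + 1)) + 15 * U5 (Z ^ (n + 2)) + 25 * U5 (Z ^ (n + 3)) + 25 * U5 (Z ^ (n + 4))) \<in> M (- 1 - int m)"
    proof (rule M_t)
      have "5 ^ 0 * U5 (Z ^ (n + 0)) + 5 ^ 1 * U5 (Z ^ (n + 1)) + of_nat 3 * (5 ^ 1 * U5 (Z ^ (n + 2)))
          + 5 ^ 2 * U5 (Z ^ (n + 3)) + 5 ^ 2 * U5 (Z ^ (n + 4)) \<in> M (- 1 - int n)"
        by (intro additive_subgroup_add additive_subgroup_of_nat subgroups S) auto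
      then show "U5 (Z ^ n) + 5 * U5 (Z ^ (n + 1)) + 15 * U5 (Z ^ (n + 2)) + 25 * U5 (Z ^ (n + 3)) + 25 * U5 (Z ^ (n + 4)) \<in> M (- 1 - int n)"
        by simp
    qed (simp add: m)
    then show ?thesis
      using U5_Z_rec[of "Z ^ n"] unfolding m power_add power_one_right by simp
  qed
qed

lemma V_term_D: "\<gamma> \<le> 2 * int i \<Longrightarrow> of_nat n * (5 ^ i * D) \<in> V \<gamma> \<delta> \<epsilon>"
  by (intro additive_subgroup_of_nat subgroups V_gen_D)
lemma V_term_E: "1 \<le> j \<Longrightarrow> 5 * int j + \<delta> \<le> 2 * int i + 1 \<Longrightarrow> of_nat n * (5 ^ i * t ^ j * E) \<in> V \<gamma> \<delta> \<epsilon>"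
  by (intro additive_subgroup_of_nat subgroups V_gen_E)
lemma V_term_E5: "1 \<le> j \<Longrightarrow> 5 * int j + \<epsilon> \<le> 2 * int i + 1 \<Longrightarrow> of_nat n * (5 ^ i * t ^ j * E5) \<in> V \<gamma> \<delta> \<epsilon>"
  by (intro additive_subgroup_of_nat subgroups V_gen_E5)

text \<open>The induction of \<open>U5_Z_in_M\<close> with \<open>E\<close> attached. Among the base
  cases \<open>D\<close> occurs only for \<open>m = 1\<close> and \<open>m = 2\<close>; later it is
  turned into terms with \<open>t\<close> by \<open>V_t\<close>.\<close>

lemma U5_E_Z_in_V: "1 \<le> m \<Longrightarrow> U5 (E * Z ^ m) \<in> V (2 - int m) (- int m) (2 - int m)"
proof (induction m rule: less_induct)
  case (less m)
  consider "m = 1" | "m = 2" | "m = 3" | "m = 4" | "m = 5" | "m > 5" using less.prems by linarith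
  then show ?case
  proof cases
    case 1
    have "of_nat 1 * (5 ^ 1 * D) + of_nat 1 * (5 ^ 3 * t ^ 1 * E) \<in> V 1 (- 1) 1"
      by (intro additive_subgroup_add subgroups V_term_D V_term_E) auto
    then show ?thesis by (simp add: 1 U5_E_Z mult.assoc)
  next
    case 2
    have "of_nat 1 * (5 ^ 0 * D) + of_nat 2 * (5 ^ 3 * t ^ 1 * E) + of_nat 1 * (5 ^ 5 * t ^ 2 * E) \<in> V 0 (- 2) 0"
      by (intro additive_subgroup_add subgroups V_term_D V_term_E) auto
    then show ?thesis by (simp add: 2 U5_E_Z mult.assoc)
  next
    case 3
    have "of_nat 46 * (5 ^ 1 * t ^ 1 * E) + of_nat 3 * (5 ^ 5 * t ^ 2 * E) + of_nat 1 * (5 ^ 7 * t ^ 3 * E)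
       - of_nat 1 * (5 ^ 3 * t ^ 1 * E5) \<in> V (- 1) (- 3) (- 1)"
      by (intro additive_subgroup_add additive_subgroup_diff subgroups V_term_E V_term_E5) auto
    then show ?thesis by (simp add: 3 U5_E_Z mult.assoc)
  next
    case 4
    have "of_nat 128 * (5 ^ 0 * t ^ 1 * E) + of_nat 111 * (5 ^ 3 * t ^ 2 * E) + of_nat 4 * (5 ^ 7 * t ^ 3 * E)
       + of_nat 1 * (5 ^ 9 * t ^ 4 * E) - of_nat 4 * (5 ^ 2 * t ^ 1 * E5) - of_nat 1 * (5 ^ 5 * t ^ 2 * E5) \<in> V (- 2) (- 4) (- 2)"
      by (intro additive_subgroup_add additive_subgroup_diff subgroups V_term_E V_term_E5) auto
    then show ?thesis by (simp add: 4 U5_E_Z mult.assoc)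
  next
    case 5
    have "of_nat 46 * (5 ^ 0 * t ^ 1 * E) + of_nat 533 * (5 ^ 2 * t ^ 2 * E) + of_nat 201 * (5 ^ 5 * t ^ 3 * E)
       + of_nat 1 * (5 ^ 10 * t ^ 4 * E) + of_nat 1 * (5 ^ 11 * t ^ 5 * E)
       - of_nat 9 * (5 ^ 1 * t ^ 1 * E5) - of_nat 9 * (5 ^ 4 * t ^ 2 * E5) - of_nat 1 * (5 ^ 7 * t ^ 3 * E5) \<in> V (- 3) (- 5) (- 3)"
      by (intro additive_subgroup_add additive_subgroup_diff subgroups V_term_E V_term_E5) auto
    then show ?thesis by (simp add: 5 U5_E_Z mult.assoc)
  next
    case 6
    define n where "n = m - 5"
    have m: "m = n + 5" and n: "n \<ge> 1" using 6 by (auto simp: n_def)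
    have IH: "U5 (E * Z ^ (n + i)) \<in> V (2 - int n - int i) (- int n - int i) (2 - int n - int i)" if "i < 5" for i
      by (rule V_mono[OF less.IH[of "n + i"]]) (use that n in \<open>auto simp: m\<close>)
    have S: "5 ^ r * U5 (E * Z ^ (n + i)) \<in> V (2 - int n) (- int n) (2 - int n)" if "i < 5" "i \<le> 2 * r" for i r
      by (rule V_pow5[OF IH]) (use that in auto)
    have "t * (U5 (E * Z ^ n) + 5 * U5 (E * Z ^ (n + 1)) + 15 * U5 (E * Z ^ (n + 2)) + 25 * U5 (E * Z ^ (n + 3)) + 25 * U5 (E * Z ^ (n + 4)))
        \<in> V (2 - int m) (- int m) (2 - int m)"
    proof (rule V_t)
      have "5 ^ 0 * U5 (E * Z ^ (n + 0)) + 5 ^ 1 * U5 (E * Z ^ (n + 1)) + of_nat 3 * (5 ^ 1 * U5 (E * Z ^ (n + 2)))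
          + 5 ^ 2 * U5 (E * Z ^ (n + 3)) + 5 ^ 2 * U5 (E * Z ^ (n + 4)) \<in> V (2 - int n) (- int n) (2 - int n)"
        by (intro additive_subgroup_add additive_subgroup_of_nat subgroups S) auto
      then show "U5 (E * Z ^ n) + 5 * U5 (E * Z ^ (n + 1)) + 15 * U5 (E * Z ^ (n + 2)) + 25 * U5 (E * Z ^ (n + 3)) + 25 * U5 (E * Z ^ (n + 4))
          \<in> V (2 - int n) (- int n) (2 - int n)"
        by simp
    qed (simp_all add: m)
    then show ?thesis
      using U5_Z_rec[of "E * Z ^ n"] unfolding m power_add power_one_right mult.assoc by simp
  qed
qed

end

section \<open>The two alternating steps and divisibility of the series \<open>S n\<close>\<close>

context eta_quintic begin

lemma Z_in_N: "Z \<in> N (- 1)"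
  using N_gen[of 1 "- 1" 0] by simp

text \<open>The coefficients 1, 5, 15, 25, 25 in \<open>t_Z\<close> have order at least
  \<open>(m - 1) / 2\<close> at 5.\<close>

lemma t_in_N: "t \<in> N (- 1)"
proof -
  have "5 ^ 0 * Z ^ 1 + 5 ^ 1 * Z ^ 2 + of_nat 3 * (5 ^ 1 * Z ^ 3) + 5 ^ 2 * Z ^ 4 + 5 ^ 2 * Z ^ 5 \<in> N (- 1)"
    by (intro additive_subgroup_add additive_subgroup_of_nat subgroups N_gen) auto
  then show ?thesis by (simp add: t_Z)
qed

lemma t_power_in_N: "1 \<le> j \<Longrightarrow> t ^ j \<in> N (- int j)"
proof (induction j rule: nat_induct_at_least)
  case base
  then show ?case using t_in_N by simp
next
  case (Suc n)
  then show ?case using N_mult[OF t_in_N Suc.IH] by simp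
qed

text \<open>Powers of \<open>t\<close> are handled through this lemma: they are first rewritten in
  \<open>Z\<close>, where the bounds on \<open>U5 (Z ^ m)\<close> and \<open>U5 (E * Z ^ m)\<close>
  apply.\<close>

lemma U5_N:
  assumes "s \<in> N \<delta>"
  shows "U5 s \<in> M (\<delta> - 1)" "U5 (E * s) \<in> V (2 + \<delta>) \<delta> (2 + \<delta>)"
proof -
  show "U5 s \<in> M (\<delta> - 1)"
  proof (rule N_linear[where L = U5, OF assms subgroups(1)])
    fix i m :: nat assume m: "1 \<le> m" "int m + \<delta> \<le> 2 * int i"
    have "5 ^ i * U5 (Z ^ m) \<in> M (\<delta> - 1)"
      by (rule M_pow5[OF U5_Z_in_M]) (use m in auto)
    then show "U5 (5 ^ i * Z ^ m) \<in> M (\<delta> - 1)"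
      using U5_pull_mult[of "5 ^ i" "Z ^ m"] by simp
  qed simp_all
  show "U5 (E * s) \<in> V (2 + \<delta>) \<delta> (2 + \<delta>)"
  proof (rule N_linear[where L = "\<lambda>s. U5 (E * s)", OF assms subgroups(3)])
    fix i m :: nat assume m: "1 \<le> m" "int m + \<delta> \<le> 2 * int i"
    have "5 ^ i * U5 (E * Z ^ m) \<in> V (2 + \<delta>) \<delta> (2 + \<delta>)"
      by (rule V_pow5[OF U5_E_Z_in_V]) (use m in auto)
    then show "U5 (E * (5 ^ i * Z ^ m)) \<in> V (2 + \<delta>) \<delta> (2 + \<delta>)"
      using U5_pull_mult[of "5 ^ i" "E * Z ^ m"] by (simp add: mult_ac)
  qed (simp_all add: algebra_simps)
qed

lemma U5_pow5: "U5 (5 ^ i * h) = 5 ^ i * U5 h"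
  using U5_pull_mult[of "5 ^ i" h] by simp

lemma U5_E5: "U5 (E5 * h) = E * U5 h"
  unfolding E5_def by (rule U5_pull_mult)

lemma U5_D: "U5 D = 5 * D"
  using U5_E by (simp add: D_def E5_def)

lemma U5_Z_D: "U5 (Z * D) = 5 * (D + 24 * (t * E))"
  using U5_E_Z(1) U5_E5[of Z] U5_Z(1) by (simp add: D_def algebra_simps)

lemma V_div5_mono:
  assumes "s \<in> V \<gamma> \<delta> \<epsilon>" "1 \<le> \<gamma>" "- 2 \<le> \<delta>" "- 2 \<le> \<epsilon>" "\<gamma>' \<le> \<gamma> - 2 \<or> \<gamma>' \<le> 0" "\<delta>' \<le> \<delta> - 2" "\<epsilon>' \<le> \<epsilon> - 2"
  shows "s \<in> (*) 5 ` V \<gamma>' \<delta>' \<epsilon>'"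
  using V_div5[OF assms(1-4)] V_mono[OF _ assms(5-7)] by blast

text \<open>The step without \<open>Z\<close>. Its target is the source of \<open>odd_step\<close>
  and conversely, so the two can alternate forever, each gaining one factor 5. Terms in
  \<open>E5\<close> turn into multiples of \<open>E\<close>, because \<open>E5\<close> is a series
  in the fifth power of \<open>q\<close>.\<close>

lemma even_step:
  assumes "s \<in> V 0 (- 5) 0"
  shows "U5 s \<in> (*) 5 ` V 0 (- 3) (- 1)"
proof (rule V_linear[where L = U5, OF assms subgroups(4)])
  fix h :: nat
  have "5 ^ h * D \<in> V 0 (- 3) (- 1)" by (rule V_gen_D) simp
  then show "U5 (5 ^ h * D) \<in> (*) 5 ` V 0 (- 3) (- 1)"
    unfolding U5_pow5 U5_D by (force simp: mult_ac)
next
  fix i j :: nat assume ij: "1 \<le> j" "5 * int j + - 5 \<le> 2 * int i + 1"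
  define \<gamma> \<delta> where "\<gamma> = 2 - int j + 2 * int i" and "\<delta> = - int j + 2 * int i"
  have "5 ^ i * U5 (E * t ^ j) \<in> V \<gamma> \<delta> \<gamma>"
    by (rule V_pow5[OF U5_N(2)[OF t_power_in_N[OF ij(1)]]]) (auto simp: \<gamma>_def \<delta>_def)
  \<comment> \<open>The extreme case is \<open>j = 1\<close>, \<open>i = 0\<close>, with
    \<open>\<gamma> = 1\<close> and \<open>\<delta> = - 1\<close>. Subtracting 2 gives exactly the
    weights -3 and -1 of the target, and \<open>\<gamma> = 1\<close> still forces a factor 5 at
    \<open>D\<close>.\<close>
  moreover have "1 \<le> \<gamma>" "- 1 \<le> \<delta>" unfolding \<gamma>_def \<delta>_def using ij by presburger+
  ultimately have "5 ^ i * U5 (E * t ^ j) \<in> (*) 5 ` V 0 (- 3) (- 1)"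
    by (elim V_div5_mono) auto
  then show "U5 (5 ^ i * t ^ j * E) \<in> (*) 5 ` V 0 (- 3) (- 1)"
    using U5_pow5[of i "E * t ^ j"] by (simp add: mult_ac)
next
  fix i j :: nat assume ij: "1 \<le> j" "5 * int j + 0 \<le> 2 * int i + 1"
  have "5 ^ i * U5 (t ^ j) \<in> M 2"
    by (rule M_pow5[OF U5_N(1)[OF t_power_in_N[OF ij(1)]]]) (use ij in presburger)
  then have "E * (5 ^ i * U5 (t ^ j)) \<in> V 2 2 2" by (rule M_E_V)
  then have "E * (5 ^ i * U5 (t ^ j)) \<in> (*) 5 ` V 0 (- 3) (- 1)" by (rule V_div5_mono) auto
  then show "U5 (5 ^ i * t ^ j * E5) \<in> (*) 5 ` V 0 (- 3) (- 1)"
    using U5_E5[of "5 ^ i * t ^ j"] U5_pow5[of i "t ^ j"] by (simp add: mult_ac)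
qed simp_all

text \<open>The step with \<open>Z\<close>, whose weight -1 in \<open>N\<close> is made up by the
  stronger weights -3 and -1 of the source.\<close>

lemma odd_step:
  assumes "s \<in> V 0 (- 3) (- 1)"
  shows "U5 (Z * s) \<in> (*) 5 ` V 0 (- 5) 0"
proof (rule V_linear[where L = "\<lambda>s. U5 (Z * s)", OF assms subgroups(4)])
  fix h :: nat
  \<comment> \<open>The term \<open>24 * (t * E)\<close> of \<open>U5_Z_D\<close> has a coefficient
    prime to 5; for \<open>h = 0\<close> it fits because the weight -5 admits \<open>t * E\<close>
    without any power of 5.\<close>
  have "of_nat 1 * (5 ^ h * D) + of_nat 24 * (5 ^ h * t ^ 1 * E) \<in> V 0 (- 5) 0"
    by (intro additive_subgroup_add subgroups V_term_D V_term_E) auto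
  moreover have "U5 (Z * (5 ^ h * D)) = 5 * (of_nat 1 * (5 ^ h * D) + of_nat 24 * (5 ^ h * t ^ 1 * E))"
    using U5_pow5[of h "Z * D"] U5_Z_D by (simp add: algebra_simps)
  ultimately show "U5 (Z * (5 ^ h * D)) \<in> (*) 5 ` V 0 (- 5) 0" by blast
next
  fix i j :: nat assume ij: "1 \<le> j" "5 * int j + - 3 \<le> 2 * int i + 1"
  define \<gamma> \<delta> where "\<gamma> = 1 - int j + 2 * int i" and "\<delta> = - int j - 1 + 2 * int i"
  have "Z * t ^ j \<in> N (- 1 + - int j)" by (rule N_mult[OF Z_in_N t_power_in_N[OF ij(1)]])
  then have "5 ^ i * U5 (E * (Z * t ^ j)) \<in> V \<gamma> \<delta> \<gamma>"
    by (rule V_pow5[OF U5_N(2)]) (auto simp: \<gamma>_def \<delta>_def)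
  moreover have "2 \<le> \<gamma>" "0 \<le> \<delta>" unfolding \<gamma>_def \<delta>_def using ij by presburger+
  ultimately have "5 ^ i * U5 (E * (Z * t ^ j)) \<in> (*) 5 ` V 0 (- 5) 0"
    by (elim V_div5_mono) auto
  then show "U5 (Z * (5 ^ i * t ^ j * E)) \<in> (*) 5 ` V 0 (- 5) 0"
    using U5_pow5[of i "E * (Z * t ^ j)"] by (simp add: mult_ac)
next
  fix i j :: nat assume ij: "1 \<le> j" "5 * int j + - 1 \<le> 2 * int i + 1"
  have "Z * t ^ j \<in> N (- 1 + - int j)" by (rule N_mult[OF Z_in_N t_power_in_N[OF ij(1)]])
  then have "5 ^ i * U5 (Z * t ^ j) \<in> M 0"
    by (rule M_pow5[OF U5_N(1)]) (use ij in presburger)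
  then have "E * (5 ^ i * U5 (Z * t ^ j)) \<in> V 2 0 2" by (rule M_E_V)
  then have "E * (5 ^ i * U5 (Z * t ^ j)) \<in> (*) 5 ` V 0 (- 5) 0" by (rule V_div5_mono) auto
  then show "U5 (Z * (5 ^ i * t ^ j * E5)) \<in> (*) 5 ` V 0 (- 5) 0"
    using U5_E5[of "5 ^ i * (Z * t ^ j)"] U5_pow5[of i "Z * t ^ j"] by (simp add: mult_ac)
qed (simp_all add: algebra_simps)

text \<open>In the application, the generating function of \<open>c\<close>.\<close>

definition "C = E / pull 2 P"

text \<open>The series \<open>S n\<close> belongs to the modulus \<open>5 ^ Suc n\<close>, so even \<open>n\<close> corresponds to the odd powers of 5.\<close>

fun S :: "nat \<Rightarrow> complex fls" where
  "S 0 = U5 (qv\<^sup>2 * C)"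
| "S (Suc n) = (if even n then U5 (S n) else U5 (qv\<^sup>2 * S n))"

text \<open>Multiplying by a pull of \<open>P\<close> clears the denominator of \<open>S n\<close>.
  Since \<open>Z\<close> exchanges \<open>pull 2 P\<close> for \<open>pull 50 P\<close>, and
  \<open>U5\<close> turns \<open>pull 50 P\<close> into \<open>pull 10 P\<close> and then
  \<open>pull 10 P\<close> into \<open>pull 2 P\<close>, the clearing factor alternates with the
  parity of \<open>n\<close>.\<close>

lemma S_in_V:
  "(if even n then pull 10 P * S n else pull 2 P * S n) \<in> (*) (5 ^ Suc n) ` (if even n then V 0 (- 5) 0 else V 0 (- 3) (- 1))"
proof (induction n)
  case 0
  have "pull 50 P = pull 5 (pull 10 P)" by (simp add: pull_pull)
  then have "E * Z = pull 5 (pull 10 P) * (qv\<^sup>2 * C)" by (simp add: Z_def C_def)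
  then have "pull 10 P * S 0 = U5 (E * Z)" by (simp only: U5_pull_mult S.simps)
  also have "\<dots> = 5 * (of_nat 1 * (5 ^ 0 * D) + of_nat 1 * (5 ^ 2 * t ^ 1 * E))"
    unfolding U5_E_Z by simp
  finally have *: "pull 10 P * S 0 = 5 * (of_nat 1 * (5 ^ 0 * D) + of_nat 1 * (5 ^ 2 * t ^ 1 * E))" .
  have "of_nat 1 * (5 ^ 0 * D) + of_nat 1 * (5 ^ 2 * t ^ 1 * E) \<in> V 0 (- 5) 0"
    by (intro additive_subgroup_add subgroups V_term_D V_term_E) auto
  then have "pull 10 P * S 0 \<in> (*) 5 ` V 0 (- 5) 0" unfolding * by (rule imageI)
  then show ?case by (simp only: dvd_0_right if_True power_Suc0_right)
next
  case (Suc n)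
  show ?case
  proof (cases "even n")
    case True
    with Suc.IH obtain s where s: "pull 10 P * S n = 5 ^ Suc n * s" "s \<in> V 0 (- 5) 0"
      by (auto simp del: S.simps)
    have "pull 10 P = pull 5 (pull 2 P)" by (simp add: pull_pull)
    then have "pull 2 P * U5 (S n) = U5 (pull 10 P * S n)" by (simp only: U5_pull_mult)
    also have "\<dots> = 5 ^ Suc n * U5 s" unfolding s by (rule U5_pow5)
    finally have "pull 2 P * U5 (S n) = 5 ^ Suc n * U5 s" .
    moreover obtain s' where "U5 s = 5 * s'" "s' \<in> V 0 (- 3) (- 1)"
      using even_step[OF s(2)] by blast
    ultimately show ?thesis using True by (auto simp: image_iff mult_ac)
  next
    case False
    with Suc.IH obtain s where s: "pull 2 P * S n = 5 ^ Suc n * s" "s \<in> V 0 (- 3) (- 1)"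
      by (auto simp del: S.simps)
    have "pull 50 P = pull 5 (pull 10 P)" by (simp add: pull_pull)
    then have "pull 10 P * U5 (qv\<^sup>2 * S n) = U5 (pull 50 P * (qv\<^sup>2 * S n))" by (simp only: U5_pull_mult)
    also have "pull 50 P * (qv\<^sup>2 * S n) = Z * (pull 2 P * S n)"
      using pull_P_nz[of 2] by (simp add: Z_def)
    also have "U5 \<dots> = 5 ^ Suc n * U5 (Z * s)" unfolding s
      using U5_pow5[of "Suc n" "Z * s"] by (simp only: mult_ac)
    finally have "pull 10 P * U5 (qv\<^sup>2 * S n) = 5 ^ Suc n * U5 (Z * s)" .
    moreover obtain s' where "U5 (Z * s) = 5 * s'" "s' \<in> V 0 (- 5) 0"
      using odd_step[OF s(2)] by blast
    ultimately show ?thesis using False by (auto simp: image_iff mult_ac)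
  qed
qed

lemma qv2_mult_nth: "(qv\<^sup>2 * h) $$ n = h $$ (n - 2)"
  by (simp add: qv_def fls_X_power_times_conv_shift)

text \<open>Each factor \<open>qv ^ 2\<close> shifts by 2, and the shifts accumulate to the sum of
  \<open>2 * 25 ^ i\<close> for \<open>i\<close> from 0 to \<open>l\<close>, which is
  \<open>(5 ^ (2 * l + 2) - 1) / 12\<close>. The step without \<open>qv ^ 2\<close> adds no shift,
  so both parities share this offset.\<close>

lemma S_nth:
  "S (2 * l) $$ n = C $$ (5 ^ (2 * l + 1) * n - (5 ^ (2 * l + 2) - 1) div 12)"
  "S (2 * l + 1) $$ n = C $$ (5 ^ (2 * l + 2) * n - (5 ^ (2 * l + 2) - 1) div 12)"
proof -
  have main: "(\<forall>n. S (2 * l) $$ n = C $$ (5 ^ (2 * l + 1) * n - (5 ^ (2 * l + 2) - 1) div 12))" for l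
  proof (induction l)
    case 0
    then show ?case by (simp add: qv2_mult_nth)
  next
    case (Suc l)
    define a :: int where "a = 5 ^ (2 * l + 2)"
    have "(5 ^ (2 * Suc l + 2) - 1 :: int) = (a - 1) + 12 * (2 * a)"
      by (simp add: a_def)
    then have shift: "(5 ^ (2 * Suc l + 2) - 1) div 12 = (a - 1) div 12 + 2 * a"
      by simp
    have "S (2 * Suc l) $$ n = S (2 * l) $$ (5 * (5 * n - 2))" for n
      by (simp add: qv2_mult_nth)
    moreover have "5 ^ (2 * l + 1) * (5 * (5 * n - 2)) - (5 ^ (2 * l + 2) - 1) div 12
       = 5 ^ (2 * Suc l + 1) * n - (5 ^ (2 * Suc l + 2) - 1) div 12" for n :: int
      unfolding shift by (simp add: a_def algebra_simps)
    ultimately show ?case using Suc.IH by metis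
  qed
  show "S (2 * l) $$ n = C $$ (5 ^ (2 * l + 1) * n - (5 ^ (2 * l + 2) - 1) div 12)" using main by blast
  show "S (2 * l + 1) $$ n = C $$ (5 ^ (2 * l + 2) * n - (5 ^ (2 * l + 2) - 1) div 12)"
    using main[of l] by (simp add: mult_ac)
qed

lemma int_fls_V:
  assumes "int_fls P" "int_fls (1 / P)" "s \<in> V \<gamma> \<delta> \<epsilon>"
  shows "int_fls s"
proof -
  have pull: "int_fls (pull d P / pull d' P)" if "d > 0" "d' > 0" for d d'
  proof -
    have "pull d P / pull d' P = pull d P * pull d' (1 / P)" using that by (simp add: pull_divide)
    then show ?thesis using assms that by (auto intro: int_fls_intros)
  qed
  have t: "int_fls t"
  proof -
    have "t = qv ^ 2 * (pull 10 P / pull 2 P) ^ 6"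
      by (simp add: t_def t1_def pull_divide pull_pull)
    then show ?thesis by (auto intro!: int_fls_intros pull)
  qed
  have ld: "int_fls (ld P)"
  proof -
    have "ld P = qv * fls_deriv P * (1 / P)" by (simp add: ld_def)
    then show ?thesis using int_fls_mult[OF int_fls_mult[OF int_fls_qv int_fls_deriv[OF assms(1)]] assms(2)] by simp
  qed
  have E: "int_fls E" unfolding E_def using ld by (auto intro!: int_fls_intros simp: ld_pull)
  then have E5: "int_fls E5" unfolding E5_def by (auto intro: int_fls_intros)
  have "id s \<in> Collect int_fls"
    by (rule V_linear[where L = id, OF assms(3) additive_subgroup_int_fls])
       (auto simp: D_def intro!: int_fls_intros t E E5)
  then show ?thesis by simp
qed

theorem S_divisible:
  assumes "int_fls P" "int_fls (1 / P)"
  shows "\<exists>s. int_fls s \<and> S n = 5 ^ Suc n * s"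
proof -
  obtain s d where s: "pull d P * S n = 5 ^ Suc n * s" "d > 0" "int_fls s"
    using S_in_V[of n] int_fls_V[OF assms] by (auto split: if_splits simp del: S.simps)
  have "S n = 5 ^ Suc n * (s * pull d (1 / P))"
    using s pull_P_nz[of d] by (simp add: pull_divide field_simps)
  moreover have "int_fls (s * pull d (1 / P))" using s assms by (auto intro: int_fls_intros)
  ultimately show ?thesis by blast
qed

end

section \<open>Expansions at the cusp\<close>

text \<open>Uniform convergence on smaller discs yields holomorphy at 0, termwise logarithmic
  derivatives and convergence of Taylor coefficients.\<close>

lemma qpoch_inf_uniform_limit:
  assumes "0 \<le> r" "r < 1" "a > 0" "b > 0"
  shows "uniform_limit (cball 0 r) (\<lambda>N q. \<Prod>n<N. 1 - q ^ a * (q ^ b) ^ n) (\<lambda>q. qpoch_inf (q ^ a) (q ^ b) :: complex) sequentially"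
proof -
  let ?f = "\<lambda>n q :: complex. 1 - q ^ a * (q ^ b) ^ n"
  have "uniformly_convergent_on (cball 0 r) (\<lambda>N q. \<Sum>n<N. norm (?f n q - 1))"
  proof (rule Weierstrass_m_test'_ev)
    show "\<forall>\<^sub>F n in sequentially. \<forall>q\<in>cball 0 r. norm (norm (?f n q - 1)) \<le> r ^ n"
    proof (intro always_eventually allI ballI)
      fix n and q :: complex assume q: "q \<in> cball 0 r"
      have "norm (norm (?f n q - 1)) = norm q ^ (a + b * n)"
        by (simp add: norm_mult norm_power power_add power_mult)
      also have "\<dots> \<le> norm q ^ n"
        by (rule power_decreasing) (use q assms in \<open>auto simp: trans_le_add2\<close>)
      also have "\<dots> \<le> r ^ n" by (rule power_mono) (use q in auto)
      finally show "norm (norm (?f n q - 1)) \<le> r ^ n" .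
    qed
  qed (use assms in \<open>simp add: summable_geometric\<close>)
  then have "uniformly_convergent_on (cball 0 r) (\<lambda>N q. \<Prod>n<N. ?f n q)"
    by (intro Infinite_Products.uniformly_convergent_on_prod') (auto intro!: continuous_intros)
  then have "uniform_limit (cball 0 r) (\<lambda>N q. \<Prod>n<N. ?f n q) (\<lambda>q. lim (\<lambda>N. \<Prod>n<N. ?f n q)) sequentially"
    by (simp only: uniformly_convergent_uniform_limit_iff)
  moreover have "lim (\<lambda>N. \<Prod>n<N. ?f n q) = qpoch_inf (q ^ a) (q ^ b)" if "q \<in> cball 0 r" for q
    by (rule limI[OF qpoch_inf_LIMSEQ]) (use that assms in \<open>auto intro!: norm_power_lt_1\<close>)
  ultimately show ?thesis
    using uniform_limit_cong'[of "cball 0 r" "\<lambda>N q. \<Prod>n<N. ?f n q" "\<lambda>N q. \<Prod>n<N. ?f n q"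
      "\<lambda>q. lim (\<lambda>N. \<Prod>n<N. ?f n q)" "\<lambda>q. qpoch_inf (q ^ a) (q ^ b)" sequentially] by blast
qed

lemma qpoch_inf_has_fps_expansion:
  assumes "a > 0" "b > 0"
  shows "\<exists>F. (\<lambda>q. qpoch_inf (q ^ a) (q ^ b)) has_fps_expansion F"
proof -
  have "(\<lambda>q::complex. qpoch_inf (q ^ a) (q ^ b)) holomorphic_on ball 0 (1 / 2)"
  proof (rule holomorphic_uniform_limit)
    show "uniform_limit (cball 0 (1 / 2)) (\<lambda>N q. \<Prod>n<N. 1 - q ^ a * (q ^ b) ^ n) (\<lambda>q. qpoch_inf (q ^ a) (q ^ b) :: complex) sequentially"
      by (rule qpoch_inf_uniform_limit) (use assms in auto)
    show "\<forall>\<^sub>F N in sequentially. continuous_on (cball 0 (1 / 2)) (\<lambda>q::complex. \<Prod>n<N. 1 - q ^ a * (q ^ b) ^ n) \<and>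
        (\<lambda>q. \<Prod>n<N. 1 - q ^ a * (q ^ b) ^ n) holomorphic_on ball 0 (1 / 2)"
      by (intro always_eventually allI conjI continuous_intros holomorphic_intros)
  qed simp
  then have "(\<lambda>q::complex. qpoch_inf (q ^ a) (q ^ b)) has_fps_expansion fps_expansion (\<lambda>q. qpoch_inf (q ^ a) (q ^ b)) 0"
    by (intro has_fps_expansion_fps_expansion[of "ball 0 (1 / 2)"]) auto
  then show ?thesis by blast
qed

lemma eulerP_has_fps_expansion: "\<exists>F. eulerP has_fps_expansion F"
  using qpoch_inf_has_fps_expansion[of 1 1] by (simp add: eulerP_def[abs_def])

lemma compose_power_has_fps_expansion:
  fixes f :: "complex \<Rightarrow> complex"
  assumes "f has_fps_expansion F" "d > 0"
  shows "(\<lambda>q. f (q ^ d)) has_fps_expansion (F oo fps_X ^ d)"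
  using has_fps_expansion_compose[OF assms(1), of "\<lambda>q. q ^ d" "fps_X ^ d"] assms(2)
  by (simp add: o_def has_fps_expansion_fps_X_power)

lemma compose_power_has_laurent_expansion:
  fixes f :: "complex \<Rightarrow> complex"
  assumes "f has_fps_expansion F" "d > 0"
  shows "(\<lambda>q. f (q ^ d)) has_laurent_expansion pull d (fps_to_fls F)"
  unfolding fls_compose_power_fps_to_fls[OF assms(2)]
  by (rule has_laurent_expansion_fps[OF compose_power_has_fps_expansion[OF assms]])

lemma eulerP_power_has_fps_expansion: "d > 0 \<Longrightarrow> \<exists>F. (\<lambda>q. eulerP (q ^ d)) has_fps_expansion F"
  using eulerP_has_fps_expansion compose_power_has_fps_expansion by blast

lemma rr_has_fps_expansion: "\<exists>F. rrA has_fps_expansion F" "\<exists>F. rrB has_fps_expansion F"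
proof -
  \<comment> \<open>At \<open>q = 0\<close> the argument \<open>q ^ 5 / q\<^sup>2\<close> hidden in \<open>rrA\<close> is the junk value \<open>0\<close>, which agrees with \<open>q ^ 3\<close>.\<close>
  have eqA: "rrA = (\<lambda>q. eulerP (q ^ 5) * qpoch_inf (q\<^sup>2) (q ^ 5) * qpoch_inf (q ^ 3) (q ^ 5))"
  proof
    fix q show "rrA q = eulerP (q ^ 5) * qpoch_inf (q\<^sup>2) (q ^ 5) * qpoch_inf (q ^ 3) (q ^ 5)"
      by (cases "q = 0") (simp add: rrA_def theta_def eulerP_def, rule rrA_eq)
  qed
  obtain F G H where "(\<lambda>q. eulerP (q ^ 5)) has_fps_expansion F"
    "(\<lambda>q::complex. qpoch_inf (q\<^sup>2) (q ^ 5)) has_fps_expansion G" "(\<lambda>q::complex. qpoch_inf (q ^ 3) (q ^ 5)) has_fps_expansion H"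
    using eulerP_power_has_fps_expansion[of 5] qpoch_inf_has_fps_expansion[of 2 5] qpoch_inf_has_fps_expansion[of 3 5] by auto
  then have "rrA has_fps_expansion F * G * H" unfolding eqA by (intro has_fps_expansion_mult)
  then show "\<exists>F. rrA has_fps_expansion F" ..
  have eqB: "rrB = (\<lambda>q. eulerP (q ^ 5) * qpoch_inf (q ^ 1) (q ^ 5) * qpoch_inf (q ^ 4) (q ^ 5))"
  proof
    fix q show "rrB q = eulerP (q ^ 5) * qpoch_inf (q ^ 1) (q ^ 5) * qpoch_inf (q ^ 4) (q ^ 5)"
      by (cases "q = 0") (simp add: rrB_def theta_def eulerP_def, simp add: rrB_eq)
  qed
  obtain F G H where "(\<lambda>q. eulerP (q ^ 5)) has_fps_expansion F"
    "(\<lambda>q::complex. qpoch_inf (q ^ 1) (q ^ 5)) has_fps_expansion G" "(\<lambda>q::complex. qpoch_inf (q ^ 4) (q ^ 5)) has_fps_expansion H"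
    using eulerP_power_has_fps_expansion[of 5] qpoch_inf_has_fps_expansion[of 1 5] qpoch_inf_has_fps_expansion[of 4 5] by auto
  then have "rrB has_fps_expansion F * G * H" unfolding eqB by (intro has_fps_expansion_mult)
  then show "\<exists>F. rrB has_fps_expansion F" ..
qed

text \<open>The value at 0 is irrelevant to a Laurent expansion, so identities proved only for
  nonzero \<open>q\<close> suffice.\<close>

lemma laurent_identity:
  assumes "f has_laurent_expansion F" "g has_laurent_expansion G" "r > 0"
    and "\<And>q. q \<noteq> 0 \<Longrightarrow> norm q < r \<Longrightarrow> f q = g q"
  shows "F = G"
proof -
  have "eventually (\<lambda>q. f q = g q) (at 0)"
    unfolding eventually_at using assms(3,4) by (intro exI[of _ r]) auto
  then have "g has_laurent_expansion F"
    using has_laurent_expansion_cong[of f g F F] assms(1) by simp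
  then show ?thesis using has_laurent_expansion_unique assms(2) by blast
qed

lemma qv_has_laurent_expansion: "(\<lambda>q. q) has_laurent_expansion qv"
  unfolding qv_def by (rule has_laurent_expansion_fps_X)

lemma eulerP_logderiv:
  assumes "norm q < 1"
  shows "(\<lambda>n. - of_nat (Suc n) * q ^ Suc n / (1 - q ^ Suc n)) sums (q * deriv eulerP q / eulerP q)"
proof -
  obtain r where r: "norm q < r" "r < 1" using assms dense by blast
  have ul: "uniform_limit (ball 0 r) (\<lambda>N q. \<Prod>n<N. 1 - q * q ^ n) eulerP sequentially"
  proof (rule uniform_limit_on_subset)
    have "0 \<le> r" using r norm_ge_zero[of q] by linarith
    then show "uniform_limit (cball 0 r) (\<lambda>N q. \<Prod>n<N. 1 - q * q ^ n) eulerP sequentially"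
      using qpoch_inf_uniform_limit[of r 1 1] r by (simp add: eulerP_def[abs_def])
  qed auto
  have "(\<lambda>n. deriv (\<lambda>q. 1 - q * q ^ n) q / (1 - q * q ^ n)) sums (deriv eulerP q / eulerP q)"
    by (rule logderiv_prodinf_complex_uniform_limit[OF ul])
       (use r assms eulerP_nz in \<open>auto intro!: holomorphic_intros\<close>)
  moreover have "deriv (\<lambda>q::complex. 1 - q * q ^ n) q = - of_nat (Suc n) * q ^ n" for n
  proof (rule DERIV_imp_deriv)
    have "((\<lambda>q::complex. 1 - q * q ^ n) has_field_derivative - (of_nat (Suc n) * q ^ n)) (at q)"
      using DERIV_diff[OF DERIV_const DERIV_power[OF DERIV_ident, of "Suc n" q]] by simp
    then show "((\<lambda>q::complex. 1 - q * q ^ n) has_field_derivative - of_nat (Suc n) * q ^ n) (at q)"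
      by (simp only: mult_minus_left)
  qed
  ultimately have "(\<lambda>n. q * (- of_nat (Suc n) * q ^ n / (1 - q * q ^ n))) sums (q * (deriv eulerP q / eulerP q))"
    by (intro sums_mult) simp
  then show ?thesis by (simp add: mult_ac)
qed

lemma Ints_closed_LIMSEQ:
  fixes X :: "nat \<Rightarrow> complex"
  assumes "X \<longlonglongrightarrow> L" "\<And>n. X n \<in> \<int>"
  shows "L \<in> \<int>"
  using closed_sequentially[OF closed_Ints] assms by blast

text \<open>The coefficients are limits of those of the finite products, which are integers, and the
  integers are closed in the complex plane.\<close>

lemma eulerP_coeff_Ints:
  assumes "eulerP has_fps_expansion F"
  shows "fps_nth F n \<in> \<int>"
proof -
  define f where "f = (\<lambda>N (q::complex). \<Prod>i<N. 1 - q * q ^ i)"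
  define G where "G = (\<lambda>N. \<Prod>i<N. 1 - fps_X * fps_X ^ i :: complex fps)"
  have exp: "f N has_fps_expansion G N" for N
    unfolding f_def G_def by (intro fps_expansion_intros)
  have int: "fps_nth (G N) n \<in> \<int>" for N n
  proof -
    have "\<forall>n. fps_nth (G N) n \<in> \<int>"
    proof (induction N)
      case 0
      then show ?case by (simp add: G_def)
    next
      case (Suc N)
      have "G (Suc N) = G N - G N * fps_X ^ Suc N" by (simp add: G_def algebra_simps)
      then show ?case using Suc by (simp add: fps_X_power_mult_right_nth del: power_Suc)
    qed
    then show ?thesis by blast
  qed
  have "uniform_limit (ball 0 (1 / 2)) f eulerP sequentially"
  proof (rule uniform_limit_on_subset)
    show "uniform_limit (cball 0 (1 / 2)) f eulerP sequentially"
      using qpoch_inf_uniform_limit[of "1 / 2" 1 1] by (simp add: eulerP_def[abs_def] f_def)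
  qed auto
  then have "(\<lambda>N. (deriv ^^ n) (f N) 0) \<longlonglongrightarrow> (deriv ^^ n) eulerP 0"
    by (rule higher_deriv_complex_uniform_limit) (auto simp: f_def intro!: always_eventually holomorphic_intros)
  then have "(\<lambda>N. (deriv ^^ n) (f N) 0 / fact n) \<longlonglongrightarrow> (deriv ^^ n) eulerP 0 / fact n"
    by (intro tendsto_divide) auto
  moreover have "(deriv ^^ n) (f N) 0 / fact n = fps_nth (G N) n" for N
    using fps_nth_fps_expansion[OF exp] by simp
  moreover have "(deriv ^^ n) eulerP 0 / fact n = fps_nth F n"
    using fps_nth_fps_expansion[OF assms] by simp
  ultimately show ?thesis using Ints_closed_LIMSEQ int by metis
qed

lemma fps_inverse_Ints:
  fixes F :: "complex fps"
  assumes "fps_nth F 0 = 1" "\<And>n. fps_nth F n \<in> \<int>"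
  shows "fps_nth (inverse F) n \<in> \<int>"
proof (induction n rule: less_induct)
  case (less n)
  show ?case
  proof (cases "n = 0")
    case False
    then have "fps_nth (inverse F) n + (\<Sum>i=1..n. fps_nth F i * fps_nth (inverse F) (n - i)) = 0"
      using fps_mult_nth[of F "inverse F" n] assms(1) inverse_mult_eq_1'[of F]
      by (simp add: sum.atLeast_Suc_atMost)
    then have "fps_nth (inverse F) n = - (\<Sum>i=1..n. fps_nth F i * fps_nth (inverse F) (n - i))"
      by (simp only: eq_neg_iff_add_eq_0)
    also have "\<dots> \<in> \<int>" by (intro Ints_minus Ints_sum Ints_mult assms(2) less.IH) auto
    finally show ?thesis .
  qed (use assms in simp)
qed

lemma fps_to_fls_integral: "(\<And>n. fps_nth F n \<in> \<int>) \<Longrightarrow> int_fls (fps_to_fls F)"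
  by (simp add: int_fls_def)

text \<open>It turns the hypothesis on \<open>c\<close>, stated over the upper half-plane, into one
  on the punctured unit disc.\<close>

lemma nome_surj: "q \<noteq> 0 \<Longrightarrow> norm q < 1 \<Longrightarrow> \<exists>\<tau>. Im \<tau> > 0 \<and> nome \<tau> = q"
proof -
  assume q: "q \<noteq> 0" "norm q < 1"
  define \<tau> where "\<tau> = Ln q / (2 * of_real pi * \<i>)"
  have "2 * of_real pi * \<i> * \<tau> = Ln q" by (simp add: \<tau>_def)
  then have "nome \<tau> = q" using q by (simp add: nome_def)
  moreover have "norm (nome \<tau>) = exp (- (2 * pi * Im \<tau>))" by (simp add: nome_def)
  then have "exp (- (2 * pi * Im \<tau>)) < 1" using q calculation by simp
  then have "Im \<tau> > 0" by (simp add: zero_less_mult_iff)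
  ultimately show ?thesis by blast
qed

lemma nome_double: "nome (2 * \<tau>) = (nome \<tau>)\<^sup>2"
  by (simp add: nome_def power2_eq_square algebra_simps flip: exp_add)

text \<open>The Lambert series is minus the logarithmic derivative of Euler's product, hence the
  change from -24 to 24.\<close>

lemma eisenstein_E2_eq:
  assumes "norm (nome \<tau>) < 1"
  shows "eisenstein_E2 \<tau> = 1 + 24 * (nome \<tau> * deriv eulerP (nome \<tau>) / eulerP (nome \<tau>))"
proof -
  have "(\<lambda>n. - (- of_nat (Suc n) * nome \<tau> ^ Suc n / (1 - nome \<tau> ^ Suc n))) sums - (nome \<tau> * deriv eulerP (nome \<tau>) / eulerP (nome \<tau>))"
    by (rule sums_minus[OF eulerP_logderiv[OF assms]])
  then have "(\<lambda>n. of_nat (Suc n) * nome \<tau> ^ Suc n / (1 - nome \<tau> ^ Suc n)) sums - (nome \<tau> * deriv eulerP (nome \<tau>) / eulerP (nome \<tau>))"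
    by (simp only: mult_minus_left minus_divide_left[symmetric] minus_minus)
  then show ?thesis unfolding eisenstein_E2_def by (simp only: sums_iff) simp
qed

text \<open>The passage from analysis to algebra: the theta identities become the assumptions of the
  locale for the expansions of \<open>eulerP\<close> and of \<open>rrA / rrB\<close> at 0, and the
  hypothesis on \<open>c\<close> identifies the coefficients of \<open>C\<close>.\<close>

lemma ex_eta_quintic:
  assumes "generates_c c"
  shows "\<exists>P w. eta_quintic P w \<and> int_fls P \<and> int_fls (1 / P) \<and>
    (\<forall>n. (eta_quintic.E P / pull 2 P) $$ int n = of_int (c n))"
proof -
  obtain Pf where Pf: "eulerP has_fps_expansion Pf" using eulerP_has_fps_expansion by blast
  obtain Af Bf where Af: "rrA has_fps_expansion Af" and Bf: "rrB has_fps_expansion Bf" using rr_has_fps_expansion by blast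
  define P A B where "P = fps_to_fls Pf" and "A = fps_to_fls Af" and "B = fps_to_fls Bf"
  note exps = compose_power_has_laurent_expansion[OF Pf, folded P_def] compose_power_has_laurent_expansion[OF Af, folded A_def]
    compose_power_has_laurent_expansion[OF Bf, folded B_def] has_laurent_expansion_fps[OF Pf, folded P_def]
    has_laurent_expansion_fps[OF Af, folded A_def] has_laurent_expansion_fps[OF Bf, folded B_def]
    qv_has_laurent_expansion has_laurent_expansion_mult has_laurent_expansion_divide has_laurent_expansion_power
    has_laurent_expansion_diff has_laurent_expansion_add has_laurent_expansion_numeral has_laurent_expansion_1
  have P0: "fps_nth Pf 0 = 1"
    using has_fps_expansion_imp_0_eq_fps_nth_0[OF Pf] by (simp add: eulerP_def qpoch_inf_def)
  have A0: "fps_nth Af 0 = 1"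
    using has_fps_expansion_imp_0_eq_fps_nth_0[OF Af] by (simp add: rrA_def theta_def qpoch_inf_def)
  have B0: "fps_nth Bf 0 = 1"
    using has_fps_expansion_imp_0_eq_fps_nth_0[OF Bf] by (simp add: rrB_def theta_def qpoch_inf_def)
  have nz: "P \<noteq> 0" "A \<noteq> 0" "B \<noteq> 0"
    using P0 A0 B0 by (auto simp: P_def A_def B_def)
  define w where "w = A / B"
  have eta: "eta_quintic P w"
  proof
    show "P \<noteq> 0" "w \<noteq> 0" using nz by (auto simp: w_def)
    show "P / pull 25 P = pull 5 w - qv - qv\<^sup>2 / pull 5 w"
      unfolding w_def pull_divide[OF zero_less_numeral]
    proof (rule laurent_identity[where r = 1])
      show "(\<lambda>q. eulerP q / eulerP (q ^ 25)) has_laurent_expansion P / pull 25 P"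
        by (intro exps; simp)
      show "(\<lambda>q. rrA (q ^ 5) / rrB (q ^ 5) - q - q\<^sup>2 / (rrA (q ^ 5) / rrB (q ^ 5))) has_laurent_expansion
           pull 5 A / pull 5 B - qv - qv\<^sup>2 / (pull 5 A / pull 5 B)"
        by (intro exps; simp)
      fix q :: complex assume q: "q \<noteq> 0" "norm q < 1"
      have q5: "q ^ 5 \<noteq> 0" "norm (q ^ 5) < 1" using q norm_power_lt_1 by auto
      define a b where "a = rrA (q ^ 5)" and "b = rrB (q ^ 5)"
      have ab: "a \<noteq> 0" "b \<noteq> 0" using rrA_nz rrB_nz q5 by (auto simp: a_def b_def)
      have 1: "eulerP q * eulerP (q ^ 5) = a\<^sup>2 - q * a * b - q\<^sup>2 * b\<^sup>2"
        unfolding a_def b_def by (rule eulerP_dissection[OF q(2,1)])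
      have 2: "a * b = eulerP (q ^ 5) * eulerP (q ^ 25)"
        using rrA_rrB[OF q5(2,1)] by (simp add: a_def b_def flip: power_mult)
      have p: "eulerP (q ^ 5) \<noteq> 0" "eulerP (q ^ 25) \<noteq> 0"
        using eulerP_nz norm_power_lt_1[OF q(2)] by auto
      have "eulerP q / eulerP (q ^ 25) = (eulerP q * eulerP (q ^ 5)) / (eulerP (q ^ 5) * eulerP (q ^ 25))"
        using p by simp
      also have "\<dots> = (a\<^sup>2 - q * a * b - q\<^sup>2 * b\<^sup>2) / (a * b)" unfolding 1 2 ..
      also have "\<dots> = a / b - q - q\<^sup>2 / (a / b)"
        using ab by (simp add: field_simps power2_eq_square)
      finally show "eulerP q / eulerP (q ^ 25) = rrA (q ^ 5) / rrB (q ^ 5) - q - q\<^sup>2 / (rrA (q ^ 5) / rrB (q ^ 5))"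
        unfolding a_def b_def .
    qed simp
    show "(P / pull 5 P) ^ 6 = w ^ 5 - 11 * qv - qv\<^sup>2 / w ^ 5"
      unfolding w_def
    proof (rule laurent_identity[where r = 1])
      show "(\<lambda>q. (eulerP q / eulerP (q ^ 5)) ^ 6) has_laurent_expansion (P / pull 5 P) ^ 6"
        by (intro exps; simp)
      show "(\<lambda>q. (rrA q / rrB q) ^ 5 - 11 * q - q\<^sup>2 / (rrA q / rrB q) ^ 5) has_laurent_expansion
           (A / B) ^ 5 - 11 * qv - qv\<^sup>2 / (A / B) ^ 5"
        by (intro exps; simp)
      fix q :: complex assume q: "q \<noteq> 0" "norm q < 1"
      define a b where "a = rrA q" and "b = rrB q"
      have ab: "a \<noteq> 0" "b \<noteq> 0" using rrA_nz rrB_nz q by (auto simp: a_def b_def)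
      have p: "eulerP (q ^ 5) \<noteq> 0" "eulerP q \<noteq> 0"
        using eulerP_nz norm_power_lt_1[OF q(2)] q by auto
      have 1: "eulerP q ^ 11 = eulerP (q ^ 5) * (a ^ 10 - 11 * q * a ^ 5 * b ^ 5 - q\<^sup>2 * b ^ 10)"
        unfolding a_def b_def by (rule eulerP_norm[OF q(2,1)])
      have 2: "a * b = eulerP q * eulerP (q ^ 5)" unfolding a_def b_def by (rule rrA_rrB[OF q(2,1)])
      have "(eulerP q / eulerP (q ^ 5)) ^ 6 = (eulerP q ^ 11 / eulerP (q ^ 5)) / (eulerP q * eulerP (q ^ 5)) ^ 5"
        using p by (simp add: field_simps eval_nat_numeral)
      also have "\<dots> = (a ^ 10 - 11 * q * a ^ 5 * b ^ 5 - q\<^sup>2 * b ^ 10) / (a * b) ^ 5"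
        unfolding 1 2 using p by simp
      also have "\<dots> = (a / b) ^ 5 - 11 * q - q\<^sup>2 / (a / b) ^ 5"
        using ab by (simp add: field_simps eval_nat_numeral)
      finally show "(eulerP q / eulerP (q ^ 5)) ^ 6 = (rrA q / rrB q) ^ 5 - 11 * q - q\<^sup>2 / (rrA q / rrB q) ^ 5"
        unfolding a_def b_def .
    qed simp
    show "pull 2 w * (1 + qv / (w * (pull 2 w)\<^sup>2)) = w\<^sup>2 * (1 - qv / (w * (pull 2 w)\<^sup>2))"
      unfolding w_def pull_divide[OF zero_less_numeral]
    proof (rule laurent_identity[where r = 1])
      let ?w = "\<lambda>q. rrA q / rrB q" and ?u = "\<lambda>q. rrA (q\<^sup>2) / rrB (q\<^sup>2)"
      show "(\<lambda>q. ?u q * (1 + q / (?w q * (?u q)\<^sup>2))) has_laurent_expansion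
          pull 2 A / pull 2 B * (1 + qv / (A / B * (pull 2 A / pull 2 B)\<^sup>2))"
        by (intro exps; simp)
      show "(\<lambda>q. (?w q)\<^sup>2 * (1 - q / (?w q * (?u q)\<^sup>2))) has_laurent_expansion
          (A / B)\<^sup>2 * (1 - qv / (A / B * (pull 2 A / pull 2 B)\<^sup>2))"
        by (intro exps; simp)
      fix q :: complex assume q: "q \<noteq> 0" "norm q < 1"
      show "?u q * (1 + q / (?w q * (?u q)\<^sup>2)) = (?w q)\<^sup>2 * (1 - q / (?w q * (?u q)\<^sup>2))"
        by (rule level10_identities(1)[OF q(2,1)])
    qed simp
    show "qv / (w * (pull 2 w)\<^sup>2) * (pull 2 P * pull 5 P ^ 5)
           = (1 - (qv / (w * (pull 2 w)\<^sup>2))\<^sup>2) * qv * P * pull 10 P ^ 5"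
      unfolding w_def pull_divide[OF zero_less_numeral]
    proof (rule laurent_identity[where r = 1])
      let ?w = "\<lambda>q. rrA q / rrB q" and ?u = "\<lambda>q. rrA (q\<^sup>2) / rrB (q\<^sup>2)"
      show "(\<lambda>q. q / (?w q * (?u q)\<^sup>2) * (eulerP (q\<^sup>2) * eulerP (q ^ 5) ^ 5)) has_laurent_expansion
          qv / (A / B * (pull 2 A / pull 2 B)\<^sup>2) * (pull 2 P * pull 5 P ^ 5)"
        by (intro exps; simp)
      show "(\<lambda>q. (1 - (q / (?w q * (?u q)\<^sup>2))\<^sup>2) * q * eulerP q * eulerP (q ^ 10) ^ 5) has_laurent_expansion
          (1 - (qv / (A / B * (pull 2 A / pull 2 B)\<^sup>2))\<^sup>2) * qv * P * pull 10 P ^ 5"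
        by (intro exps; simp)
      fix q :: complex assume q: "q \<noteq> 0" "norm q < 1"
      show "q / (?w q * (?u q)\<^sup>2) * (eulerP (q\<^sup>2) * eulerP (q ^ 5) ^ 5)
          = (1 - (q / (?w q * (?u q)\<^sup>2))\<^sup>2) * q * eulerP q * eulerP (q ^ 10) ^ 5"
        by (rule level10_identities(2)[OF q(2,1)])
    qed simp
  qed
  have int: "fps_nth Pf n \<in> \<int>" for n by (rule eulerP_coeff_Ints[OF Pf])
  have intP: "int_fls P" unfolding P_def by (rule fps_to_fls_integral[OF int])
  have "P * fps_to_fls (inverse Pf) = 1"
    unfolding P_def using inverse_mult_eq_1'[of Pf] P0 by (simp flip: fls_times_fps_to_fls)
  then have "1 / P = fps_to_fls (inverse Pf)" using nz(1) by (simp add: field_simps)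
  then have intP': "int_fls (1 / P)" using fps_to_fls_integral[OF fps_inverse_Ints[OF P0 int]] by simp

  have l1: "(\<lambda>q. q * deriv eulerP q / eulerP q) has_laurent_expansion ld P"
    unfolding ld_def by (intro exps has_laurent_expansion_deriv)
  \<comment> \<open>Substituting the square of \<open>q\<close> is available for power series
    expansions only, so \<open>ld P\<close> is first recognised as a power series; this uses that
    \<open>P\<close> has constant term 1.\<close>
  have l2: "(\<lambda>q. q\<^sup>2 * deriv eulerP (q\<^sup>2) / eulerP (q\<^sup>2)) has_laurent_expansion pull 2 (ld P)"
  proof -
    have f: "(\<lambda>q. q * deriv eulerP q / eulerP q) has_fps_expansion fps_X * fps_deriv Pf * inverse Pf"
      unfolding divide_inverse
      by (intro has_fps_expansion_mult has_fps_expansion_fps_X has_fps_expansion_deriv has_fps_expansion_inverse Pf)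
         (simp add: P0)
    have "ld P = fps_to_fls (fps_X * fps_deriv Pf * inverse Pf)"
      using has_laurent_expansion_unique[OF l1 has_laurent_expansion_fps[OF f]] .
    then show ?thesis using compose_power_has_laurent_expansion[OF f, of 2] by simp
  qed
  define h where "h = (\<lambda>q. (1 + 24 * (2 * (q\<^sup>2 * deriv eulerP (q\<^sup>2) / eulerP (q\<^sup>2)) - q * deriv eulerP q / eulerP q)) / eulerP (q\<^sup>2))"
  have "h has_laurent_expansion (1 + 24 * (2 * pull 2 (ld P) - ld P)) / pull 2 P"
    unfolding h_def by (intro exps l1 l2) auto
  moreover have "1 + 24 * (2 * pull 2 (ld P) - ld P) = eta_quintic.E P"
    using ld_pull[of 2 P] by (simp add: eta_quintic.E_def[OF eta])
  ultimately have h: "h has_laurent_expansion eta_quintic.E P / pull 2 P" by simp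
  have sums: "(\<lambda>n. of_int (c n) * q ^ n) sums h q" if q: "q \<noteq> 0" "norm q < 1" for q
  proof -
    obtain \<tau> where \<tau>: "Im \<tau> > 0" "nome \<tau> = q" using nome_surj[OF q] by blast
    have "eisenstein_E2 \<tau> = 1 + 24 * (q * deriv eulerP q / eulerP q)"
      "eisenstein_E2 (2 * \<tau>) = 1 + 24 * (q\<^sup>2 * deriv eulerP (q\<^sup>2) / eulerP (q\<^sup>2))"
      using eisenstein_E2_eq[of \<tau>] eisenstein_E2_eq[of "2 * \<tau>"] \<tau> q norm_power_lt_1[OF q(2), of 2]
      by (simp_all add: nome_double)
    then have "(2 * eisenstein_E2 (2 * \<tau>) - eisenstein_E2 \<tau>) / qpoch_inf (nome \<tau> ^ 2) (nome \<tau> ^ 2) = h q"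
      unfolding h_def \<tau>(2) eulerP_def[of "q\<^sup>2", symmetric] by (simp add: algebra_simps)
    then show ?thesis using assms \<tau> unfolding generates_c_def by metis
  qed
  define C where "C = Abs_fps (\<lambda>n. complex_of_int (c n))"
  \<comment> \<open>The hypothesis says nothing about \<open>q = 0\<close>, which is never a value of \<open>nome\<close>.\<close>
  define h' where "h' = (\<lambda>q. if q = 0 then of_int (c 0) else h q)"
  have "h' has_fps_expansion C"
  proof (rule has_fps_expansionI)
    show "eventually (\<lambda>q. (\<lambda>n. fps_nth C n * q ^ n) sums h' q) (nhds 0)"
    proof (rule eventually_nhds_metric[THEN iffD2], intro exI[of _ 1] conjI allI impI)
      fix q :: complex assume "dist q 0 < 1"
      then show "(\<lambda>n. fps_nth C n * q ^ n) sums h' q"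
        using sums[of q] powser_sums_zero[of "\<lambda>n. complex_of_int (c n)"] by (auto simp: h'_def C_def)
    qed simp
  qed
  then have "fps_to_fls C = eta_quintic.E P / pull 2 P"
    by (intro laurent_identity[OF has_laurent_expansion_fps h, of h' C 1]) (auto simp: h'_def)
  then have "\<forall>n. (eta_quintic.E P / pull 2 P) $$ int n = of_int (c n)"
    by (metis C_def fps_nth_Abs_fps fps_to_fls_nth nat_int of_nat_less_0_iff)
  with eta intP intP' show ?thesis by blast
qed

theorem theorem1p1:
  fixes c :: "nat \<Rightarrow> int" and k n :: nat
  assumes "generates_c c"
    and "k \<ge> 1"
  shows "[c (5 ^ (2 * k - 1) * n + (7 * 5 ^ (2 * k - 1) + 1) div 12) = 0] (mod 5 ^ (2 * k - 1))
       \<and> [c (5 ^ (2 * k) * n + (11 * 5 ^ (2 * k) + 1) div 12) = 0] (mod 5 ^ (2 * k))"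
proof -
  obtain P w where eta: "eta_quintic P w" and int: "int_fls P" "int_fls (1 / P)"
    and C: "\<And>n. (eta_quintic.E P / pull 2 P) $$ int n = of_int (c n)"
    using ex_eta_quintic[OF assms(1)] by blast
  interpret eta_quintic P w by (rule eta)
  obtain l where k: "k = Suc l" using assms(2) by (cases k) auto
  have cong: "[c m = 0] (mod 5 ^ Suc j)" if "S j $$ i = of_int (c m)" for j i m
  proof -
    obtain s where s: "int_fls s" "S j = 5 ^ Suc j * s" using S_divisible[OF int] by blast
    obtain a where a: "s $$ i = of_int a" using s(1) by (auto simp: int_fls_def Ints_def)
    have e: "5 ^ Suc j * s = fls_const (5 ^ Suc j) * s" by (simp only: fls_const_power fls_const_numeral)
    then have "complex_of_int (c m) = of_int (5 ^ Suc j * a)"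
      using that unfolding s(2) e fls_mult_const_nth a by simp
    then have "c m = 5 ^ Suc j * a" by (simp only: of_int_eq_iff)
    then show ?thesis by (simp add: cong_0_iff del: power_Suc)
  qed
  have C': "C $$ int n = of_int (c n)" for n unfolding C_def by (rule C)
  show ?thesis
  proof
    define a :: nat where "a = 5 ^ (2 * k - 1)"
    have a_l: "a = 5 ^ (2 * l + 1)" by (simp add: a_def k)
    obtain d where d: "7 * a + 1 = 12 * d" using index_odd_dvd[OF assms(2)] by (auto simp: a_def elim: dvdE)
    have "7 * int a + 1 = 12 * int d" "(5 ^ (2 * l + 2) :: int) = 5 * int a"
      using arg_cong[OF d, of int] by (simp_all add: a_l)
    moreover from this(1) have "5 * int a - 1 = 12 * (int a - int d)" by (simp add: algebra_simps)
    ultimately have "(5 ^ (2 * l + 2) - 1 :: int) = 12 * (int a - int d)" by simp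
    then have v: "(5 ^ (2 * l + 2) - 1 :: int) div 12 = int a - int d" by simp
    \<comment> \<open>The progression starts at index 1, since index 0 of \<open>S (2 * l)\<close>
      refers to a negative index of \<open>C\<close>. The residue is
      \<open>12 * a - 5 * a = 7 * a\<close>, up to the terms 1 and 12.\<close>
    have "5 ^ (2 * l + 1) * (int n + 1) - (5 ^ (2 * l + 2) - 1) div 12 = int (a * n + d)"
      unfolding v by (simp add: a_l algebra_simps)
    moreover have "(7 * a + 1) div 12 = d" using d by simp
    ultimately have "S (2 * l) $$ (int n + 1) = C $$ (int (a * n + (7 * a + 1) div 12))"
      unfolding S_nth by simp
    then have "[c (a * n + (7 * a + 1) div 12) = 0] (mod 5 ^ Suc (2 * l))"
      unfolding C' by (rule cong)
    then show "[c (5 ^ (2 * k - 1) * n + (7 * 5 ^ (2 * k - 1) + 1) div 12) = 0] (mod 5 ^ (2 * k - 1))"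
      by (simp add: a_def k)
  next
    define b :: nat where "b = 5 ^ (2 * k)"
    have b_l: "b = 5 ^ (2 * l + 2)" by (simp add: b_def k)
    obtain d where d: "11 * b + 1 = 12 * d" using index_even_dvd[of k] by (auto simp: b_def elim: dvdE)
    have "11 * int b + 1 = 12 * int d" "(5 ^ (2 * l + 2) :: int) = int b"
      using arg_cong[OF d, of int] by (simp_all add: b_l)
    moreover from this(1) have "int b - 1 = 12 * (int b - int d)" by (simp add: algebra_simps)
    ultimately have "(5 ^ (2 * l + 2) - 1 :: int) = 12 * (int b - int d)" by simp
    then have v: "(5 ^ (2 * l + 2) - 1 :: int) div 12 = int b - int d" by simp
    \<comment> \<open>The same shift by one; now \<open>12 * b - b\<close> produces the 11.\<close>
    have "5 ^ (2 * l + 2) * (int n + 1) - (5 ^ (2 * l + 2) - 1) div 12 = int (b * n + d)"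
      unfolding v by (simp add: b_l algebra_simps)
    moreover have "(11 * b + 1) div 12 = d" using d by simp
    ultimately have "S (2 * l + 1) $$ (int n + 1) = C $$ (int (b * n + (11 * b + 1) div 12))"
      unfolding S_nth by simp
    then have "[c (b * n + (11 * b + 1) div 12) = 0] (mod 5 ^ Suc (2 * l + 1))"
      unfolding C' by (rule cong)
    then show "[c (5 ^ (2 * k) * n + (11 * 5 ^ (2 * k) + 1) div 12) = 0] (mod 5 ^ (2 * k))"
      by (simp add: b_def k)
  qed
qed

end
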